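(* Consider a RAP-modulated fluid process $\{(R_t,\mathbf{A}_t)\}_{t\ge 0}$ with $n^0=0$. For all $\boldsymbol{\beta}\in\mathfrak{Z}^-$ and $x\ge0$, $$\mathbb{E}_{\boldsymbol{\beta}}\left[\mathbf{O}_x\mathbb{1}\{\tau_-^x<\infty\}\right]=\boldsymbol{\beta}\,e^{(C^-+D^{-+}\Psi)x}.$$
   Context: Setting (RAP-modulated fluid process with $n^0=0$). Elements of state spaces are row vectors; $\mathbf{1}$ is a column vector of ones of appropriate dimension. For $k\in\{+,-\}$ let $n^k\ge 1$, $m^k_1,\dots,m^k_{n^k}\ge1$ be integers, $\eta^k=\sum_i m^k_i$, and split $\mathbb{R}^{\eta^k}$ into $n^k$ consecutive blocks of sizes $m_1^k,\dots,m^k_{n^k}$. For $1\le i\le n^k$ let $\mathfrak{Z}^k_i$ be a subset of $\{\boldsymbol{x}\in\mathbb{R}^{\eta^k}:\boldsymbol{x}$ vanishes outside block $i$ and $\boldsymbol{x}\mathbf{1}=1\}$ which is bounded and minimal, i.e. not contained in any affine subspace of dimension $m^k_i-2$ (the only affine subspace of dimension $-1$ is $\varnothing$). Put $\mathfrak{Z}^k=\bigcup_i\mathfrak{Z}^k_i$; $\mathfrak{Z}^+$ and $\mathfrak{Z}^-$ are regarded as lying in different spaces, hence disjoint. Given are real matrices $C^k_{ij}\in\mathbb{R}^{m^k_i\times m^k_j}$ and $D^{k\ell}_{ij}\in\mathbb{R}^{m^k_i\times m^\ell_j}$ ($\ell\ne k$); let $C^k=(C^k_{ij})_{i,j}\in\mathbb{R}^{\eta^k\times\eta^k}$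 and $D^{k\ell}=(D^{k\ell}_{ij})_{i,j}\in\mathbb{R}^{\eta^k\times\eta^\ell}$ be the full block matrices, $\Gamma^k=\mathrm{diag}(C^k_{11},\dots,C^k_{n^kn^k})$, and let $\widehat C^k_{ij}$ ($i\neq j$), $\widehat D^{k\ell}_{ij}$ be the matrices of the sizes of $C^k$, $D^{k\ell}$ whose $(i,j)$ block is $C^k_{ij}$, $D^{k\ell}_{ij}$ and which are zero elsewhere. Assume $C^k\mathbf{1}+D^{k\ell}\mathbf{1}=\mathbf{0}$ for $k\neq\ell$. The orbit process $\{\mathbf{A}_t\}_{t\ge0}$ is a càdlàg piecewise-deterministic Markov process on $\mathfrak{Z}^+\cup\mathfrak{Z}^-$: with no jumps after $t$ and $\mathbf{A}_t\in\mathfrak{Z}^k$, $\mathbf{A}_{t+r}=\mathbf{A}_te^{\Gamma^kr}/(\mathbf{A}_te^{\Gamma^kr}\mathbf{1})\in\mathfrak{Z}^k$; from a state $\boldsymbol{a}\in\mathfrak{Z}^k_i$ it jumps to $\boldsymbol{a}\widehat C^k_{ij}/(\boldsymbol{a}\widehat C^k_{ij}\mathbf{1})\in\mathfrak{Z}^k_j$ ($j\ne i$) with intensity $\boldsymbol{a}\widehat C^k_{ij}\mathbf{1}\ge0$, and to $\boldsymbol{a}\widehat D^{k\ell}_{ij}/(\boldsymbol{a}\widehat D^{k\ell}_{ij}\mathbf{1})\in\mathfrak{Z}^\ell_j$ ($\ell\neq k$) with intensity $\boldsymbol{a}\widehat D^{k\ell}_{ij}\mathbf{1}\ge0$. It is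 assumed that the data are such that all these intensities are nonnegative and all these points lie in the indicated sets. The level process is $R_t=\int_0^t(\mathbb{1}\{\mathbf{A}_s\in\mathfrak{Z}^+\}-\mathbb{1}\{\mathbf{A}_s\in\mathfrak{Z}^-\})\,\mathrm{d}s$. Nontriviality assumption: for $k\in\{+,-\}$ and all $\boldsymbol{\alpha}\in\mathfrak{Z}^k$, $\mathbb{P}(\mathbf{A}_s\in\mathfrak{Z}^k\ \forall s\in[0,t]\mid\mathbf{A}_0=\boldsymbol{\alpha})\to0$ as $t\to\infty$. $\mathbb{P}_{\boldsymbol{\alpha}},\mathbb{E}_{\boldsymbol{\alpha}}$ denote law and expectation given $\mathbf{A}_0=\boldsymbol{\alpha}$. $\Psi=\lim_{n\to\infty}\Psi_n$, where $\Psi_0=0$ and $\Psi_n=\int_0^\infty e^{C^+y}(D^{+-}+\Psi_{n-1}D^{-+}\Psi_{n-1})e^{C^-y}\,\mathrm{d}y$ for $n\ge1$; equivalently $\Psi$ is the unique matrix with $\mathbb{E}_{\boldsymbol{\alpha}}[\mathbf{A}_{\tau_-}\mathbb{1}\{\tau_-<\infty\}]=\boldsymbol{\alpha}\Psi$ for all $\boldsymbol{\alpha}\in\mathfrak{Z}^+$, where $\tau_-=\inf\{t>0:R_t\le0\}$. For $x\ge0$, $\tau_-^x=\inf\{t\ge0:R_t=-x,\ \mathbf{A}_t\in\mathfrak{Z}^-\}$, and $\mathbf{O}_x=\mathbf{A}_{\tau_-^x}$ if $\tau_-^x<\infty$, $\mathbf{O}_x=\Delta$ (an isolated cemetery state)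 otherwise; $\mathbf{O}_x\mathbb{1}\{\tau_-^x<\infty\}$ is read as $\mathbf{0}$ when $\tau_-^x=\infty$. *)

theory Defs
  imports "HOL-Probability.Probability"
begin

section \<open>Linear algebra\<close>

text \<open>
  Elements of the state spaces are row vectors, multiplied by matrices from the right with \<open>v*\<close>;
  \<open>1 :: real^'n\<close> is the vector of ones, so \<open>a \<bullet> 1\<close> is the sum of the entries of \<open>a\<close>.
  The ring operations that the library puts on \<open>real^'n^'n\<close> are componentwise, so the matrix
  exponential is defined here from the matrix product \<open>**\<close>.
\<close>

definition mexp :: "real^'n^'n \<Rightarrow> real^'n^'n" where
  "mexp M = (\<Sum>k. (1 / fact k) *\<^sub>R (((**) M) ^^ k) (mat 1))"

text \<open>The value is \<open>0\<close> if \<open>v \<bullet> 1 = 0\<close>.\<close>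

definition normalise :: "real^'n \<Rightarrow> real^'n" where
  "normalise v = v /\<^sub>R (v \<bullet> 1)"

text \<open>
  A partition of the coordinates \<open>'p\<close> into blocks is a surjection \<open>b :: 'p \<Rightarrow> 'i\<close>, block \<open>i\<close> being
  \<open>{r. b r = i}\<close>. Thus \<open>'i\<close> stands for the index set \<open>{1..n}\<close> of the blocks (phases), the size of
  block \<open>i\<close> is \<open>card {r. b r = i} \<ge> 1\<close>, and \<open>CARD('p)\<close> is the sum of the block sizes.
  \<open>block_part b c i j M\<close> is \<open>M\<close> with all entries outside block \<open>(i, j)\<close> replaced by \<open>0\<close>.
\<close>

definition block_part ::
    "('p \<Rightarrow> 'i) \<Rightarrow> ('q \<Rightarrow> 'j) \<Rightarrow> 'i \<Rightarrow> 'j \<Rightarrow> real^'q^'p \<Rightarrow> real^'q^'p" where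
  "block_part b c i j M = (\<chi> r s. if b r = i \<and> c s = j then M $ r $ s else 0)"

definition block_diag :: "('p \<Rightarrow> 'i) \<Rightarrow> real^'p^'p \<Rightarrow> real^'p^'p" where
  "block_diag b M = (\<chi> r s. if b r = b s then M $ r $ s else 0)"

text \<open>
  The affine subspaces of dimension \<open>-1\<close> are exactly the empty set, also for \<^const>\<open>aff_dim\<close>.
\<close>

definition phase_sets :: "('p::finite \<Rightarrow> 'i) \<Rightarrow> ('i \<Rightarrow> (real^'p) set) \<Rightarrow> bool" where
  "phase_sets b Z \<longleftrightarrow> surj b \<and>
    (\<forall>i. Z i \<subseteq> {x. (\<forall>r. b r \<noteq> i \<longrightarrow> x $ r = 0) \<and> x \<bullet> 1 = 1} \<and>
         bounded (Z i) \<and>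
         \<not> (\<exists>S. affine S \<and> aff_dim S = int (card {r. b r = i}) - 2 \<and> Z i \<subseteq> S))"

text \<open>
  Admissibility of a jump out of \<open>a\<close> with matrix \<open>M\<close> into \<open>S\<close>. If \<open>a v* M = 0\<close> the intensity is
  zero and there is no jump, hence no target to be constrained. In all other cases
  \<open>normalise (a v* M) \<in> S\<close> is required; for sets \<open>S\<close> of vectors with entries summing to one this
  also excludes that \<open>(a v* M) \<bullet> 1 = 0\<close> while \<open>a v* M \<noteq> 0\<close>, where the target would not be defined.
\<close>

definition jump_ok :: "real^'p \<Rightarrow> real^'q^'p \<Rightarrow> (real^'q) set \<Rightarrow> bool" where
  "jump_ok a M S \<longleftrightarrow> (a v* M) \<bullet> 1 \<ge> 0 \<and> (a v* M \<noteq> 0 \<longrightarrow> normalise (a v* M) \<in> S)"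


section \<open>The local characteristics of the orbit process\<close>

text \<open>
  The state space is the disjoint union of two Euclidean spaces; \<open>Inl\<close> marks \<open>+\<close> and \<open>Inr\<close> marks
  \<open>-\<close>. It carries the sum of the two Borel sigma-algebras.
\<close>

type_synonym ('p, 'm) state = "(real, 'p) vec + (real, 'm) vec"

definition sum_borel :: "('a::topological_space + 'b::topological_space) measure" where
  "sum_borel = sigma UNIV {S. Inl -` S \<in> sets borel \<and> Inr -` S \<in> sets borel}"

definition state_set :: "('i \<Rightarrow> (real^'p) set) \<Rightarrow> ('j \<Rightarrow> (real^'m) set) \<Rightarrow> ('p, 'm) state set" where
  "state_set Zp Zm = Inl ` (\<Union>i. Zp i) \<union> Inr ` (\<Union>j. Zm j)"

definition flow ::
    "('p::finite \<Rightarrow> 'i) \<Rightarrow> ('m::finite \<Rightarrow> 'j) \<Rightarrow> real^'p^'p \<Rightarrow> real^'m^'m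
     \<Rightarrow> ('p, 'm) state \<Rightarrow> real \<Rightarrow> ('p, 'm) state" where
  "flow bp bm Cp Cm y r =
    (case y of
       Inl a \<Rightarrow> Inl (normalise (a v* mexp (r *\<^sub>R block_diag bp Cp)))
     | Inr a \<Rightarrow> Inr (normalise (a v* mexp (r *\<^sub>R block_diag bm Cm))))"

text \<open>
  \<open>jump_rate \<dots> y B\<close> is the total intensity of the jumps from \<open>y\<close> to targets in \<open>B\<close>. For a state
  in phase \<open>i\<close> only the summands with first index \<open>i\<close> contribute, as the state vanishes outside
  block \<open>i\<close>.
\<close>

definition jump_rate ::
    "('p::finite \<Rightarrow> 'i::finite) \<Rightarrow> ('m::finite \<Rightarrow> 'j::finite)
     \<Rightarrow> real^'p^'p \<Rightarrow> real^'m^'m \<Rightarrow> real^'m^'p \<Rightarrow> real^'p^'m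
     \<Rightarrow> ('p, 'm) state \<Rightarrow> ('p, 'm) state set \<Rightarrow> real" where
  "jump_rate bp bm Cp Cm Dpm Dmp y B =
    (case y of
       Inl a \<Rightarrow>
         (\<Sum>(i, j)\<in>{(i, j). i \<noteq> j}.
            ((a v* block_part bp bp i j Cp) \<bullet> 1)
              * indicator B (Inl (normalise (a v* block_part bp bp i j Cp)))) +
         (\<Sum>(i, j)\<in>UNIV.
            ((a v* block_part bp bm i j Dpm) \<bullet> 1)
              * indicator B (Inr (normalise (a v* block_part bp bm i j Dpm))))
     | Inr a \<Rightarrow>
         (\<Sum>(i, j)\<in>{(i, j). i \<noteq> j}.
            ((a v* block_part bm bm i j Cm) \<bullet> 1)
              * indicator B (Inr (normalise (a v* block_part bm bm i j Cm)))) +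
         (\<Sum>(i, j)\<in>UNIV.
            ((a v* block_part bm bp i j Dmp) \<bullet> 1)
              * indicator B (Inl (normalise (a v* block_part bm bp i j Dmp)))))"


section \<open>The process\<close>

text \<open>
  \<open>post_jump A T n\<close> is the state at the \<open>n\<close>-th jump time \<open>T n\<close> (irrelevant where \<open>T n = \<infinity>\<close>), and
  \<open>jump_history\<close> the sigma-algebra generated by the first \<open>n\<close> jump times and the states at them.
\<close>

definition post_jump ::
    "(real \<Rightarrow> 'w \<Rightarrow> ('p, 'm) state) \<Rightarrow> (nat \<Rightarrow> 'w \<Rightarrow> ereal) \<Rightarrow> nat \<Rightarrow> 'w \<Rightarrow> ('p, 'm) state" where
  "post_jump A T n \<omega> = A (real_of_ereal (T n \<omega>)) \<omega>"

definition jump_history ::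
    "'w measure \<Rightarrow> (real \<Rightarrow> 'w \<Rightarrow> ('p::finite, 'm::finite) state) \<Rightarrow> (nat \<Rightarrow> 'w \<Rightarrow> ereal)
     \<Rightarrow> nat \<Rightarrow> 'w measure" where
  "jump_history F A T n =
    vimage_algebra (space F) (\<lambda>\<omega>. \<lambda>l\<in>{..n}. (T l \<omega>, post_jump A T l \<omega>))
      (\<Pi>\<^sub>M l\<in>{..n}. borel \<Otimes>\<^sub>M sum_borel)"

definition level ::
    "('i \<Rightarrow> (real^'p) set) \<Rightarrow> ('j \<Rightarrow> (real^'m) set) \<Rightarrow> (real \<Rightarrow> 'w \<Rightarrow> ('p, 'm) state)
     \<Rightarrow> real \<Rightarrow> 'w \<Rightarrow> real" where
  "level Zp Zm A t \<omega> =
    (LBINT s:{0..t}. indicator (Inl ` (\<Union>i. Zp i)) (A s \<omega>) - indicator (Inr ` (\<Union>j. Zm j)) (A s \<omega>))"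

text \<open>
  The locale describes a RAP-modulated fluid process: \<open>F\<close> provides the measurable space, \<open>P \<alpha>\<close> is
  the law given that the orbit process \<open>A\<close> starts in \<open>\<alpha>\<close>, and \<open>T\<close> is the sequence of jump times of
  \<open>A\<close>, with \<open>T 0 = 0\<close>. If there are only finitely many jumps, the later jump times are \<open>\<infinity>\<close>.
  The level process is \<^const>\<open>level\<close>.

  That \<open>A\<close> is a piecewise-deterministic Markov process with the given flow, jump intensities and
  jump targets is expressed as in Davis's construction of these processes. Between jumps \<open>A\<close>
  follows the flow, and \<open>T n\<close> tends to \<open>\<infinity>\<close>, so that the paths are cadlag. Given the history up to
  \<open>T n < \<infinity>\<close>, with \<open>y\<close> the state at that time, the conditional probability of
  \<open>T (Suc n) - T n \<le> t\<close> together with a jump into \<open>B\<close> is the integral over \<open>s \<in> [0, t]\<close> of the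
  probability \<open>exp (- \<integral>\<^sub>0\<^sup>s q (y\<^sub>r) dr)\<close> of no jump before time \<open>s\<close>, times the intensity of
  a jump from \<open>y\<^sub>s\<close> into \<open>B\<close>. Here \<open>y\<^sub>r\<close> is the flow from \<open>y\<close> and \<open>q\<close> is the total intensity.

  In \<open>flow_p\<close> and \<open>flow_m\<close> membership implies that the normalising constant is nonzero, as
  \<open>normalise v = 0\<close> otherwise.
\<close>

locale rap_fluid =
  fixes bp :: "'p::finite \<Rightarrow> 'i::finite" and bm :: "'m::finite \<Rightarrow> 'j::finite"
    and Zp :: "'i \<Rightarrow> (real^'p) set" and Zm :: "'j \<Rightarrow> (real^'m) set"
    and Cp :: "real^'p^'p" and Cm :: "real^'m^'m"
    and Dpm :: "real^'m^'p" and Dmp :: "real^'p^'m"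
    and F :: "'w measure" and P :: "('p, 'm) state \<Rightarrow> 'w measure"
    and A :: "real \<Rightarrow> 'w \<Rightarrow> ('p, 'm) state" and T :: "nat \<Rightarrow> 'w \<Rightarrow> ereal"
  assumes phase_sets_p: "phase_sets bp Zp"
    and phase_sets_m: "phase_sets bm Zm"
    and row_sums_p: "Cp *v 1 + Dpm *v 1 = 0"
    and row_sums_m: "Cm *v 1 + Dmp *v 1 = 0"
    and flow_p: "\<And>a r. \<lbrakk>a \<in> (\<Union>i. Zp i); r \<ge> 0\<rbrakk> \<Longrightarrow>
      normalise (a v* mexp (r *\<^sub>R block_diag bp Cp)) \<in> (\<Union>i. Zp i)"
    and flow_m: "\<And>a r. \<lbrakk>a \<in> (\<Union>j. Zm j); r \<ge> 0\<rbrakk> \<Longrightarrow>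
      normalise (a v* mexp (r *\<^sub>R block_diag bm Cm)) \<in> (\<Union>j. Zm j)"
    and jump_pp: "\<And>a i j. \<lbrakk>a \<in> Zp i; j \<noteq> i\<rbrakk> \<Longrightarrow> jump_ok a (block_part bp bp i j Cp) (Zp j)"
    and jump_mm: "\<And>a i j. \<lbrakk>a \<in> Zm i; j \<noteq> i\<rbrakk> \<Longrightarrow> jump_ok a (block_part bm bm i j Cm) (Zm j)"
    and jump_pm: "\<And>a i j. a \<in> Zp i \<Longrightarrow> jump_ok a (block_part bp bm i j Dpm) (Zm j)"
    and jump_mp: "\<And>a i j. a \<in> Zm i \<Longrightarrow> jump_ok a (block_part bm bp i j Dmp) (Zp j)"
    and prob: "\<And>\<alpha>. \<alpha> \<in> state_set Zp Zm \<Longrightarrow> prob_space (P \<alpha>)"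
    and sets_P: "\<And>\<alpha>. \<alpha> \<in> state_set Zp Zm \<Longrightarrow> sets (P \<alpha>) = sets F"
    and start: "\<And>\<alpha>. \<alpha> \<in> state_set Zp Zm \<Longrightarrow> AE \<omega> in P \<alpha>. A 0 \<omega> = \<alpha>"
    and measurable_A: "\<And>t. t \<ge> 0 \<Longrightarrow> A t \<in> F \<rightarrow>\<^sub>M sum_borel"
    and measurable_T: "\<And>n. T n \<in> borel_measurable F"
    and A_in_states: "\<And>t \<omega>. \<lbrakk>t \<ge> 0; \<omega> \<in> space F\<rbrakk> \<Longrightarrow> A t \<omega> \<in> state_set Zp Zm"
    and T_0: "\<And>\<omega>. \<omega> \<in> space F \<Longrightarrow> T 0 \<omega> = 0"
    and T_less: "\<And>n \<omega>. \<lbrakk>\<omega> \<in> space F; T n \<omega> < \<infinity>\<rbrakk> \<Longrightarrow> T n \<omega> < T (Suc n) \<omega>"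
    and T_infinite: "\<And>n \<omega>. \<lbrakk>\<omega> \<in> space F; T n \<omega> = \<infinity>\<rbrakk> \<Longrightarrow> T (Suc n) \<omega> = \<infinity>"
    and T_tendsto: "\<And>\<omega>. \<omega> \<in> space F \<Longrightarrow> (\<lambda>n. T n \<omega>) \<longlonglongrightarrow> \<infinity>"
    and A_flow: "\<And>n t \<omega>. \<lbrakk>\<omega> \<in> space F; T n \<omega> \<le> ereal t; ereal t < T (Suc n) \<omega>\<rbrakk> \<Longrightarrow>
      A t \<omega> = flow bp bm Cp Cm (post_jump A T n \<omega>) (t - real_of_ereal (T n \<omega>))"
    and jump_law: "\<And>\<alpha> n t B. \<lbrakk>\<alpha> \<in> state_set Zp Zm; t \<ge> 0; B \<in> sets sum_borel\<rbrakk> \<Longrightarrow>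
      AE \<omega> in P \<alpha>.
        real_cond_exp (P \<alpha>) (jump_history F A T n)
          (indicator {\<omega> \<in> space F. T n \<omega> < \<infinity> \<and> T (Suc n) \<omega> \<le> T n \<omega> + ereal t \<and>
                                  post_jump A T (Suc n) \<omega> \<in> B}) \<omega>
        = (if T n \<omega> < \<infinity>
           then LBINT s:{0..t}.
             exp (- (LBINT r:{0..s}. jump_rate bp bm Cp Cm Dpm Dmp
                       (flow bp bm Cp Cm (post_jump A T n \<omega>) r) UNIV))
             * jump_rate bp bm Cp Cm Dpm Dmp (flow bp bm Cp Cm (post_jump A T n \<omega>) s) B
           else 0)"
    and nontrivial_p: "\<And>\<alpha>. \<alpha> \<in> (\<Union>i. Zp i) \<Longrightarrow>
      ((\<lambda>t. measure (P (Inl \<alpha>)) {\<omega> \<in> space F. \<forall>s\<in>{0..t}. A s \<omega> \<in> Inl ` (\<Union>i. Zp i)}) \<longlongrightarrow> 0) at_top"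
    and nontrivial_m: "\<And>\<alpha>. \<alpha> \<in> (\<Union>j. Zm j) \<Longrightarrow>
      ((\<lambda>t. measure (P (Inr \<alpha>)) {\<omega> \<in> space F. \<forall>s\<in>{0..t}. A s \<omega> \<in> Inr ` (\<Union>j. Zm j)}) \<longlongrightarrow> 0) at_top"


section \<open>First passage\<close>

primrec Psi_seq ::
    "real^'p^'p \<Rightarrow> real^'m^'m \<Rightarrow> real^'m^'p \<Rightarrow> real^'p^'m \<Rightarrow> nat \<Rightarrow> real^'m::finite^'p::finite" where
  "Psi_seq Cp Cm Dpm Dmp 0 = 0"
| "Psi_seq Cp Cm Dpm Dmp (Suc n) =
    (LBINT y:{0..}. mexp (y *\<^sub>R Cp)
       ** (Dpm + Psi_seq Cp Cm Dpm Dmp n ** Dmp ** Psi_seq Cp Cm Dpm Dmp n)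
       ** mexp (y *\<^sub>R Cm))"

definition Psi ::
    "real^'p^'p \<Rightarrow> real^'m^'m \<Rightarrow> real^'m^'p \<Rightarrow> real^'p^'m \<Rightarrow> real^'m::finite^'p::finite" where
  "Psi Cp Cm Dpm Dmp = lim (Psi_seq Cp Cm Dpm Dmp)"

definition tau_minus ::
    "('i \<Rightarrow> (real^'p) set) \<Rightarrow> ('j \<Rightarrow> (real^'m) set) \<Rightarrow> (real \<Rightarrow> 'w \<Rightarrow> ('p, 'm) state)
     \<Rightarrow> real \<Rightarrow> 'w \<Rightarrow> ereal" where
  "tau_minus Zp Zm A x \<omega> =
    Inf (ereal ` {t. t \<ge> 0 \<and> level Zp Zm A t \<omega> = - x \<and> A t \<omega> \<in> Inr ` (\<Union>j. Zm j)})"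

text \<open>The cemetery state is \<open>None\<close>.\<close>

definition down_orbit ::
    "('i \<Rightarrow> (real^'p) set) \<Rightarrow> ('j \<Rightarrow> (real^'m) set) \<Rightarrow> (real \<Rightarrow> 'w \<Rightarrow> ('p, 'm) state)
     \<Rightarrow> real \<Rightarrow> 'w \<Rightarrow> ('p, 'm) state option" where
  "down_orbit Zp Zm A x \<omega> =
    (if tau_minus Zp Zm A x \<omega> < \<infinity>
     then Some (A (real_of_ereal (tau_minus Zp Zm A x \<omega>)) \<omega>) else None)"

text \<open>
  The vector that is \<open>0\<close> in the cemetery state. The value on \<open>Some (Inl a)\<close> is arbitrary: by
  right-continuity the infimum in \<^const>\<open>tau_minus\<close> is attained when finite, so that
  \<^const>\<open>down_orbit\<close> is never of this form.
\<close>

definition minus_vector :: "('p, 'm) state option \<Rightarrow> real^'m" where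
  "minus_vector y = (case y of Some (Inr b) \<Rightarrow> b | _ \<Rightarrow> 0)"

end

theory Submission
  imports Defs
begin

text \<open>
  Write \<open>C\<^sup>k\<close>, \<open>D\<^sup>k\<^sup>l\<close>,
  \<open>\<Gamma>\<^sup>k\<close> for the matrices of the process, \<open>k\<close> and
  \<open>l\<close> being signs, and call a column vector \<open>h\<close> nonnegative if
  \<open>a \<bullet> h \<ge> 0\<close> for every state \<open>a\<close> of the sign in question.
  The states are bounded, have entries summing to one and span the whole space, so nonnegative
  vectors form a cone in which the vector of ones is an order unit, and a vector is determined
  by its products with the states. All estimates below are made in this order.

  The process is linear in disguise. If the orbit starts in \<open>a\<close>, the vector
  \<open>a e\<^sup>\<Gamma>\<^sup>s\<close> has as its sum of entries the probability of no jump
  before \<open>s\<close>, and its normalisation is the orbit at \<open>s\<close>; likewise an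
  intensity times the corresponding jump target is linear in the state. Hence one step of the
  jump chain maps functionals that are linear in the state to such functionals. Applied to the
  first passage downwards this expresses the expectation of \<open>O\<^sub>x \<bullet>
  h\<close>, restricted to passages before the \<open>k\<close>-th jump, as \<open>\<beta>
  \<bullet> n\<^sub>k(x)\<close>, where the pairs \<open>(m\<^sub>k, n\<^sub>k)\<close> of
  functions of the height (\<open>up\<close> and \<open>down\<close> below) are iterates of a
  linear integral operator (\<open>passage_value_step\<close>, \<open>down_eq_hit_sum\<close>).

  The iterates increase to a bounded limit \<open>(m, n)\<close>, which solves \<open>n' =
  C\<^sup>- n + D\<^sup>-\<^sup>+ m\<close> and \<open>m' = - (C\<^sup>+ m + D\<^sup>+\<^sup>-
  n)\<close> with \<open>n(0) = h\<close> (\<open>passage_limit_derivatives\<close>). If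
  \<open>m = \<Psi> n\<close>, then \<open>n' = (C\<^sup>- + D\<^sup>-\<^sup>+ \<Psi>)
  n\<close>, which is the claim. The identity comes from two bounds. From below, \<open>m \<ge>
  \<Psi>\<^sub>j n\<close> for each iterate \<open>\<Psi>\<^sub>j\<close> of the definition of
  \<open>\<Psi>\<close>: by the Sylvester equation for \<open>\<Psi>\<^sub>j\<close> the
  difference \<open>G\<close> satisfies \<open>G' \<le> - C\<^sup>+ G\<close>, and
  \<open>G\<close> is bounded, so \<open>G \<ge> 0\<close> because \<open>e\<^sup>C\<^sup>s
  \<rightarrow> 0\<close> for \<open>C = C\<^sup>+\<close> (\<open>psi_le_up_limit\<close>). At
  height \<open>0\<close> this bounds the increasing sequence \<open>\<Psi>\<^sub>j\<close>, so
  that \<open>\<Psi>\<close> exists and solves a Riccati equation. From above, the iterates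
  \<open>(m\<^sub>k, n\<^sub>k)\<close> stay below every nonnegative solution of the
  differential system (\<open>passage_le_solution\<close>), and by the Riccati equation
  \<open>(\<Psi> e\<^sup>U\<^sup>x h, e\<^sup>U\<^sup>x h)\<close> with \<open>U = C\<^sup>- +
  D\<^sup>-\<^sup>+ \<Psi>\<close> is one. The two bounds meet in \<open>down_limit_eq\<close>.

  The decay of \<open>e\<^sup>C\<^sup>s\<close> for \<open>C = C\<^sup>+\<close> is the
  nontriviality assumption: \<open>a e\<^sup>C\<^sup>t \<bullet> 1\<close> is at most the
  probability of keeping the sign \<open>+\<close> up to time \<open>t\<close>, again by the
  jump chain (\<open>staying_up_probability\<close>).
\<close>

section \<open>Bilinearity of matrix products\<close>

lemma bounded_bilinear_matrix_mult:
  "bounded_bilinear ((**) :: real^'b^'a \<Rightarrow> real^'c^'b \<Rightarrow> real^'c^'a)"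
  unfolding bilinear_conv_bounded_bilinear[symmetric] bilinear_def
  by (auto intro!: linearI simp: vec_eq_iff matrix_matrix_mult_def sum.distrib algebra_simps
      sum_distrib_left)

lemma bounded_bilinear_matrix_vector_mult:
  "bounded_bilinear ((*v) :: real^'b^'a \<Rightarrow> real^'b \<Rightarrow> real^'a)"
  unfolding bilinear_conv_bounded_bilinear[symmetric] bilinear_def
  by (auto intro!: linearI simp: vec_eq_iff matrix_vector_mult_def sum.distrib algebra_simps
      sum_distrib_left)

lemma bounded_bilinear_vector_matrix_mult:
  "bounded_bilinear ((v*) :: real^'a \<Rightarrow> real^'b^'a \<Rightarrow> real^'b)"
  unfolding bilinear_conv_bounded_bilinear[symmetric] bilinear_def
  by (auto intro!: linearI simp: vec_eq_iff vector_matrix_mult_def sum.distrib algebra_simps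
      sum_distrib_left)

lemma vector_matrix_inner: "(a v* M) \<bullet> h = a \<bullet> (M *v h)" for a :: "real^'a" and h :: "real^'b"
  by (simp add: dot_lmul_matrix)

lemmas mult_linear_simps =
  bounded_bilinear.add_left[OF bounded_bilinear_matrix_mult]
  bounded_bilinear.add_right[OF bounded_bilinear_matrix_mult]
  bounded_bilinear.diff_left[OF bounded_bilinear_matrix_mult]
  bounded_bilinear.diff_right[OF bounded_bilinear_matrix_mult]
  bounded_bilinear.minus_left[OF bounded_bilinear_matrix_mult]
  bounded_bilinear.minus_right[OF bounded_bilinear_matrix_mult]
  bounded_bilinear.scaleR_left[OF bounded_bilinear_matrix_mult]
  bounded_bilinear.scaleR_right[OF bounded_bilinear_matrix_mult]
  bounded_bilinear.zero_left[OF bounded_bilinear_matrix_mult]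
  bounded_bilinear.zero_right[OF bounded_bilinear_matrix_mult]
  bounded_bilinear.add_left[OF bounded_bilinear_matrix_vector_mult]
  bounded_bilinear.add_right[OF bounded_bilinear_matrix_vector_mult]
  bounded_bilinear.diff_left[OF bounded_bilinear_matrix_vector_mult]
  bounded_bilinear.diff_right[OF bounded_bilinear_matrix_vector_mult]
  bounded_bilinear.minus_left[OF bounded_bilinear_matrix_vector_mult]
  bounded_bilinear.minus_right[OF bounded_bilinear_matrix_vector_mult]
  bounded_bilinear.scaleR_left[OF bounded_bilinear_matrix_vector_mult]
  bounded_bilinear.scaleR_right[OF bounded_bilinear_matrix_vector_mult]
  bounded_bilinear.zero_left[OF bounded_bilinear_matrix_vector_mult]
  bounded_bilinear.zero_right[OF bounded_bilinear_matrix_vector_mult]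

section \<open>The matrix exponential\<close>

abbreviation mpow :: "real^'n^'n \<Rightarrow> nat \<Rightarrow> real^'n^'n" where
  "mpow M k \<equiv> (((**) M) ^^ k) (mat 1)"

lemma mpow_scaleR: "mpow (t *\<^sub>R M) k = t ^ k *\<^sub>R mpow M k"
  by (induction k) (simp_all add: mult_linear_simps)

lemma mpow_commute: "M ** mpow M k = mpow M k ** M"
proof (induction k)
  case (Suc k)
  have "M ** mpow M (Suc k) = M ** (mpow M k ** M)" using Suc by simp
  then show ?case by (simp add: matrix_mul_assoc)
qed simp

text \<open>
  The norm of a matrix product is at most a constant times the product of the norms, which is
  all that the comparison with the scalar exponential series uses.
\<close>
lemma summable_mexp:
  fixes M :: "real^'n^'n"
  shows "summable (\<lambda>k. norm ((1 / fact k) *\<^sub>R mpow M k))"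
proof -
  obtain K where K: "\<And>(X::real^'n^'n) (Y::real^'n^'n). norm (X ** Y) \<le> norm X * norm Y * K" "K > 0"
    using bounded_bilinear.pos_bounded[OF bounded_bilinear_matrix_mult] by metis
  have "norm (mpow M k) \<le> (norm M * K) ^ k * norm (mat 1 :: real^'n^'n)" for k
  proof (induction k)
    case (Suc k)
    have "norm (mpow M (Suc k)) \<le> norm M * norm (mpow M k) * K"
      using K(1)[of M "mpow M k"] by (simp only: funpow.simps o_apply)
    also have "\<dots> = (norm M * K) * norm (mpow M k)" by (simp only: mult_ac)
    also have "\<dots> \<le> (norm M * K) * ((norm M * K) ^ k * norm (mat 1 :: real^'n^'n))"
      using K(2) by (intro mult_left_mono[OF Suc]) auto
    also have "\<dots> = (norm M * K) ^ Suc k * norm (mat 1 :: real^'n^'n)"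
      by (simp only: power_Suc mult_ac)
    finally show ?case .
  qed simp
  then have *: "(1 / fact k) * norm (mpow M k) \<le>
      (1 / fact k) * ((norm M * K) ^ k * norm (mat 1 :: real^'n^'n))" for k
    by (intro mult_left_mono) auto
  have "summable (\<lambda>k. norm (mat 1 :: real^'n^'n) * (inverse (fact k) * (norm M * K) ^ k))"
    by (intro summable_mult summable_exp)
  then show ?thesis
    by (rule summable_comparison_test'[where N=0]) (use * in \<open>simp add: divide_simps mult_ac\<close>)
qed

text \<open>
  Entrywise the exponential is a scalar power series in \<open>t\<close>, so the theorem on
  termwise differentiation applies to it.
\<close>
lemma mexp_scaleR_nth:
  "mexp (t *\<^sub>R M) $ i $ j = (\<Sum>k. (mpow M k $ i $ j / fact k) * t ^ k)"
  "summable (\<lambda>k. (mpow M k $ i $ j / fact k) * t ^ k)"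
proof -
  have s: "summable (\<lambda>k. (1 / fact k) *\<^sub>R mpow (t *\<^sub>R M) k)"
    by (rule summable_norm_cancel[OF summable_mexp])
  have bl: "bounded_linear (\<lambda>X::real^'u^'v. X $ i $ j)" for i :: "'v::finite" and j :: "'u::finite"
    by (rule bounded_linear_compose[OF bounded_linear_vec_nth bounded_linear_vec_nth])
  show "mexp (t *\<^sub>R M) $ i $ j = (\<Sum>k. (mpow M k $ i $ j / fact k) * t ^ k)"
    using bounded_linear.suminf[OF bl s, of i j] by (simp add: mexp_def mpow_scaleR mult_ac)
  show "summable (\<lambda>k. (mpow M k $ i $ j / fact k) * t ^ k)"
    using bounded_linear.summable[OF bl s, of i j] by (simp add: mpow_scaleR mult_ac)
qed

lemma mexp_mult_sums:
  "M ** mexp (t *\<^sub>R M) = (\<Sum>k. (t ^ k / fact k) *\<^sub>R mpow M (Suc k))"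
  "mexp (t *\<^sub>R M) ** M = (\<Sum>k. (t ^ k / fact k) *\<^sub>R mpow M (Suc k))"
  "summable (\<lambda>k. (t ^ k / fact k) *\<^sub>R mpow M (Suc k))"
proof -
  have s: "summable (\<lambda>k. (1 / fact k) *\<^sub>R mpow (t *\<^sub>R M) k)"
    by (rule summable_norm_cancel[OF summable_mexp])
  have b1: "bounded_linear (\<lambda>X. M ** X)" 
    by (rule bounded_bilinear.bounded_linear_right[OF bounded_bilinear_matrix_mult])
  have b2: "bounded_linear (\<lambda>X. X ** M)" 
    by (rule bounded_bilinear.bounded_linear_left[OF bounded_bilinear_matrix_mult])
  show "M ** mexp (t *\<^sub>R M) = (\<Sum>k. (t ^ k / fact k) *\<^sub>R mpow M (Suc k))"
    unfolding mexp_def bounded_linear.suminf[OF b1 s] by (simp add: mpow_scaleR mult_linear_simps)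
  show "mexp (t *\<^sub>R M) ** M = (\<Sum>k. (t ^ k / fact k) *\<^sub>R mpow M (Suc k))"
    unfolding mexp_def bounded_linear.suminf[OF b2 s] 
    by (simp add: mpow_scaleR mult_linear_simps mpow_commute)
  show "summable (\<lambda>k. (t ^ k / fact k) *\<^sub>R mpow M (Suc k))"
    using bounded_linear.summable[OF b1 s] by (simp add: mpow_scaleR mult_linear_simps)
qed

lemma mexp_commute: "mexp (t *\<^sub>R M) ** M = M ** mexp (t *\<^sub>R M)"
  by (simp only: mexp_mult_sums)

lemma mexp_zero [simp]: "mexp 0 = mat 1"
proof -
  have *: "(1 / fact k) *\<^sub>R mpow (0::real^'n^'n) k = (if k = 0 then mat 1 else 0)" for k
    by (cases k) (simp_all add: mult_linear_simps)
  show ?thesis unfolding mexp_def * by (subst suminf_finite[where N="{0}"]) auto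
qed

lemma has_vector_derivative_vec_lambda:
  fixes f :: "real \<Rightarrow> (real^'n)^'m"
  assumes "\<And>i j. ((\<lambda>t. f t $ i $ j) has_real_derivative f' $ i $ j) (at x within S)"
  shows "(f has_vector_derivative f') (at x within S)"
  unfolding has_vector_derivative_def
proof (subst has_derivative_componentwise_within, safe)
  fix b :: "(real^'n)^'m" assume "b \<in> Basis"
  then obtain i u where u: "b = axis i u" "u \<in> Basis" by (auto simp: Basis_vec_def)
  then obtain j where j: "u = axis j 1" by (auto simp: Basis_vec_def)
  show "((\<lambda>t. f t \<bullet> b) has_derivative (\<lambda>t. (t *\<^sub>R f') \<bullet> b)) (at x within S)"
    using assms[of i j] unfolding u j has_field_derivative_def
    by (simp add: inner_axis mult_commute_abs)
qed

lemma mexp_has_vector_derivative: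
  "((\<lambda>t. mexp (t *\<^sub>R M)) has_vector_derivative (M ** mexp (t *\<^sub>R M))) (at t within S)"
proof (rule has_vector_derivative_at_within, rule has_vector_derivative_vec_lambda)
  fix i j
  let ?c = "\<lambda>k. mpow M k $ i $ j / fact k"
  have "((\<lambda>t. \<Sum>k. ?c k * t ^ k) has_real_derivative (\<Sum>k. diffs ?c k * t ^ k)) (at t)"
    by (rule termdiffs_strong_converges_everywhere) (rule mexp_scaleR_nth)
  moreover have "(\<Sum>k. diffs ?c k * t ^ k) = (M ** mexp (t *\<^sub>R M)) $ i $ j"
  proof -
    have bl: "bounded_linear (\<lambda>X::real^'u^'v. X $ i $ j)" for i :: "'v::finite" and j :: "'u::finite"
      by (rule bounded_linear_compose[OF bounded_linear_vec_nth bounded_linear_vec_nth])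
    have "(M ** mexp (t *\<^sub>R M)) $ i $ j = (\<Sum>k. ((t ^ k / fact k) *\<^sub>R mpow M (Suc k)) $ i $ j)"
      unfolding mexp_mult_sums(1) by (rule bounded_linear.suminf[OF bl mexp_mult_sums(3)])
    then show ?thesis by (simp add: diffs_def mult_ac del: funpow.simps)
  qed
  ultimately show "((\<lambda>t. mexp (t *\<^sub>R M) $ i $ j) has_real_derivative 
      (M ** mexp (t *\<^sub>R M)) $ i $ j) (at t)"
    by (simp only: mexp_scaleR_nth(1))
qed

lemmas matrix_mult_derivative = 
  bounded_bilinear.has_vector_derivative[OF bounded_bilinear_matrix_mult]
lemmas matrix_vector_derivative = 
  bounded_bilinear.has_vector_derivative[OF bounded_bilinear_matrix_vector_mult]
lemmas inner_derivative = 
  bounded_bilinear.has_vector_derivative[OF bounded_bilinear_inner]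

text \<open>
  In comparison arguments the exponential runs backwards from a fixed end point
  \<open>c\<close>.
\<close>
lemma mexp_has_vector_derivative_rev:
  "((\<lambda>s. mexp ((c - s) *\<^sub>R M)) has_vector_derivative - (mexp ((c - s) *\<^sub>R M) ** M)) (at s within S)"
proof -
  have "((\<lambda>s. c - s) has_vector_derivative -1) (at s within S)"
    by (auto intro!: derivative_eq_intros)
  from vector_diff_chain_within[OF this mexp_has_vector_derivative]
  show ?thesis by (simp add: o_def mexp_commute)
qed

lemma mexp_continuous: "continuous_on S (\<lambda>t. mexp (t *\<^sub>R M))"
  by (rule continuous_on_vector_derivative, rule mexp_has_vector_derivative)

text \<open>
  The product \<open>e\<^sup>u\<^sup>M e\<^sup>(\<^sup>c\<^sup>-\<^sup>u\<^sup>)\<^sup>M\<close>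
  has derivative zero in \<open>u\<close>, so its values at \<open>u = 0\<close> and \<open>u =
  s\<close> agree for \<open>c = s + t\<close>.
\<close>
lemma mexp_add: "mexp ((s + t) *\<^sub>R M) = mexp (s *\<^sub>R M) ** mexp (t *\<^sub>R M)"
proof -
  let ?c = "s + t"
  have "\<exists>k. \<forall>u\<in>UNIV. mexp (u *\<^sub>R M) ** mexp ((?c - u) *\<^sub>R M) = k"
  proof (rule has_derivative_zero_constant[OF convex_UNIV, simplified bex_UNIV])
    fix u
    have "((\<lambda>u. mexp (u *\<^sub>R M) ** mexp ((?c - u) *\<^sub>R M)) has_vector_derivative 0) (at u)"
      by (rule has_vector_derivative_eq_rhs, rule matrix_mult_derivative
          [OF mexp_has_vector_derivative mexp_has_vector_derivative_rev])
        (simp add: mult_linear_simps matrix_mul_assoc mexp_commute)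
    then show "((\<lambda>u. mexp (u *\<^sub>R M) ** mexp ((?c - u) *\<^sub>R M)) has_derivative (\<lambda>h. 0)) (at u)"
      by (simp add: has_vector_derivative_def)
  qed
  then obtain k where k: "\<And>u. mexp (u *\<^sub>R M) ** mexp ((?c - u) *\<^sub>R M) = k" by auto
  from k[of 0] k[of s] show ?thesis by simp
qed

lemma mexp_minus: "mexp (t *\<^sub>R M) ** mexp ((- t) *\<^sub>R M) = mat 1"
  using mexp_add[of t "- t" M] by simp

section \<open>Cones of nonnegative functionals\<close>

text \<open>
  The dual cone of a set of states. A matrix acts on column vectors from the left, and \<open>a
  v* M\<close> tested against \<open>h\<close> is \<open>a\<close> tested against \<open>M *v
  h\<close>, so positivity of the action on states is positivity on dual cones in the opposite
  direction.
\<close>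
definition nonneg_on :: "(real^'n) set \<Rightarrow> (real^'n) set" where
  "nonneg_on Z = {h. \<forall>z\<in>Z. 0 \<le> z \<bullet> h}"

definition cone_map :: "(real^'m) set \<Rightarrow> (real^'n) set \<Rightarrow> real^'n^'m \<Rightarrow> bool" where
  "cone_map Z W M \<longleftrightarrow> (\<forall>h\<in>nonneg_on W. M *v h \<in> nonneg_on Z)"

lemma nonneg_onI: "(\<And>z. z \<in> Z \<Longrightarrow> 0 \<le> z \<bullet> h) \<Longrightarrow> h \<in> nonneg_on Z"
  by (simp add: nonneg_on_def)

lemma nonneg_onD: "h \<in> nonneg_on Z \<Longrightarrow> z \<in> Z \<Longrightarrow> 0 \<le> z \<bullet> h"
  by (simp add: nonneg_on_def)

lemma nonneg_on_zero [simp]: "0 \<in> nonneg_on Z"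
  by (simp add: nonneg_on_def)

lemma nonneg_on_add: "\<lbrakk>g \<in> nonneg_on Z; h \<in> nonneg_on Z\<rbrakk> \<Longrightarrow> g + h \<in> nonneg_on Z"
  by (simp add: nonneg_on_def inner_add_right)

lemma nonneg_on_scaleR: "\<lbrakk>0 \<le> c; h \<in> nonneg_on Z\<rbrakk> \<Longrightarrow> c *\<^sub>R h \<in> nonneg_on Z"
  by (simp add: nonneg_on_def)

lemma nonneg_on_limit:
  assumes "(f \<longlongrightarrow> l) F" "F \<noteq> bot" "eventually (\<lambda>x. f x \<in> nonneg_on Z) F"
  shows "l \<in> nonneg_on Z"
proof (rule nonneg_onI)
  fix z assume z: "z \<in> Z"
  have "((\<lambda>x. z \<bullet> f x) \<longlongrightarrow> z \<bullet> l) F" by (intro tendsto_intros assms)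
  then show "0 \<le> z \<bullet> l"
    by (rule tendsto_lowerbound[OF _ eventually_mono[OF assms(3)] assms(2)])
      (use z in \<open>simp add: nonneg_on_def\<close>)
qed

text \<open>
  The integral of a function that is not integrable is \<open>0\<close>, which lies in the cone.
\<close>
lemma nonneg_on_integral:
  assumes "\<And>x. x \<in> space M \<Longrightarrow> f x \<in> nonneg_on Z"
  shows "(\<integral>x. f x \<partial>M) \<in> nonneg_on Z"
proof (cases "integrable M f")
  case True
  show ?thesis
  proof (rule nonneg_onI)
    fix z assume z: "z \<in> Z"
    have "z \<bullet> (\<integral>x. f x \<partial>M) = (\<integral>x. z \<bullet> f x \<partial>M)" using True by simp
    also have "\<dots> \<ge> 0" 
      by (intro Bochner_Integration.integral_nonneg nonneg_onD[OF assms z])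
    finally show "0 \<le> z \<bullet> (\<integral>x. f x \<partial>M)" .
  qed
qed (simp add: not_integrable_integral_eq)

lemma nonneg_on_set_integral:
  assumes "\<And>x. x \<in> A \<Longrightarrow> f x \<in> nonneg_on Z"
  shows "(LINT x:A|M. f x) \<in> nonneg_on Z"
  unfolding set_lebesgue_integral_def
  by (rule nonneg_on_integral) (use assms in \<open>auto simp: indicator_def\<close>)

lemma cone_mapD: "cone_map Z W M \<Longrightarrow> h \<in> nonneg_on W \<Longrightarrow> M *v h \<in> nonneg_on Z"
  by (simp add: cone_map_def)

lemma cone_map_mult: "cone_map Z W M \<Longrightarrow> cone_map W V N \<Longrightarrow> cone_map Z V (M ** N)"
  by (simp add: cone_map_def flip: matrix_vector_mul_assoc)

lemma cone_map_add: "cone_map Z W M \<Longrightarrow> cone_map Z W N \<Longrightarrow> cone_map Z W (M + N)"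
  by (simp add: cone_map_def mult_linear_simps nonneg_on_add)

lemma cone_map_zero [simp]: "cone_map Z W 0"
  by (simp add: cone_map_def mult_linear_simps)

lemma cone_map_limit:
  assumes "(f \<longlongrightarrow> l) F" "F \<noteq> bot" "eventually (\<lambda>x. cone_map Z W (f x)) F"
  shows "cone_map Z W l"
  unfolding cone_map_def
proof
  fix h assume h: "h \<in> nonneg_on W"
  have "((\<lambda>x. f x *v h) \<longlongrightarrow> l *v h) F"
    by (rule bounded_bilinear.tendsto[OF bounded_bilinear_matrix_vector_mult assms(1) tendsto_const])
  then show "l *v h \<in> nonneg_on Z"
    by (rule nonneg_on_limit[OF _ assms(2)]) 
      (use h in \<open>auto intro: eventually_mono[OF assms(3)] cone_mapD\<close>)
qed

lemma cone_map_set_integral: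
  fixes f :: "'a \<Rightarrow> real^'n^'m"
  assumes "\<And>x. x \<in> A \<Longrightarrow> cone_map Z W (f x)"
  shows "cone_map Z W (LINT x:A|M. f x)"
  unfolding cone_map_def
proof
  fix h :: "real^'n" assume h: "h \<in> nonneg_on W"
  have bl: "bounded_linear (\<lambda>X::real^'n^'m. X *v h)"
    by (rule bounded_bilinear.bounded_linear_left[OF bounded_bilinear_matrix_vector_mult])
  show "(LINT x:A|M. f x) *v h \<in> nonneg_on Z"
  proof (cases "set_integrable M A f")
    case True
    then have "(LINT x:A|M. f x) *v h = (LINT x:A|M. f x *v h)"
      unfolding set_lebesgue_integral_def set_integrable_def
      by (subst integral_bounded_linear[OF bl, symmetric]) (simp_all add: mult_linear_simps)
    then show ?thesis using h assms by (auto intro!: nonneg_on_set_integral cone_mapD)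
  next
    case False
    then show ?thesis
      unfolding set_lebesgue_integral_def set_integrable_def
      by (simp add: not_integrable_integral_eq mult_linear_simps)
  qed
qed

section \<open>Monotonicity along the exponential\<close>

text \<open>
  Differentiating \<open>z \<bullet> e\<^sup>(\<^sup>t\<^sup>-\<^sup>s\<^sup>)\<^sup>M
  f(s)\<close> turns a differential inequality for \<open>f\<close> into monotonicity of a
  scalar function. Every comparison below has this form.
\<close>
lemma inner_mexp_rev_derivative:
  assumes "(f has_vector_derivative f') (at s within S)"
  shows "((\<lambda>s. z \<bullet> (mexp ((t - s) *\<^sub>R M) *v f s)) has_real_derivative
    z \<bullet> (mexp ((t - s) *\<^sub>R M) *v (f' - M *v f s))) (at s within S)"
  unfolding has_real_derivative_iff_has_vector_derivative
  by (rule has_vector_derivative_eq_rhs, rule inner_derivative[OF has_vector_derivative_const],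
      rule matrix_vector_derivative[OF mexp_has_vector_derivative_rev assms])
    (simp add: mult_linear_simps inner_add_right inner_diff_right matrix_vector_mul_assoc)

lemma inner_mexp_derivative:
  assumes "(f has_vector_derivative f') (at s within S)"
  shows "((\<lambda>s. z \<bullet> (mexp (s *\<^sub>R M) *v f s)) has_real_derivative
    z \<bullet> (mexp (s *\<^sub>R M) *v (f' + M *v f s))) (at s within S)"
  unfolding has_real_derivative_iff_has_vector_derivative
  by (rule has_vector_derivative_eq_rhs, rule inner_derivative[OF has_vector_derivative_const],
      rule matrix_vector_derivative[OF mexp_has_vector_derivative assms])
    (simp add: mult_linear_simps inner_add_right inner_diff_right matrix_vector_mul_assoc 
      mexp_commute)

lemma mexp_vector_derivative:
  "((\<lambda>s. mexp (s *\<^sub>R M) *v h) has_vector_derivative M *v (mexp (s *\<^sub>R M) *v h)) (at s within S)"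
  by (rule has_vector_derivative_eq_rhs, 
      rule matrix_vector_derivative[OF mexp_has_vector_derivative has_vector_derivative_const])
    (simp add: mult_linear_simps matrix_vector_mul_assoc)

lemma mexp_vector_continuous: "continuous_on S (\<lambda>s. mexp (s *\<^sub>R M) *v h)"
  by (rule continuous_on_vector_derivative, rule mexp_vector_derivative)

lemma nondecreasing_on_Icc:
  fixes f :: "real \<Rightarrow> real"
  assumes "a \<le> b" "\<And>x. x \<in> {a..b} \<Longrightarrow> (f has_real_derivative f' x) (at x within {a..b})"
    and "\<And>x. x \<in> {a..b} \<Longrightarrow> 0 \<le> f' x"
  shows "f a \<le> f b"
proof (rule DERIV_nonneg_imp_increasing_open[OF assms(1)])
  show "continuous_on {a..b} f"
    using assms(2) by (meson DERIV_continuous continuous_on_eq_continuous_within)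
  fix x assume "a < x" "x < b"
  with assms(2,3)[of x] show "\<exists>y. DERIV f x :> y \<and> 0 \<le> y"
    by (auto simp: at_within_Icc_at)
qed

section \<open>Normalised state sets\<close>

text \<open>
  The properties of the set of all states of one sign that make the order given by its dual cone
  behave like a coordinatewise order.
\<close>
locale state_cone =
  fixes Z :: "(real^'n) set"
  assumes bounded_Z: "bounded Z"
    and sum_one: "\<And>z. z \<in> Z \<Longrightarrow> z \<bullet> 1 = 1"
    and span_Z: "span Z = UNIV"
begin

lemma norm_bound: obtains L where "L > 0" "\<And>z. z \<in> Z \<Longrightarrow> norm z \<le> L"
  using bounded_Z by (auto simp: bounded_pos)

lemma inner_bound: obtains L where "L > 0" "\<And>z v. z \<in> Z \<Longrightarrow> \<bar>z \<bullet> v\<bar> \<le> L * norm v"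
proof -
  obtain L where L: "L > 0" "\<And>z. z \<in> Z \<Longrightarrow> norm z \<le> L" using norm_bound by blast
  show thesis
    by (rule that[OF L(1)])
      (meson Cauchy_Schwarz_ineq2 L(2) mult_right_mono norm_ge_zero order_trans)
qed

lemma one_nonneg [simp]: "1 \<in> nonneg_on Z"
  by (rule nonneg_onI) (simp add: sum_one)

text \<open>
  Boundedness of the states makes \<open>1\<close> an order unit: \<open>z \<bullet> v\<close>
  is at most a multiple of the norm of \<open>v\<close>, while \<open>z \<bullet> 1 = 1\<close>.
\<close>
lemma order_unit: 
  obtains L where "L > 0" "\<And>v. (L * norm v) *\<^sub>R 1 + v \<in> nonneg_on Z" 
    "\<And>v. (L * norm v) *\<^sub>R 1 - v \<in> nonneg_on Z"
proof -
  obtain L where L: "L > 0" "\<And>z v. z \<in> Z \<Longrightarrow> \<bar>z \<bullet> v\<bar> \<le> L * norm v" using inner_bound by blast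
  show thesis
  proof (rule that[OF L(1)])
    fix v
    show "(L * norm v) *\<^sub>R 1 + v \<in> nonneg_on Z" "(L * norm v) *\<^sub>R 1 - v \<in> nonneg_on Z"
      using L(2)[of _ v] by (force simp: nonneg_on_def inner_add_right inner_diff_right sum_one)+
  qed
qed

text \<open>
  The states span the space, so every coordinate is a finite combination of products with
  states. This carries bounds, limits and equations over from products with states to vectors.
\<close>
lemma axis_combination:
  obtains t r where "finite t" "t \<subseteq> Z" "\<And>v :: real^'n. v $ i = (\<Sum>z\<in>t. r z * (z \<bullet> v))"
proof -
  have "axis i 1 \<in> span Z" using span_Z by simp
  then obtain t r where t: "finite t" "t \<subseteq> Z" "axis i 1 = (\<Sum>z\<in>t. r z *\<^sub>R z)"
    unfolding span_explicit by auto
  have "v $ i = (\<Sum>z\<in>t. r z * (z \<bullet> v))" for v :: "real^'n"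
  proof -
    have "v $ i = axis i 1 \<bullet> v" by (simp add: inner_axis' )
    then show ?thesis by (simp add: t(3) inner_sum_left)
  qed
  with t show thesis using that by blast
qed

lemma norm_le_of_inner:
  obtains K where "K > 0" "\<And>v c. (\<And>z. z \<in> Z \<Longrightarrow> \<bar>z \<bullet> v\<bar> \<le> c) \<Longrightarrow> norm v \<le> K * c"
proof -
  have "\<exists>K\<ge>0. \<forall>v c. (\<forall>z\<in>Z. \<bar>z \<bullet> v\<bar> \<le> c) \<longrightarrow> \<bar>v $ i\<bar> \<le> K * c" for i
  proof -
    obtain t r where t: "finite t" "t \<subseteq> Z" "\<And>v :: real^'n. v $ i = (\<Sum>z\<in>t. r z * (z \<bullet> v))"
      using axis_combination[of i] by blast
    have "\<bar>v $ i\<bar> \<le> (\<Sum>z\<in>t. \<bar>r z\<bar>) * c" if "\<forall>z\<in>Z. \<bar>z \<bullet> v\<bar> \<le> c" for v c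
      unfolding t(3) sum_distrib_right
      using that t(2) by (intro order_trans[OF sum_abs] sum_mono) 
        (auto simp: abs_mult intro!: mult_left_mono)
    then show ?thesis by (intro exI[of _ "\<Sum>z\<in>t. \<bar>r z\<bar>"]) (auto intro: sum_nonneg)
  qed
  then obtain K where K: "\<And>i. K i \<ge> 0" 
      "\<And>i v c. (\<forall>z\<in>Z. \<bar>z \<bullet> v\<bar> \<le> c) \<Longrightarrow> \<bar>v $ i\<bar> \<le> K i * c"
    by metis
  have ne: "Z \<noteq> {}"
  proof
    assume "Z = {}"
    then have "(1::real^'n) = 0" using span_Z by auto
    then show False by (simp add: vec_eq_iff)
  qed
  show thesis
  proof (rule that[of "1 + (\<Sum>i\<in>UNIV. K i)"])
    show "0 < 1 + (\<Sum>i\<in>UNIV. K i)" using K(1) by (simp add: add_pos_nonneg sum_nonneg)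
    fix v c assume *: "\<And>z. z \<in> Z \<Longrightarrow> \<bar>z \<bullet> v\<bar> \<le> c"
    then have "0 \<le> c" using ne by force
    have "norm v \<le> (\<Sum>i\<in>UNIV. \<bar>v $ i\<bar>)" by (rule norm_le_l1_cart)
    also have "\<dots> \<le> (\<Sum>i\<in>UNIV. K i * c)" using * by (intro sum_mono K(2)) auto
    also have "\<dots> \<le> (1 + (\<Sum>i\<in>UNIV. K i)) * c"
      using \<open>0 \<le> c\<close> by (simp add: sum_distrib_right[symmetric] distrib_right)
    finally show "norm v \<le> (1 + (\<Sum>i\<in>UNIV. K i)) * c" .
  qed
qed

lemma eq_of_inner:
  assumes "\<And>z. z \<in> Z \<Longrightarrow> z \<bullet> v = z \<bullet> w"
  shows "v = w"
proof -
  obtain K where "\<And>v c. (\<And>z. z \<in> Z \<Longrightarrow> \<bar>z \<bullet> v\<bar> \<le> c) \<Longrightarrow> norm v \<le> K * c" 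
    using norm_le_of_inner by blast
  from this[of "v - w" 0] assms show ?thesis by (simp add: inner_diff_right)
qed

lemma tendsto_of_inner:
  assumes "\<And>z. z \<in> Z \<Longrightarrow> ((\<lambda>x. z \<bullet> f x) \<longlongrightarrow> z \<bullet> l) F"
  shows "(f \<longlongrightarrow> l) F"
proof (rule vec_tendstoI)
  fix i
  obtain t r where t: "finite t" "t \<subseteq> Z" "\<And>v :: real^'n. v $ i = (\<Sum>z\<in>t. r z * (z \<bullet> v))"
    using axis_combination[of i] by blast
  show "((\<lambda>x. f x $ i) \<longlongrightarrow> l $ i) F"
    unfolding t(3) using t(2) by (intro tendsto_intros assms) auto
qed

lemma convergent_of_inner:
  assumes "\<And>z. z \<in> Z \<Longrightarrow> convergent (\<lambda>n. z \<bullet> f n)"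
  shows "convergent f"
proof -
  have "\<exists>l. (\<lambda>n. f n $ i) \<longlonglongrightarrow> l" for i
  proof -
    obtain t r where t: "finite t" "t \<subseteq> Z" "\<And>v :: real^'n. v $ i = (\<Sum>z\<in>t. r z * (z \<bullet> v))"
      using axis_combination[of i] by blast
    have "convergent (\<lambda>n. f n $ i)"
      unfolding t(3) using t(2) assms by (intro convergent_sum convergent_mult_const_iff[THEN iffD2]
          convergent_mult convergent_const) auto
    then show ?thesis by (simp add: convergent_def)
  qed
  then obtain l where "\<And>i. (\<lambda>n. f n $ i) \<longlonglongrightarrow> l i" by metis
  then have "f \<longlonglongrightarrow> (\<chi> i. l i)" by (intro vec_tendstoI) simp
  then show ?thesis by (rule convergentI)
qed


text \<open>
  Adding a positive matrix to the generator of a positive semigroup keeps it positive. The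
  function \<open>\<phi>(s) = z \<bullet> e\<^sup>(\<^sup>t\<^sup>-\<^sup>s\<^sup>)\<^sup>A
  e\<^sup>s\<^sup>(\<^sup>A\<^sup>+\<^sup>B\<^sup>) h\<close> has derivative \<open>z \<bullet>
  e\<^sup>(\<^sup>t\<^sup>-\<^sup>s\<^sup>)\<^sup>A B
  e\<^sup>s\<^sup>(\<^sup>A\<^sup>+\<^sup>B\<^sup>) h\<close>, so a lower bound for
  \<open>e\<^sup>s\<^sup>(\<^sup>A\<^sup>+\<^sup>B\<^sup>) h\<close> improves by one
  integration. Starting from a constant, \<open>k\<close> rounds give the bound \<open>- b
  (\<kappa> t)\<^sup>k / k!\<close>, which tends to \<open>0\<close>.
\<close>
lemma mexp_perturbed_cone_map:
  assumes A: "\<And>t. t \<ge> 0 \<Longrightarrow> cone_map Z Z (mexp (t *\<^sub>R A))" and B: "cone_map Z Z B" 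
    and "T \<ge> 0"
  shows "cone_map Z Z (mexp (T *\<^sub>R (A + B)))"
  unfolding cone_map_def
proof
  fix h assume h: "h \<in> nonneg_on Z"
  obtain L where L: "L > 0" "\<And>z v. z \<in> Z \<Longrightarrow> \<bar>z \<bullet> v\<bar> \<le> L * norm v" using inner_bound by blast
  have bnd: "\<exists>c>0. \<forall>s\<in>{0..T}. \<forall>z\<in>Z. \<bar>z \<bullet> (mexp (s *\<^sub>R M) *v v)\<bar> \<le> c" for M v
  proof -
    have "bounded ((\<lambda>s. mexp (s *\<^sub>R M) *v v) ` {0..T})"
      by (intro compact_imp_bounded compact_continuous_image mexp_vector_continuous) auto
    then obtain c where c: "c > 0" "\<And>s. s \<in> {0..T} \<Longrightarrow> norm (mexp (s *\<^sub>R M) *v v) \<le> c"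
      by (auto simp: bounded_pos)
    show ?thesis
    proof (intro exI[of _ "L * c"] conjI ballI)
      fix s z assume s: "s \<in> {0..T}" "z \<in> Z"
      have "\<bar>z \<bullet> (mexp (s *\<^sub>R M) *v v)\<bar> \<le> L * norm (mexp (s *\<^sub>R M) *v v)" by (rule L(2)[OF s(2)])
      also have "\<dots> \<le> L * c" using c s L by (intro mult_left_mono) auto
      finally show "\<bar>z \<bullet> (mexp (s *\<^sub>R M) *v v)\<bar> \<le> L * c" .
    qed (use c L in simp)
  qed
  obtain \<kappa> where \<kappa>: "\<kappa> > 0" "\<And>s z. s \<in> {0..T} \<Longrightarrow> z \<in> Z \<Longrightarrow> \<bar>z \<bullet> (mexp (s *\<^sub>R A) *v (B *v 1))\<bar> \<le> \<kappa>"
    using bnd[of A "B *v 1"] by blast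
  obtain b where b: "b > 0" "\<And>s z. s \<in> {0..T} \<Longrightarrow> z \<in> Z \<Longrightarrow> \<bar>z \<bullet> (mexp (s *\<^sub>R (A + B)) *v h)\<bar> \<le> b"
    using bnd[of "A + B" h] by blast
  let ?f = "\<lambda>s. mexp (s *\<^sub>R (A + B)) *v h"
  have claim: "0 \<le> z \<bullet> ?f t + b * ((\<kappa> * t) ^ k / fact k)" if "t \<in> {0..T}" "z \<in> Z" for t z k
    using that
  proof (induction k arbitrary: t z)
    case 0
    then show ?case using b(2)[of t z] by auto
  next
    case (Suc k)
    define \<phi> where "\<phi> s = z \<bullet> (mexp ((t - s) *\<^sub>R A) *v ?f s) + b * ((\<kappa> * s) ^ Suc k / fact (Suc k))" for s
    define e where "e s = b * ((\<kappa> * s) ^ k / fact k)" for s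
    have "\<phi> 0 \<le> \<phi> t"
    proof (rule nondecreasing_on_Icc[where f = \<phi>])
      show "0 \<le> t" using Suc.prems by simp
      fix s assume s: "s \<in> {0..t}"
      have "((\<lambda>s. b * ((\<kappa> * s) ^ Suc k / fact (Suc k))) has_real_derivative e s * \<kappa>) (at s within {0..t})"
        unfolding e_def by (rule derivative_eq_intros refl | simp add: divide_simps)+
      from DERIV_add[OF inner_mexp_rev_derivative[OF mexp_vector_derivative] this, of z t A "A + B" h]
      show "(\<phi> has_real_derivative z \<bullet> (mexp ((t - s) *\<^sub>R A) *v (B *v ?f s)) + e s * \<kappa>) (at s within {0..t})"
        unfolding \<phi>_def by (simp add: mult_linear_simps)
      have e0: "e s \<ge> 0" using b \<kappa> s by (simp add: e_def)
      have "?f s + e s *\<^sub>R 1 \<in> nonneg_on Z"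
        using Suc.IH[of s] s Suc.prems(1) 
        by (intro nonneg_onI) (auto simp: inner_add_right sum_one e_def)
      then have "mexp ((t - s) *\<^sub>R A) *v (B *v (?f s + e s *\<^sub>R 1)) \<in> nonneg_on Z"
        using s by (intro cone_mapD[OF A] cone_mapD[OF B]) auto
      from nonneg_onD[OF this Suc.prems(2)]
      have "0 \<le> z \<bullet> (mexp ((t - s) *\<^sub>R A) *v (B *v ?f s)) + e s * (z \<bullet> (mexp ((t - s) *\<^sub>R A) *v (B *v 1)))"
        by (simp add: mult_linear_simps inner_add_right)
      also have "e s * (z \<bullet> (mexp ((t - s) *\<^sub>R A) *v (B *v 1))) \<le> e s * \<kappa>"
        using \<kappa>(2)[of "t - s" z] s Suc.prems e0 by (intro mult_left_mono) auto
      finally show "0 \<le> z \<bullet> (mexp ((t - s) *\<^sub>R A) *v (B *v ?f s)) + e s * \<kappa>" by simp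
    qed
    moreover have "\<phi> 0 \<ge> 0" using nonneg_onD[OF cone_mapD[OF A h] Suc.prems(2), of t] Suc.prems(1)
      by (simp add: \<phi>_def)
    ultimately show ?case by (simp add: \<phi>_def)
  qed
  show "mexp (T *\<^sub>R (A + B)) *v h \<in> nonneg_on Z"
  proof (rule nonneg_onI)
    fix z assume z: "z \<in> Z"
    have "(\<lambda>k. (\<kappa> * T) ^ k / fact k) \<longlonglongrightarrow> 0"
      using summable_LIMSEQ_zero[OF summable_exp[of "\<kappa> * T"]] by (simp add: divide_inverse mult.commute)
    from tendsto_add[OF tendsto_const[of "z \<bullet> ?f T"] tendsto_mult[OF tendsto_const[of b] this]]
    have "(\<lambda>k. z \<bullet> ?f T + b * ((\<kappa> * T) ^ k / fact k)) \<longlonglongrightarrow> z \<bullet> ?f T"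
      by simp
    then show "0 \<le> z \<bullet> ?f T"
      by (intro LIMSEQ_le_const[of _ "z \<bullet> ?f T" 0]) (use claim[of T z] z assms(3) in auto)
  qed
qed

lemma mexp_perturbed_mono:
  assumes A: "\<And>t. t \<ge> 0 \<Longrightarrow> cone_map Z Z (mexp (t *\<^sub>R A))" and B: "cone_map Z Z B" 
    and "t \<ge> 0" "h \<in> nonneg_on Z"
  shows "mexp (t *\<^sub>R (A + B)) *v h - mexp (t *\<^sub>R A) *v h \<in> nonneg_on Z"
proof (rule nonneg_onI)
  fix z assume z: "z \<in> Z"
  let ?f = "\<lambda>s. mexp (s *\<^sub>R (A + B)) *v h"
  have "z \<bullet> (mexp ((t - 0) *\<^sub>R A) *v ?f 0) \<le> z \<bullet> (mexp ((t - t) *\<^sub>R A) *v ?f t)"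
  proof (rule nondecreasing_on_Icc[OF assms(3)])
    fix s assume s: "s \<in> {0..t}"
    show "((\<lambda>s. z \<bullet> (mexp ((t - s) *\<^sub>R A) *v ?f s)) has_real_derivative
        z \<bullet> (mexp ((t - s) *\<^sub>R A) *v (B *v ?f s))) (at s within {0..t})"
      by (rule DERIV_cong, rule inner_mexp_rev_derivative[OF mexp_vector_derivative])
        (simp add: mult_linear_simps)
    show "0 \<le> z \<bullet> (mexp ((t - s) *\<^sub>R A) *v (B *v ?f s))"
      using s assms(4)
      by (intro nonneg_onD[OF _ z] cone_mapD[OF A] cone_mapD[OF B] 
          cone_mapD[OF mexp_perturbed_cone_map[OF A B]]) auto
  qed
  then show "0 \<le> z \<bullet> (mexp (t *\<^sub>R (A + B)) *v h - mexp (t *\<^sub>R A) *v h)"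
    by (simp add: inner_diff_right)
qed

text \<open>
  The image of the order unit controls a positive matrix, as in the operator norm of a positive
  operator.
\<close>
lemma cone_map_norm:
  obtains K where "K > 0" "\<And>M v. cone_map Z Z M \<Longrightarrow> norm (M *v v) \<le> K * norm (M *v 1) * norm v"
proof -
  obtain L where L: "L > 0" "\<And>z v. z \<in> Z \<Longrightarrow> \<bar>z \<bullet> v\<bar> \<le> L * norm v" using inner_bound by blast
  obtain K0 where K0: "K0 > 0" "\<And>v c. (\<And>z. z \<in> Z \<Longrightarrow> \<bar>z \<bullet> v\<bar> \<le> c) \<Longrightarrow> norm v \<le> K0 * c"
    using norm_le_of_inner by blast
  have "norm (M *v v) \<le> K0 * (L * L) * norm (M *v 1) * norm v" if M: "cone_map Z Z M" for M v
  proof -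
    have "norm (M *v v) \<le> K0 * (L * norm v * (L * norm (M *v 1)))"
    proof (rule K0(2))
      fix z assume z: "z \<in> Z"
      have 1: "(L * norm v) *\<^sub>R 1 + v \<in> nonneg_on Z" "(L * norm v) *\<^sub>R 1 - v \<in> nonneg_on Z"
        using L(2)[of _ v] by (force simp: nonneg_on_def inner_add_right inner_diff_right sum_one)+
      have "\<bar>z \<bullet> (M *v v)\<bar> \<le> L * norm v * (z \<bullet> (M *v 1))"
        using nonneg_onD[OF cone_mapD[OF M 1(1)] z] nonneg_onD[OF cone_mapD[OF M 1(2)] z]
        by (simp add: mult_linear_simps inner_add_right inner_diff_right abs_le_iff)
      also have "\<dots> \<le> L * norm v * (L * norm (M *v 1))"
        using L z by (intro mult_left_mono order_trans[OF abs_ge_self L(2)]) auto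
      finally show "\<bar>z \<bullet> (M *v v)\<bar> \<le> L * norm v * (L * norm (M *v 1))" .
    qed
    then show ?thesis by (simp only: mult_ac)
  qed
  then show thesis using K0 L by (intro that[of "K0 * (L * L)"]) auto
qed

text \<open>
  Once the image of the order unit tends to zero, the norm of the exponential falls below
  \<open>e\<^sup>-\<^sup>1\<close> at some time \<open>t\<^sub>0\<close>; the semigroup property
  iterates this over multiples of \<open>t\<^sub>0\<close>.
\<close>
lemma mexp_exponential_decay:
  assumes A: "\<And>t. t \<ge> 0 \<Longrightarrow> cone_map Z Z (mexp (t *\<^sub>R A))" 
    and lim: "((\<lambda>t. mexp (t *\<^sub>R A) *v 1) \<longlongrightarrow> 0) at_top"
  obtains K \<rho> where "K > 0" "\<rho> > 0" 
    "\<And>t v. t \<ge> 0 \<Longrightarrow> norm (mexp (t *\<^sub>R A) *v v) \<le> K * exp (- (\<rho> * t)) * norm v"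
proof -
  obtain K0 where K0: "K0 > 0" 
      "\<And>M v. cone_map Z Z M \<Longrightarrow> norm (M *v v) \<le> K0 * norm (M *v 1) * norm v"
    using cone_map_norm by blast
  define \<kappa> where "\<kappa> t = K0 * norm (mexp (t *\<^sub>R A) *v 1)" for t
  have \<kappa>: "norm (mexp (t *\<^sub>R A) *v v) \<le> \<kappa> t * norm v" if t: "t \<ge> 0" for t v
    unfolding \<kappa>_def by (rule K0(2)[OF A[OF t]])
  have "(\<kappa> \<longlongrightarrow> K0 * norm (0::real^'n)) at_top"
    unfolding \<kappa>_def by (intro tendsto_intros lim)
  then have "eventually (\<lambda>t. \<kappa> t < exp (-1)) at_top"
    by (intro order_tendstoD(2)) auto
  then obtain t1 where t1: "\<And>t. t \<ge> t1 \<Longrightarrow> \<kappa> t < exp (-1)"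
    by (auto simp: eventually_at_top_linorder)
  define t0 where "t0 = max 1 t1"
  have t0: "t0 > 0" "\<kappa> t0 \<le> exp (-1)" using t1[of t0] by (auto simp: t0_def)
  have "bounded (\<kappa> ` {0..t0})"
    unfolding \<kappa>_def
    by (intro compact_imp_bounded compact_continuous_image continuous_intros mexp_vector_continuous) auto
  then obtain c where c: "c > 0" "\<And>s. s \<in> {0..t0} \<Longrightarrow> \<kappa> s \<le> c"
    by (force simp: bounded_pos)
  have step: "norm (mexp ((real n * t0 + u) *\<^sub>R A) *v v) \<le> exp (- real n) * c * norm v" 
    if u: "u \<in> {0..t0}" for n u v
  proof (induction n)
    case 0
    show ?case using order_trans[OF \<kappa>[of u v] mult_right_mono[OF c(2)[OF u], of "norm v"]] u by simp
  next
    case (Suc n)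
    have "norm (mexp ((real (Suc n) * t0 + u) *\<^sub>R A) *v v) =
        norm (mexp (t0 *\<^sub>R A) *v (mexp ((real n * t0 + u) *\<^sub>R A) *v v))"
      by (simp only: matrix_vector_mul_assoc mexp_add[symmetric] of_nat_Suc)
        (simp add: algebra_simps)
    also have "\<dots> \<le> \<kappa> t0 * norm (mexp ((real n * t0 + u) *\<^sub>R A) *v v)"
      using t0 by (intro \<kappa>) auto
    also have "\<dots> \<le> exp (-1) * (exp (- real n) * c * norm v)"
      using t0 Suc by (intro mult_mono) auto
    also have "\<dots> = exp (- real (Suc n)) * c * norm v" by (simp add: mult_exp_exp)
    finally show ?case .
  qed
  show thesis
  proof (rule that[of "c * exp 1" "1 / t0"])
    fix t :: real and v assume t: "t \<ge> 0"
    define n where "n = nat \<lfloor>t / t0\<rfloor>"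
    have n: "real n \<le> t / t0" "t / t0 < real n + 1"
      using t t0 by (auto simp: n_def)
    then have u: "t - real n * t0 \<in> {0..t0}" using t0 by (auto simp: field_simps)
    have "norm (mexp (t *\<^sub>R A) *v v) \<le> exp (- real n) * c * norm v"
      using step[OF u, of n v] by simp
    also have "\<dots> \<le> exp (1 - t / t0) * c * norm v"
      using n c by (intro mult_right_mono) auto
    also have "\<dots> = c * exp 1 * exp (- (1 / t0 * t)) * norm v"
      using mult_exp_exp[of 1 "- (t / t0)"] by simp
    finally show "norm (mexp (t *\<^sub>R A) *v v) \<le> c * exp 1 * exp (- (1 / t0 * t)) * norm v" .
  qed (use c t0 in auto)
qed

end

section \<open>Integrals\<close>

lemma LBINT_FTC:
  fixes F :: "real \<Rightarrow> 'a::euclidean_space"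
  assumes "a \<le> b" "\<And>x. x \<in> {a..b} \<Longrightarrow> (F has_vector_derivative f x) (at x within {a..b})"
    and "set_integrable lborel {a..b} f"
  shows "(LBINT x:{a..b}. f x) = F b - F a"
  using fundamental_theorem_of_calculus[OF assms(1,2)] set_borel_integral_eq_integral(2)[OF assms(3)]
  by (simp add: integral_unique)

lemma LBINT_tail_limit:
  fixes f :: "real \<Rightarrow> 'a::euclidean_space"
  assumes "set_integrable lborel {r..} f"
  shows "(\<lambda>n. LBINT x:{r..r + real n}. f x) \<longlonglongrightarrow> (LBINT x:{r..}. f x)"
proof -
  have U: "(\<Union>n. {r..r + real n}) = {r..}"
  proof (intro equalityI subsetI)
    fix x assume "x \<in> {r..}"
    moreover obtain n where "x - r \<le> real n" using real_arch_simple by blast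
    ultimately show "x \<in> (\<Union>n. {r..r + real n})" by (auto intro!: exI[of _ n])
  qed auto
  show ?thesis
    using set_integral_cont_up[of "\<lambda>n. {r..r + real n}" lborel f] assms unfolding U
    by (auto simp: incseq_def)
qed

lemma LBINT_FTC_infinite:
  fixes F :: "real \<Rightarrow> 'a::euclidean_space"
  assumes "\<And>x. x \<ge> r \<Longrightarrow> (F has_vector_derivative f x) (at x within {r..})"
    and int: "set_integrable lborel {r..} f" and lim: "(F \<longlongrightarrow> l) at_top"
  shows "(LBINT x:{r..}. f x) = l - F r"
proof -
  have "(LBINT x:{r..r + real n}. f x) = F (r + real n) - F r" for n
    by (rule LBINT_FTC) (auto intro: assms(1) has_vector_derivative_within_subset
        set_integrable_subset[OF int])
  moreover have "(\<lambda>n. F (r + real n) - F r) \<longlonglongrightarrow> l - F r"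
    by (intro tendsto_intros filterlim_compose[OF lim] filterlim_tendsto_add_at_top[OF tendsto_const]
        filterlim_real_sequentially)
  ultimately show ?thesis using LBINT_tail_limit[OF int] LIMSEQ_unique by auto
qed

lemma borel_measurable_mexp_vector [measurable (raw)]:
  fixes A :: "real^'n^'n"
  assumes [measurable]: "f \<in> borel_measurable M" "g \<in> borel_measurable M"
  shows "(\<lambda>x. mexp (f x *\<^sub>R A) *v g x) \<in> borel_measurable M"
proof (rule borel_measurable_continuous_Pair[OF assms])
  have "continuous_on UNIV (\<lambda>x::real \<times> (real^'n). mexp (fst x *\<^sub>R A))"
    by (rule continuous_on_compose2[OF mexp_continuous[of UNIV]]) (auto intro!: continuous_intros)
  then show "continuous_on UNIV (\<lambda>x::real \<times> (real^'n). mexp (fst x *\<^sub>R A) *v snd x)"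
    by (intro bounded_bilinear.continuous_on[OF bounded_bilinear_matrix_vector_mult])
      (auto intro!: continuous_intros)
qed

lemma borel_measurable_matrix_vector [measurable (raw)]:
  fixes A :: "real^'n^'m"
  assumes [measurable]: "g \<in> borel_measurable M"
  shows "(\<lambda>x. A *v g x) \<in> borel_measurable M"
  by (rule borel_measurable_continuous_on[OF _ assms], rule linear_continuous_on,
      rule bounded_bilinear.bounded_linear_right[OF bounded_bilinear_matrix_vector_mult])

lemma set_integrable_Icc_bounded:
  fixes f :: "real \<Rightarrow> 'a::euclidean_space"
  assumes [measurable]: "f \<in> borel_measurable borel" and "\<And>x. x \<in> {a..b} \<Longrightarrow> norm (f x) \<le> B"
  shows "set_integrable lborel {a..b} f"
proof (rule set_integrable_bound)
  have "integrable lborel (indicat_real {a..b})"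
    by (cases "a \<le> b") (auto simp: integrable_indicator_iff)
  then show "set_integrable lborel {a..b} (\<lambda>x. B)"
    by (simp add: set_integrable_def)
  show "set_borel_measurable lborel {a..b} f"
    unfolding set_borel_measurable_def by simp
  show "AE x in lborel. x \<in> {a..b} \<longrightarrow> norm (f x) \<le> norm B"
    using assms(2) by (intro AE_I2 impI) (metis abs_ge_self order_trans real_norm_def)
qed

lemma set_integrable_exp_tail:
  assumes "(\<rho>::real) > 0" 
  shows "set_integrable lborel {r..} (\<lambda>s. B * exp (- (\<rho> * (s - r))))"
proof -
  have "(\<lambda>x. exp (- \<rho> * x) :: real) absolutely_integrable_on {r..}"
    by (intro nonnegative_absolutely_integrable_1 integrable_on_exp_minus_to_infinity assms) auto
  then have "set_integrable lborel {r..} (\<lambda>s. exp (- \<rho> * s))"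
    unfolding set_integrable_def by (subst integrable_completion[symmetric]) auto
  then have "set_integrable lborel {r..} (\<lambda>s. (B * exp (\<rho> * r)) * exp (- \<rho> * s))"
    by (cases "B = 0") (simp_all only: set_integrable_mult_right_iff mult_eq_0_iff exp_not_eq_zero simp_thms, simp add: set_integrable_def)
  then show ?thesis
    by (rule set_integrable_cong[THEN iffD1, rotated 3]) (auto simp: mult_exp_exp algebra_simps)
qed

lemma set_integrable_exp_bounded:
  fixes f :: "real \<Rightarrow> 'a::euclidean_space"
  assumes [measurable]: "f \<in> borel_measurable borel" and "\<rho> > 0"
    and "\<And>s. s \<ge> r \<Longrightarrow> norm (f s) \<le> B * exp (- (\<rho> * (s - r)))"
  shows "set_integrable lborel {r..} f"
proof (rule set_integrable_bound[OF set_integrable_exp_tail[OF assms(2), of r B]])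
  show "set_borel_measurable lborel {r..} f"
    unfolding set_borel_measurable_def by simp
  show "AE x in lborel. x \<in> {r..} \<longrightarrow> norm (f x) \<le> norm (B * exp (- (\<rho> * (x - r))))"
    using assms(3) by (intro AE_I2 impI) (metis abs_ge_self atLeast_iff order_trans real_norm_def)
qed

lemma inner_set_integral:
  fixes f :: "real \<Rightarrow> 'a::euclidean_space"
  assumes "set_integrable lborel A f"
  shows "z \<bullet> (LBINT x:A. f x) = (LBINT x:A. z \<bullet> f x)" "set_integrable lborel A (\<lambda>x. z \<bullet> f x)"
proof -
  show "z \<bullet> (LBINT x:A. f x) = (LBINT x:A. z \<bullet> f x)"
    using assms unfolding set_lebesgue_integral_def set_integrable_def
    by (subst integral_inner_right[symmetric]) auto
  show "set_integrable lborel A (\<lambda>x. z \<bullet> f x)"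
    using integrable_inner_right[of z lborel "\<lambda>x. indicator A x *\<^sub>R f x"] assms 
    unfolding set_integrable_def by auto
qed

lemma linear_set_integral:
  fixes f :: "real \<Rightarrow> 'a::euclidean_space" and T :: "'a \<Rightarrow> 'b::euclidean_space"
  assumes "bounded_linear T" "set_integrable lborel A f"
  shows "T (LBINT x:A. f x) = (LBINT x:A. T (f x))" "set_integrable lborel A (\<lambda>x. T (f x))"
proof -
  interpret bounded_linear T by fact
  show "T (LBINT x:A. f x) = (LBINT x:A. T (f x))"
    using integral_bounded_linear[OF assms(1) assms(2)[unfolded set_integrable_def]]
    unfolding set_lebesgue_integral_def by (simp add: scaleR)
  show "set_integrable lborel A (\<lambda>x. T (f x))"
    using integrable_bounded_linear[OF assms(1) assms(2)[unfolded set_integrable_def]]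
    unfolding set_integrable_def by (simp add: scaleR)
qed

lemma norm_matrix_le:
  fixes M :: "real^'n^'m"
  assumes "\<And>v. norm (M *v v) \<le> c * norm v"
  shows "norm M \<le> real (CARD('m) * CARD('n)) * c"
proof -
  have e: "\<bar>M $ i $ j\<bar> \<le> c" for i j
  proof -
    have "(M *v axis j 1) $ i = M $ i $ j" 
      by (simp add: matrix_vector_mult_basis column_def)
    then show ?thesis
      using component_le_norm_cart[of "M *v axis j 1" i] assms[of "axis j 1"] by simp
  qed
  have "norm M \<le> (\<Sum>i\<in>UNIV. norm (M $ i))"
    unfolding norm_vec_def by (rule L2_set_le_sum) simp
  also have "\<dots> \<le> (\<Sum>i\<in>UNIV. \<Sum>j\<in>UNIV. \<bar>M $ i $ j\<bar>)"
    by (intro sum_mono norm_le_l1_cart)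
  also have "\<dots> \<le> (\<Sum>i\<in>(UNIV::'m set). \<Sum>j\<in>(UNIV::'n set). c)"
    by (intro sum_mono e)
  finally show ?thesis by simp
qed

text \<open>
  Order intervals are bounded in norm.
\<close>
lemma (in state_cone) norm_le_of_between:
  obtains K where "K > 0" "\<And>v w. \<lbrakk>v \<in> nonneg_on Z; w - v \<in> nonneg_on Z\<rbrakk> \<Longrightarrow> norm v \<le> K * norm w"
proof -
  obtain L where L: "L > 0" "\<And>z v. z \<in> Z \<Longrightarrow> \<bar>z \<bullet> v\<bar> \<le> L * norm v" using inner_bound by blast
  obtain K where K: "K > 0" "\<And>v c. (\<And>z. z \<in> Z \<Longrightarrow> \<bar>z \<bullet> v\<bar> \<le> c) \<Longrightarrow> norm v \<le> K * c"
    using norm_le_of_inner by blast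
  show thesis
  proof (rule that[of "K * L"])
    fix v w assume v: "v \<in> nonneg_on Z" "w - v \<in> nonneg_on Z"
    have "norm v \<le> K * (L * norm w)"
    proof (rule K(2))
      fix z assume z: "z \<in> Z"
      show "\<bar>z \<bullet> v\<bar> \<le> L * norm w"
        using nonneg_onD[OF v(1) z] nonneg_onD[OF v(2) z] L(2)[OF z, of w] 
        by (simp add: inner_diff_right)
    qed
    then show "norm v \<le> K * L * norm w" by simp
  qed (use K L in auto)
qed

text \<open>
  For bounded measurable \<open>g\<close> the integral is continuous in its upper end, and for
  continuous \<open>g\<close> it is differentiable. Applied twice to the integral equations of
  the limits this raises their regularity from measurable to differentiable.
\<close>
lemma indefinite_mexp_integral:
  fixes A :: "real^'n^'n"
  assumes [measurable]: "g \<in> borel_measurable borel" and B: "\<And>s. s \<in> {0..b} \<Longrightarrow> norm (g s) \<le> B"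
  shows "set_integrable lborel {0..b} (\<lambda>s. mexp (s *\<^sub>R A) *v g s)" (is ?thesis1)
    and "continuous_on {0..b} (\<lambda>r. LBINT s:{0..r}. mexp (s *\<^sub>R A) *v g s)" (is ?thesis2)
    and "\<lbrakk>continuous_on {0..b} g; r \<in> {0..b}\<rbrakk> \<Longrightarrow>
      ((\<lambda>r. LBINT s:{0..r}. mexp (s *\<^sub>R A) *v g s) has_vector_derivative mexp (r *\<^sub>R A) *v g r)
        (at r within {0..b})"
proof -
  obtain K where K: "\<And>(X::real^'n^'n) (v::real^'n). norm (X *v v) \<le> norm X * norm v * K" "K > 0"
    using bounded_bilinear.pos_bounded[OF bounded_bilinear_matrix_vector_mult] by metis
  have "bounded ((\<lambda>s. mexp (s *\<^sub>R A)) ` {0..b})"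
    by (intro compact_imp_bounded compact_continuous_image mexp_continuous) auto
  then obtain c where c: "c > 0" "\<And>s. s \<in> {0..b} \<Longrightarrow> norm (mexp (s *\<^sub>R A)) \<le> c"
    by (auto simp: bounded_pos)
  show int: ?thesis1
  proof (rule set_integrable_Icc_bounded[where B="c * B * K"])
    fix s assume s: "s \<in> {0..b}"
    have "norm (mexp (s *\<^sub>R A)) * norm (g s) \<le> c * B"
      using c s B by (intro mult_mono) auto
    then show "norm (mexp (s *\<^sub>R A) *v g s) \<le> c * B * K"
      using K by (meson mult_right_mono less_imp_le order_trans)
  qed simp
  have eq: "(LBINT s:{0..r}. mexp (s *\<^sub>R A) *v g s) = integral {0..r} (\<lambda>s. mexp (s *\<^sub>R A) *v g s)"
    if "r \<in> {0..b}" for r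
    by (rule set_borel_integral_eq_integral(2), rule set_integrable_subset[OF int]) (use that in auto)
  have "continuous_on {0..b} (\<lambda>r. integral {0..r} (\<lambda>s. mexp (s *\<^sub>R A) *v g s))"
    by (rule indefinite_integral_continuous_1, rule set_borel_integral_eq_integral(1)[OF int])
  then show ?thesis2 by (subst continuous_on_cong[OF refl eq])
  assume g: "continuous_on {0..b} g" and r: "r \<in> {0..b}"
  have "continuous_on {0..b} (\<lambda>s. mexp (s *\<^sub>R A) *v g s)"
    by (rule bounded_bilinear.continuous_on[OF bounded_bilinear_matrix_vector_mult mexp_continuous g])
  from integral_has_vector_derivative[OF this r]
  show "((\<lambda>r. LBINT s:{0..r}. mexp (s *\<^sub>R A) *v g s) has_vector_derivative mexp (r *\<^sub>R A) *v g r)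
        (at r within {0..b})"
    by (rule has_vector_derivative_transform[OF r, rotated]) (simp add: eq)
qed

lemma LBINT_split_tail:
  fixes f :: "real \<Rightarrow> 'a::euclidean_space"
  assumes "set_integrable lborel {a..} f" "a \<le> r"
  shows "(LBINT s:{r..}. f s) = (LBINT s:{a..}. f s) - (LBINT s:{a..r}. f s)"
proof -
  have i: "set_integrable lborel {r..} f" "set_integrable lborel {a..r} f"
    using assms(2) by (auto intro: set_integrable_subset[OF assms(1)])
  have "(LBINT s:{a..}. f s) - (LBINT s:{a..r}. f s) = 
      (\<integral>s. (indicator {a..} s *\<^sub>R f s - indicator {a..r} s *\<^sub>R f s) \<partial>lborel)"
    using assms(1) i(2) unfolding set_lebesgue_integral_def set_integrable_def by simp
  also have "\<dots> = (LBINT s:{r..}. f s)"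
    unfolding set_lebesgue_integral_def
  proof (rule integral_cong_AE)
    show "AE s in lborel. indicator {a..} s *\<^sub>R f s - indicator {a..r} s *\<^sub>R f s = indicator {r..} s *\<^sub>R f s"
      using AE_lborel_singleton[of r] by eventually_elim (use assms(2) in \<open>auto simp: indicator_def\<close>)
  qed (use i assms(1) in \<open>auto simp: set_integrable_def\<close>)
  finally show ?thesis by simp
qed

section \<open>Fluid matrices acting on cones\<close>

text \<open>
  The analytic content of a fluid process, without any probability: \<open>Gp\<close> and
  \<open>Gm\<close> generate the unnormalised flows, \<open>Cp - Gp\<close> and \<open>Cm -
  Gm\<close> describe the jumps that keep the sign, \<open>Dpm\<close> and \<open>Dmp\<close>
  those that change it.
\<close>
locale fluid_cones = p: state_cone Zp + m: state_cone Zm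
  for Zp :: "(real^'p) set" and Zm :: "(real^'m) set" +
  fixes Gp Cp :: "real^'p^'p" and Gm Cm :: "real^'m^'m"
    and Dpm :: "real^'m^'p" and Dmp :: "real^'p^'m"
  assumes Gp_cone: "\<And>t. t \<ge> 0 \<Longrightarrow> cone_map Zp Zp (mexp (t *\<^sub>R Gp))"
    and Gm_cone: "\<And>t. t \<ge> 0 \<Longrightarrow> cone_map Zm Zm (mexp (t *\<^sub>R Gm))"
    and Jp_cone: "cone_map Zp Zp (Cp - Gp)"
    and Jm_cone: "cone_map Zm Zm (Cm - Gm)"
    and Dpm_cone: "cone_map Zp Zm Dpm"
    and Dmp_cone: "cone_map Zm Zp Dmp"
    and rows_p: "Cp *v 1 + Dpm *v 1 = 0"
    and rows_m: "Cm *v 1 + Dmp *v 1 = 0"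
    and Cp_vanishes: "((\<lambda>t. mexp (t *\<^sub>R Cp) *v 1) \<longlongrightarrow> 0) at_top"
begin

lemma Cp_cone: "t \<ge> 0 \<Longrightarrow> cone_map Zp Zp (mexp (t *\<^sub>R Cp))"
  using p.mexp_perturbed_cone_map[OF Gp_cone Jp_cone] by simp

lemma Cm_cone: "t \<ge> 0 \<Longrightarrow> cone_map Zm Zm (mexp (t *\<^sub>R Cm))"
  using m.mexp_perturbed_cone_map[OF Gm_cone Jm_cone] by simp

text \<open>
  The flow alone is dominated by the flow with the jumps that keep the sign.
\<close>
lemma Gp_vanishes: "((\<lambda>t. mexp (t *\<^sub>R Gp) *v 1) \<longlongrightarrow> 0) at_top"
proof (rule p.tendsto_of_inner)
  fix z assume z: "z \<in> Zp"
  have "((\<lambda>t. z \<bullet> (mexp (t *\<^sub>R Cp) *v 1)) \<longlongrightarrow> z \<bullet> 0) at_top"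
    by (intro tendsto_intros Cp_vanishes)
  note lim = this[unfolded inner_zero_right]
  show "((\<lambda>t. z \<bullet> (mexp (t *\<^sub>R Gp) *v 1)) \<longlongrightarrow> z \<bullet> 0) at_top"
    unfolding inner_zero_right
  proof (rule tendsto_sandwich[OF _ _ tendsto_const lim])
    show "\<forall>\<^sub>F t in at_top. 0 \<le> z \<bullet> (mexp (t *\<^sub>R Gp) *v 1)"
      using eventually_ge_at_top[of 0]
      by eventually_elim (rule nonneg_onD[OF cone_mapD[OF Gp_cone p.one_nonneg] z])
    show "\<forall>\<^sub>F t in at_top. z \<bullet> (mexp (t *\<^sub>R Gp) *v 1) \<le> z \<bullet> (mexp (t *\<^sub>R Cp) *v 1)"
      using eventually_ge_at_top[of 0]
      by eventually_elim (use nonneg_onD[OF p.mexp_perturbed_mono[OF Gp_cone Jp_cone _ p.one_nonneg] z]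
          in \<open>simp add: inner_diff_right\<close>)
  qed
qed

text \<open>
  By \<open>rows_m\<close> the total mass \<open>z \<bullet> e\<^sup>C\<^sup>t 1\<close> for
  \<open>C = Cm\<close> decreases at the rate at which the sign is changed, so it is at most
  one.
\<close>
lemma Cm_bounded:
  obtains K where "K > 0" "\<And>t v. t \<ge> 0 \<Longrightarrow> norm (mexp (t *\<^sub>R Cm) *v v) \<le> K * norm v"
proof -
  have Cm1: "Cm *v 1 = - (Dmp *v 1)" using rows_m by (simp add: eq_neg_iff_add_eq_0)
  have le1: "z \<bullet> (mexp (t *\<^sub>R Cm) *v 1) \<le> 1" if z: "z \<in> Zm" and t: "t \<ge> 0" for z t
  proof -
    have "- (z \<bullet> (mexp (0 *\<^sub>R Cm) *v 1)) \<le> - (z \<bullet> (mexp (t *\<^sub>R Cm) *v 1))"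
    proof (rule nondecreasing_on_Icc[OF t, where f="\<lambda>t. - (z \<bullet> (mexp (t *\<^sub>R Cm) *v 1))"])
      fix s assume s: "s \<in> {0..t}"
      show "((\<lambda>t. - (z \<bullet> (mexp (t *\<^sub>R Cm) *v 1))) has_real_derivative 
          z \<bullet> (mexp (s *\<^sub>R Cm) *v (Dmp *v 1))) (at s within {0..t})"
        by (intro DERIV_cong[OF DERIV_minus[OF inner_mexp_derivative[OF has_vector_derivative_const]]])
          (simp add: Cm1 mult_linear_simps)
      show "0 \<le> z \<bullet> (mexp (s *\<^sub>R Cm) *v (Dmp *v 1))"
        using s by (intro nonneg_onD[OF _ z] cone_mapD[OF Cm_cone] cone_mapD[OF Dmp_cone]) auto
    qed
    then show ?thesis by (simp add: m.sum_one[OF z])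
  qed
  obtain K where K: "K > 0" "\<And>v c. (\<And>z. z \<in> Zm \<Longrightarrow> \<bar>z \<bullet> v\<bar> \<le> c) \<Longrightarrow> norm v \<le> K * c"
    using m.norm_le_of_inner by blast
  obtain K0 where K0: "K0 > 0" 
      "\<And>M v. cone_map Zm Zm M \<Longrightarrow> norm (M *v v) \<le> K0 * norm (M *v 1) * norm v"
    using m.cone_map_norm by blast
  show thesis
  proof (rule that[of "K0 * (K * 1)"])
    fix t :: real and v :: "real^'m" assume t: "t \<ge> 0"
    have "norm (mexp (t *\<^sub>R Cm) *v 1) \<le> K * 1"
    proof (rule K(2))
      fix z assume z: "z \<in> Zm"
      show "\<bar>z \<bullet> (mexp (t *\<^sub>R Cm) *v 1)\<bar> \<le> 1"
        using le1[OF z t] nonneg_onD[OF cone_mapD[OF Cm_cone[OF t] m.one_nonneg] z] by simp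
    qed
    then have "K0 * norm (mexp (t *\<^sub>R Cm) *v 1) * norm v \<le> K0 * (K * 1) * norm v"
      using K0 by (intro mult_right_mono mult_left_mono) auto
    then show "norm (mexp (t *\<^sub>R Cm) *v v) \<le> K0 * (K * 1) * norm v"
      using K0(2)[OF Cm_cone[OF t], of v] by simp
  qed (use K K0 in auto)
qed

section \<open>The iterates of the first return matrix\<close>

abbreviation "psi \<equiv> Psi_seq Cp Cm Dpm Dmp"

lemma two_sided_decay:
  fixes X :: "real^'m^'p"
  obtains B \<rho> where "B > 0" "\<rho> > 0" 
    "\<And>y. y \<ge> 0 \<Longrightarrow> norm (mexp (y *\<^sub>R Cp) ** X ** mexp (y *\<^sub>R Cm)) \<le> B * exp (- (\<rho> * (y - 0)))"
proof -
  obtain K \<rho> where K: "K > 0" "\<rho> > 0" 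
    "\<And>t v. t \<ge> 0 \<Longrightarrow> norm (mexp (t *\<^sub>R Cp) *v v) \<le> K * exp (- (\<rho> * t)) * norm v"
    using p.mexp_exponential_decay[OF Cp_cone Cp_vanishes] by blast
  obtain K' where K': "K' > 0" "\<And>t v. t \<ge> 0 \<Longrightarrow> norm (mexp (t *\<^sub>R Cm) *v v) \<le> K' * norm v"
    using Cm_bounded by blast
  obtain k where k: "\<And>v. norm (X *v v) \<le> norm v * k" "k > 0"
    using bounded_linear.pos_bounded[OF bounded_bilinear.bounded_linear_right
        [OF bounded_bilinear_matrix_vector_mult]] by metis
  define B where "B = real (CARD('p) * CARD('m)) * (K * (K' * k))"
  show thesis
  proof (rule that[of B \<rho>])
    fix y :: real assume y: "y \<ge> 0"
    have "norm (mexp (y *\<^sub>R Cp) ** X ** mexp (y *\<^sub>R Cm)) \<le> 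
        real (CARD('p) * CARD('m)) * (K * exp (- (\<rho> * y)) * (K' * k))"
    proof (rule norm_matrix_le)
      fix v :: "real^'m"
      have "norm (X *v (mexp (y *\<^sub>R Cm) *v v)) \<le> norm (mexp (y *\<^sub>R Cm) *v v) * k" by (rule k(1))
      also have "\<dots> \<le> K' * norm v * k" using k K'(2)[OF y] by (intro mult_right_mono) auto
      finally have "norm (X *v (mexp (y *\<^sub>R Cm) *v v)) \<le> K' * k * norm v" by (simp add: mult_ac)
      then have "K * exp (- (\<rho> * y)) * norm (X *v (mexp (y *\<^sub>R Cm) *v v)) 
          \<le> K * exp (- (\<rho> * y)) * (K' * k * norm v)"
        using K by (intro mult_left_mono) auto
      then show "norm ((mexp (y *\<^sub>R Cp) ** X ** mexp (y *\<^sub>R Cm)) *v v) 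
          \<le> K * exp (- (\<rho> * y)) * (K' * k) * norm v"
        using K(3)[OF y, of "X *v (mexp (y *\<^sub>R Cm) *v v)"]
        by (simp add: matrix_vector_mul_assoc matrix_mul_assoc mult.assoc)
    qed
    then show "norm (mexp (y *\<^sub>R Cp) ** X ** mexp (y *\<^sub>R Cm)) \<le> B * exp (- (\<rho> * (y - 0)))"
      by (simp add: B_def mult_ac)
  qed (use K K' k in \<open>auto simp: B_def\<close>)
qed

lemma two_sided_continuous:
  fixes X :: "real^'m^'p"
  shows "continuous_on S (\<lambda>y. mexp (y *\<^sub>R Cp) ** X ** mexp (y *\<^sub>R Cm))"
  by (intro bounded_bilinear.continuous_on[OF bounded_bilinear_matrix_mult] mexp_continuous
      continuous_on_const)

lemma two_sided_integrable:
  fixes X :: "real^'m^'p"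
  shows "set_integrable lborel {0..} (\<lambda>y. mexp (y *\<^sub>R Cp) ** X ** mexp (y *\<^sub>R Cm))"
proof -
  obtain B \<rho> where B: "B > 0" "\<rho> > 0" 
    "\<And>y. y \<ge> 0 \<Longrightarrow> norm (mexp (y *\<^sub>R Cp) ** X ** mexp (y *\<^sub>R Cm)) \<le> B * exp (- (\<rho> * (y - 0)))"
    using two_sided_decay by blast
  show ?thesis
    by (rule set_integrable_exp_bounded[OF _ B(2,3)])
      (auto intro: borel_measurable_continuous_onI two_sided_continuous)
qed

text \<open>
  The integrand is a solution of \<open>F' = Cp F + F Cm\<close> that decays exponentially;
  integrating the equation over the half line leaves minus its value at \<open>0\<close>.
\<close>
lemma sylvester:
  fixes X :: "real^'m^'p"
  defines "S \<equiv> LBINT y:{0..}. mexp (y *\<^sub>R Cp) ** X ** mexp (y *\<^sub>R Cm)"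
  shows "Cp ** S + S ** Cm = - X"
proof -
  let ?F = "\<lambda>y. mexp (y *\<^sub>R Cp) ** X ** mexp (y *\<^sub>R Cm)"
  have b1: "bounded_linear (\<lambda>Y::real^'m^'p. Cp ** Y)"
    by (rule bounded_bilinear.bounded_linear_right[OF bounded_bilinear_matrix_mult])
  have b2: "bounded_linear (\<lambda>Y::real^'m^'p. Y ** Cm)"
    by (rule bounded_bilinear.bounded_linear_left[OF bounded_bilinear_matrix_mult])
  note i = linear_set_integral[OF b1 two_sided_integrable, of X] linear_set_integral[OF b2 two_sided_integrable, of X]
  have "Cp ** S + S ** Cm = (LBINT y:{0..}. Cp ** ?F y + ?F y ** Cm)"
    unfolding S_def i(1,3) by (rule set_integral_add(2)[symmetric]) (rule i)+
  also have "\<dots> = 0 - ?F 0"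
  proof (rule LBINT_FTC_infinite)
    fix y :: real
    show "(?F has_vector_derivative Cp ** ?F y + ?F y ** Cm) (at y within {0..})"
      by (rule has_vector_derivative_eq_rhs, rule matrix_mult_derivative[OF matrix_mult_derivative
            [OF mexp_has_vector_derivative has_vector_derivative_const] mexp_has_vector_derivative])
        (simp add: mult_linear_simps matrix_mul_assoc mexp_commute[symmetric])
  next
    show "set_integrable lborel {0..} (\<lambda>y. Cp ** ?F y + ?F y ** Cm)"
      by (rule set_integral_add(1)) (rule i)+
    obtain B \<rho> where B: "B > 0" "\<rho> > 0" "\<And>y. y \<ge> 0 \<Longrightarrow> norm (?F y) \<le> B * exp (- (\<rho> * (y - 0)))"
      using two_sided_decay by blast
    have "((\<lambda>y. B * exp (- (\<rho> * (y - 0)))) \<longlongrightarrow> 0) at_top"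
      using B by real_asymp
    then show "(?F \<longlongrightarrow> 0) at_top"
      by (rule Lim_null_comparison[rotated])
        (use B(3) in \<open>auto intro: eventually_mono[OF eventually_ge_at_top[of 0]]\<close>)
  qed
  finally show ?thesis by simp
qed

lemma psi_sylvester: 
  "Cp ** psi (Suc n) + psi (Suc n) ** Cm = - (Dpm + psi n ** Dmp ** psi n)"
  using sylvester[of "Dpm + psi n ** Dmp ** psi n"] by simp

lemma two_sided_cone: "cone_map Zp Zm X \<Longrightarrow> 
    cone_map Zp Zm (LBINT y:{0..}. mexp (y *\<^sub>R Cp) ** X ** mexp (y *\<^sub>R Cm))"
  by (rule cone_map_set_integral) (auto intro!: cone_map_mult[OF cone_map_mult] Cp_cone Cm_cone)

lemma psi_cone: "cone_map Zp Zm (psi n)"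
  by (induction n) (simp_all only: Psi_seq.simps cone_map_zero, intro two_sided_cone cone_map_add Dpm_cone
      cone_map_mult[OF cone_map_mult[OF _ Dmp_cone]])

text \<open>
  The map \<open>X \<mapsto> X ** Dmp ** X\<close> is increasing on positive matrices: its
  increment splits into two products of positive matrices.
\<close>
lemma psi_mono: "cone_map Zp Zm (psi (Suc n) - psi n)"
proof (induction n)
  case (Suc n)
  let ?X = "\<lambda>n. Dpm + psi n ** Dmp ** psi n"
  have "psi (Suc (Suc n)) - psi (Suc n) = 
      (LBINT y:{0..}. mexp (y *\<^sub>R Cp) ** (?X (Suc n)) ** mexp (y *\<^sub>R Cm)
        - mexp (y *\<^sub>R Cp) ** (?X n) ** mexp (y *\<^sub>R Cm))"
    unfolding set_integral_diff(2)[OF two_sided_integrable two_sided_integrable] by simp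
  also have "\<dots> = (LBINT y:{0..}. mexp (y *\<^sub>R Cp) ** (?X (Suc n) - ?X n) ** mexp (y *\<^sub>R Cm))"
    by (simp add: mult_linear_simps)
  also have "cone_map Zp Zm \<dots>"
  proof (rule two_sided_cone)
    have "?X (Suc n) - ?X n = psi (Suc n) ** Dmp ** (psi (Suc n) - psi n) + (psi (Suc n) - psi n) ** Dmp ** psi n"
      by (simp add: mult_linear_simps del: Psi_seq.simps)
    also have "cone_map Zp Zm \<dots>"
      by (intro cone_map_add cone_map_mult[OF cone_map_mult[OF _ Dmp_cone]] psi_cone Suc)
    finally show "cone_map Zp Zm (?X (Suc n) - ?X n)" .
  qed
  finally show ?case .
qed (use psi_cone[of "Suc 0"] in simp)

end

section \<open>Iterates of the first passage functional\<close>

lemma (in state_cone) dominating_scalar: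
  obtains c where "c \<ge> 0" "c *\<^sub>R 1 - h \<in> nonneg_on Z"
proof -
  obtain L where "L > 0" "\<And>v. (L * norm v) *\<^sub>R 1 - v \<in> nonneg_on Z" using order_unit by metis
  then show thesis by (intro that[of "L * norm h"]) auto
qed

lemma incseq_bounded_convergent:
  fixes f :: "nat \<Rightarrow> real"
  assumes "\<And>k. f k \<le> f (Suc k)" "\<And>k. f k \<le> b"
  shows "convergent f"
proof (rule Bseq_mono_convergent)
  have "incseq f" using assms(1) by (rule incseq_SucI)
  then show "\<forall>m n. m \<le> n \<longrightarrow> f m \<le> f n" by (simp add: incseq_def)
  then have "\<bar>f k\<bar> \<le> \<bar>f 0\<bar> + \<bar>b\<bar>" for k using assms(2)[of k] by (smt (verit) zero_le)
  then show "Bseq f" by (intro BseqI'[of _ "\<bar>f 0\<bar> + \<bar>b\<bar>"]) simp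
qed

context fluid_cones
begin

text \<open>
  For a functional with values \<open>u\<close> on upward and \<open>v\<close> on downward
  states, \<open>a \<bullet> gain_p u v\<close> is the rate at which jumps out of
  \<open>a\<close> contribute, that is, the sum over the jumps of intensity times value at the
  target.
\<close>
definition gain_p :: "real^'p \<Rightarrow> real^'m \<Rightarrow> real^'p" where
  "gain_p u v = (Cp - Gp) *v u + Dpm *v v"

definition gain_m :: "real^'p \<Rightarrow> real^'m \<Rightarrow> real^'m" where
  "gain_m u v = (Cm - Gm) *v v + Dmp *v u"

lemma gain_nonneg:
  assumes "u \<in> nonneg_on Zp" "v \<in> nonneg_on Zm"
  shows "gain_p u v \<in> nonneg_on Zp" "gain_m u v \<in> nonneg_on Zm"
  unfolding gain_p_def gain_m_def
  by (intro nonneg_on_add cone_mapD[OF Jp_cone] cone_mapD[OF Dpm_cone] cone_mapD[OF Jm_cone] 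
      cone_mapD[OF Dmp_cone] assms)+

lemma gain_diff:
  "gain_p u v - gain_p u' v' = gain_p (u - u') (v - v')"
  "gain_m u v - gain_m u' v' = gain_m (u - u') (v - v')"
  by (simp_all add: gain_p_def gain_m_def mult_linear_simps)

lemma gain_measurable [measurable (raw)]:
  assumes [measurable]: "f \<in> borel_measurable M" "g \<in> borel_measurable M"
  shows "(\<lambda>x. gain_p (f x) (g x)) \<in> borel_measurable M" "(\<lambda>x. gain_m (f x) (g x)) \<in> borel_measurable M"
  unfolding gain_p_def gain_m_def by measurable

lemma gain_bounded:
  obtains B where "B > 0" "\<And>u v. norm (gain_p u v) \<le> B * (norm u + norm v)" 
    "\<And>u v. norm (gain_m u v) \<le> B * (norm u + norm v)"
proof -
  obtain a where a: "a > 0" "\<And>u. norm ((Cp - Gp) *v u) \<le> norm u * a"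
    using bounded_linear.pos_bounded[OF matrix_vector_mul_bounded_linear] by metis
  obtain b where b: "b > 0" "\<And>u. norm (Dpm *v u) \<le> norm u * b"
    using bounded_linear.pos_bounded[OF matrix_vector_mul_bounded_linear] by metis
  obtain c where c: "c > 0" "\<And>u. norm ((Cm - Gm) *v u) \<le> norm u * c"
    using bounded_linear.pos_bounded[OF matrix_vector_mul_bounded_linear] by metis
  obtain d where d: "d > 0" "\<And>u. norm (Dmp *v u) \<le> norm u * d"
    using bounded_linear.pos_bounded[OF matrix_vector_mul_bounded_linear] by metis
  show thesis
  proof (rule that[of "a + b + c + d"])
    fix u :: "real^'p" and v :: "real^'m"
    have "norm (gain_p u v) \<le> norm u * a + norm v * b" 
      unfolding gain_p_def by (rule norm_triangle_mono[OF a(2) b(2)])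
    also have "\<dots> \<le> norm u * (a + b + c + d) + norm v * (a + b + c + d)"
      using a b c d by (intro add_mono mult_left_mono) auto
    finally show "norm (gain_p u v) \<le> (a + b + c + d) * (norm u + norm v)" by (simp add: algebra_simps)
    have "norm (gain_m u v) \<le> norm v * c + norm u * d" 
      unfolding gain_m_def by (rule norm_triangle_mono[OF c(2) d(2)])
    also have "\<dots> \<le> norm v * (a + b + c + d) + norm u * (a + b + c + d)"
      using a b c d by (intro add_mono mult_left_mono) auto
    finally show "norm (gain_m u v) \<le> (a + b + c + d) * (norm u + norm v)" by (simp add: algebra_simps)
  qed (use a b c d in auto)
qed

text \<open>
  The functional \<open>h\<close> of the state at the first passage to a level below the present
  one, restricted to passages before the \<open>k\<close>-th jump, as a function of the height
  above that level: the first component is for states that move up, the second for states that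
  move down. The recursion conditions on the first jump. From a state moving up the height
  \<open>r\<close> grows to \<open>s\<close> until the jump; from one moving down it shrinks to
  \<open>s\<close>, unless there is no jump and the passage happens on the way.
\<close>
primrec passage :: "real^'m \<Rightarrow> nat \<Rightarrow> (real \<Rightarrow> real^'p) \<times> (real \<Rightarrow> real^'m)" where
  "passage h 0 = (\<lambda>r. 0, \<lambda>r. 0)"
| "passage h (Suc k) =
    (\<lambda>r. LBINT s:{r..}. mexp ((s - r) *\<^sub>R Gp) *v gain_p (fst (passage h k) s) (snd (passage h k) s),
     \<lambda>r. mexp (r *\<^sub>R Gm) *v h +
       (LBINT s:{0..r}. mexp ((r - s) *\<^sub>R Gm) *v gain_m (fst (passage h k) s) (snd (passage h k) s)))"

abbreviation "up h k \<equiv> fst (passage h k)"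
abbreviation "down h k \<equiv> snd (passage h k)"

lemma up_Suc: "up h (Suc k) r = (LBINT s:{r..}. mexp ((s - r) *\<^sub>R Gp) *v gain_p (up h k s) (down h k s))"
  by simp

lemma down_Suc: "down h (Suc k) r = mexp (r *\<^sub>R Gm) *v h +
    (LBINT s:{0..r}. mexp ((r - s) *\<^sub>R Gm) *v gain_m (up h k s) (down h k s))"
  by simp

lemma passage_measurable [measurable]:
  "up h k \<in> borel_measurable borel" "down h k \<in> borel_measurable borel"
proof (induction k)
  case (Suc k)
  note [measurable] = Suc
  have up: "up h (Suc k) = (\<lambda>r. \<integral>s. (if r \<le> s then mexp ((s - r) *\<^sub>R Gp) *v gain_p (up h k s) (down h k s) 
      else 0) \<partial>lborel)"
    by (auto simp: fun_eq_iff set_lebesgue_integral_def intro!: Bochner_Integration.integral_cong)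
  have down: "down h (Suc k) = (\<lambda>r. mexp (r *\<^sub>R Gm) *v h + (\<integral>s. (if 0 \<le> s \<and> s \<le> r then 
      mexp ((r - s) *\<^sub>R Gm) *v gain_m (up h k s) (down h k s) else 0) \<partial>lborel))"
    by (auto simp: fun_eq_iff set_lebesgue_integral_def intro!: Bochner_Integration.integral_cong)
  { case 1 show ?case unfolding up by measurable next
    case 2 show ?case unfolding down by measurable }
qed simp_all

lemma passage_nonneg:
  assumes h: "h \<in> nonneg_on Zm" and "r \<ge> 0"
  shows "up h k r \<in> nonneg_on Zp" "down h k r \<in> nonneg_on Zm"
  using \<open>r \<ge> 0\<close>
proof (induction k arbitrary: r)
  case (Suc k)
  { case 1 then show ?case unfolding up_Suc
      by (intro nonneg_on_set_integral cone_mapD[OF Gp_cone] gain_nonneg Suc) auto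
  next
    case 2 then show ?case unfolding down_Suc
      by (intro nonneg_on_add nonneg_on_set_integral cone_mapD[OF Gm_cone] gain_nonneg Suc h) auto }
qed simp_all


text \<open>
  Comparison principle. The functions \<open>M\<close> and \<open>N\<close> satisfy the same
  recursion as the iterates: by the differential equations the integrand of the recursion is a
  total derivative along the flow. The boundary term of the upward part is only nonnegative and
  not zero, and so \<open>M\<close> need not be bounded.
\<close>
lemma passage_le_solution:
  fixes N :: "real \<Rightarrow> real^'m" and M :: "real \<Rightarrow> real^'p"
  assumes h: "h \<in> nonneg_on Zm"
    and N: "\<And>r. r \<ge> 0 \<Longrightarrow> N r \<in> nonneg_on Zm" and M: "\<And>r. r \<ge> 0 \<Longrightarrow> M r \<in> nonneg_on Zp"
    and N': "\<And>r. (N has_vector_derivative Cm *v N r + Dmp *v M r) (at r)"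
    and M': "\<And>r. (M has_vector_derivative - (Cp *v M r + Dpm *v N r)) (at r)"
    and N0: "N 0 - h \<in> nonneg_on Zm" and r: "r \<ge> 0"
  shows "M r - up h k r \<in> nonneg_on Zp" "N r - down h k r \<in> nonneg_on Zm"
  using r
proof (induction k arbitrary: r)
  case (Suc k)
  have contN: "continuous_on S N" and contM: "continuous_on S M" for S
    by (rule continuous_on_vector_derivative, rule has_vector_derivative_at_within, rule N' M')+
  have contp: "continuous_on S (\<lambda>s. gain_p (M s) (N s))" 
    and contm: "continuous_on S (\<lambda>s. gain_m (M s) (N s))" for S
    unfolding gain_p_def gain_m_def
    by (intro continuous_intros bounded_linear.continuous_on[OF matrix_vector_mul_bounded_linear] 
        contN contM)+
  { case 1
    define E where "E s = mexp ((s - r) *\<^sub>R Gp)" for s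
    let ?g = "\<lambda>s. E s *v gain_p (up h k s) (down h k s)" and ?G = "\<lambda>s. E s *v gain_p (M s) (N s)"
    have contE: "continuous_on S E" for S
      unfolding E_def by (rule continuous_on_compose2[OF mexp_continuous[of UNIV]]) (auto intro!: continuous_intros)
    have contG: "continuous_on S ?G" for S
      by (rule bounded_bilinear.continuous_on[OF bounded_bilinear_matrix_vector_mult contE contp])
    have [measurable]: "?g \<in> borel_measurable borel" unfolding E_def by measurable
    have cone: "?g s \<in> nonneg_on Zp" "?G s - ?g s \<in> nonneg_on Zp" if s: "s \<ge> r" for s
    proof -
      have "0 \<le> s" using 1 s by simp
      then show "?g s \<in> nonneg_on Zp" unfolding E_def
        using s by (intro cone_mapD[OF Gp_cone] gain_nonneg passage_nonneg h) auto
      have "?G s - ?g s = E s *v gain_p (M s - up h k s) (N s - down h k s)"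
        by (simp add: mult_linear_simps flip: gain_diff)
      also have "\<dots> \<in> nonneg_on Zp" unfolding E_def
        using s \<open>0 \<le> s\<close> by (intro cone_mapD[OF Gp_cone] gain_nonneg Suc) auto
      finally show "?G s - ?g s \<in> nonneg_on Zp" .
    qed
    \<comment> \<open>Cut off at \<open>r + t\<close>: on the half line the integrand built from \<open>M\<close> and
       \<open>N\<close> may fail to be integrable.\<close>
    have finite_part: "M r - (LBINT s:{r..r + t}. ?g s) \<in> nonneg_on Zp" if t: "t \<ge> 0" for t
    proof -
      have iG: "set_integrable lborel {r..r + t} ?G"
        unfolding set_integrable_def by (rule borel_integrable_compact) (auto intro: contG)
      obtain K where K: "K > 0" 
          "\<And>v w. \<lbrakk>v \<in> nonneg_on Zp; w - v \<in> nonneg_on Zp\<rbrakk> \<Longrightarrow> norm v \<le> K * norm w"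
        using p.norm_le_of_between by blast
      have ig: "set_integrable lborel {r..r + t} ?g"
      proof (rule set_integrable_bound)
        show "set_integrable lborel {r..r + t} (\<lambda>s. K *\<^sub>R ?G s)"
          using linear_set_integral(2)[OF bounded_linear_scaleR_right iG] .
        show "set_borel_measurable lborel {r..r + t} ?g" unfolding set_borel_measurable_def by simp
        show "AE s in lborel. s \<in> {r..r + t} \<longrightarrow> norm (?g s) \<le> norm (K *\<^sub>R ?G s)"
          using K cone by (intro AE_I2) auto
      qed
      have "(LBINT s:{r..r + t}. ?G s) = (\<lambda>s. - (E s *v M s)) (r + t) - (\<lambda>s. - (E s *v M s)) r"
      proof (rule LBINT_FTC[OF _ _ iG])
        fix s
        have "((\<lambda>s. mexp ((s - r) *\<^sub>R Gp)) has_vector_derivative E s ** Gp) (at s within {r..r + t})"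
          using has_vector_derivative_at_within[OF vector_diff_chain_at
              [OF has_vector_derivative_diff_const[THEN iffD2, OF has_vector_derivative_id] mexp_has_vector_derivative]]
          by (simp add: o_def E_def mexp_commute)
        then have "(E has_vector_derivative E s ** Gp) (at s within {r..r + t})"
          unfolding E_def .
        note d = has_vector_derivative_minus[OF matrix_vector_derivative[OF this has_vector_derivative_at_within[OF M'[of s]]]]
        show "((\<lambda>s. - (E s *v M s)) has_vector_derivative ?G s) (at s within {r..r + t})"
          by (rule has_vector_derivative_eq_rhs[OF d]) 
            (simp add: gain_p_def mult_linear_simps matrix_vector_mul_assoc)
      qed (use t in simp)
      also have "\<dots> = M r - E (r + t) *v M (r + t)" by (simp add: E_def)
      finally have "M r - (LBINT s:{r..r + t}. ?g s) = E (r + t) *v M (r + t) + (LBINT s:{r..r + t}. ?G s - ?g s)"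
        unfolding set_integral_diff(2)[OF iG ig] by simp
      also have "\<dots> \<in> nonneg_on Zp"
      proof (rule nonneg_on_add)
        show "E (r + t) *v M (r + t) \<in> nonneg_on Zp"
          using t 1 unfolding E_def by (intro cone_mapD[OF Gp_cone] M) auto
        show "(LBINT s:{r..r + t}. ?G s - ?g s) \<in> nonneg_on Zp"
          by (intro nonneg_on_set_integral cone) auto
      qed
      finally show ?thesis .
    qed
    show ?case
    proof (cases "set_integrable lborel {r..} ?g")
      case True
      have "(\<lambda>n. M r - (LBINT s:{r..r + real n}. ?g s)) \<longlonglongrightarrow> M r - up h (Suc k) r"
        unfolding up_Suc E_def[symmetric] by (intro tendsto_intros LBINT_tail_limit True)
      then show ?thesis by (rule nonneg_on_limit) (use finite_part in auto)
    next
      case False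
      then have "up h (Suc k) r = 0"
        unfolding up_Suc E_def[symmetric] set_lebesgue_integral_def set_integrable_def
        by (rule not_integrable_integral_eq)
      then show ?thesis using M 1 by (simp del: passage.simps)
    qed
  next
    case 2
    define E where "E s = mexp ((r - s) *\<^sub>R Gm)" for s
    let ?g = "\<lambda>s. E s *v gain_m (up h k s) (down h k s)" and ?G = "\<lambda>s. E s *v gain_m (M s) (N s)"
    have contE: "continuous_on S E" for S
      unfolding E_def by (rule continuous_on_compose2[OF mexp_continuous[of UNIV]]) (auto intro!: continuous_intros)
    have contG: "continuous_on S ?G" for S
      by (rule bounded_bilinear.continuous_on[OF bounded_bilinear_matrix_vector_mult contE contm])
    have [measurable]: "?g \<in> borel_measurable borel" unfolding E_def by measurable
    have cone: "?g s \<in> nonneg_on Zm" "?G s - ?g s \<in> nonneg_on Zm" if s: "s \<in> {0..r}" for s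
    proof -
      show "?g s \<in> nonneg_on Zm" unfolding E_def
        using s by (intro cone_mapD[OF Gm_cone] gain_nonneg passage_nonneg h) auto
      have "?G s - ?g s = E s *v gain_m (M s - up h k s) (N s - down h k s)"
        by (simp add: mult_linear_simps flip: gain_diff)
      also have "\<dots> \<in> nonneg_on Zm" unfolding E_def
        using s by (intro cone_mapD[OF Gm_cone] gain_nonneg Suc) auto
      finally show "?G s - ?g s \<in> nonneg_on Zm" .
    qed
    have iG: "set_integrable lborel {0..r} ?G"
      unfolding set_integrable_def by (rule borel_integrable_compact) (auto intro: contG)
    obtain K where K: "K > 0" 
        "\<And>v w. \<lbrakk>v \<in> nonneg_on Zm; w - v \<in> nonneg_on Zm\<rbrakk> \<Longrightarrow> norm v \<le> K * norm w"
      using m.norm_le_of_between by blast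
    have ig: "set_integrable lborel {0..r} ?g"
    proof (rule set_integrable_bound)
      show "set_integrable lborel {0..r} (\<lambda>s. K *\<^sub>R ?G s)"
        using linear_set_integral(2)[OF bounded_linear_scaleR_right iG] .
      show "set_borel_measurable lborel {0..r} ?g" unfolding set_borel_measurable_def by simp
      show "AE s in lborel. s \<in> {0..r} \<longrightarrow> norm (?g s) \<le> norm (K *\<^sub>R ?G s)"
        using K cone by (intro AE_I2) auto
    qed
    have "(LBINT s:{0..r}. ?G s) = (\<lambda>s. E s *v N s) r - (\<lambda>s. E s *v N s) 0"
    proof (rule LBINT_FTC[OF _ _ iG])
      fix s
      have "(E has_vector_derivative - (E s ** Gm)) (at s within {0..r})"
        unfolding E_def by (rule mexp_has_vector_derivative_rev)
      note d = matrix_vector_derivative[OF this has_vector_derivative_at_within[OF N'[of s]]]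
      show "((\<lambda>s. E s *v N s) has_vector_derivative ?G s) (at s within {0..r})"
        by (rule has_vector_derivative_eq_rhs[OF d]) 
          (simp add: gain_m_def mult_linear_simps matrix_vector_mul_assoc)
    qed (use 2 in simp)
    also have "\<dots> = N r - E 0 *v N 0" by (simp add: E_def)
    finally have "N r - down h (Suc k) r = E 0 *v (N 0 - h) + (LBINT s:{0..r}. ?G s - ?g s)"
      unfolding set_integral_diff(2)[OF iG ig] down_Suc by (simp add: E_def mult_linear_simps)
    also have "\<dots> \<in> nonneg_on Zm"
    proof (rule nonneg_on_add)
      show "E 0 *v (N 0 - h) \<in> nonneg_on Zm"
        using 2 unfolding E_def by (intro cone_mapD[OF Gm_cone] N0) auto
      show "(LBINT s:{0..r}. ?G s - ?g s) \<in> nonneg_on Zm"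
        by (intro nonneg_on_set_integral cone) auto
    qed
    finally show ?case .
  }
qed (use N M in simp_all)

text \<open>
  By the row sum conditions multiples of \<open>1\<close> are constant solutions of the
  differential system.
\<close>
lemma passage_le_one:
  assumes h: "h \<in> nonneg_on Zm" and c: "c \<ge> 0" "c *\<^sub>R 1 - h \<in> nonneg_on Zm" and r: "r \<ge> 0"
  shows "c *\<^sub>R 1 - up h k r \<in> nonneg_on Zp" "c *\<^sub>R 1 - down h k r \<in> nonneg_on Zm"
proof -
  have N: "((\<lambda>r. c *\<^sub>R 1) has_vector_derivative Cm *v (c *\<^sub>R 1) + Dmp *v (c *\<^sub>R 1)) (at r)" for r
    using arg_cong[OF rows_m, of "scaleR c"] by (simp add: mult_linear_simps scaleR_add_right)
  have M: "((\<lambda>r. c *\<^sub>R 1) has_vector_derivative - (Cp *v (c *\<^sub>R 1) + Dpm *v (c *\<^sub>R 1))) (at r)" for r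
    using arg_cong[OF rows_p, of "scaleR c"] 
    by (simp add: mult_linear_simps scaleR_add_right del: minus_add_distrib)
  note cones = nonneg_on_scaleR[OF c(1) m.one_nonneg] nonneg_on_scaleR[OF c(1) p.one_nonneg]
  show "c *\<^sub>R 1 - up h k r \<in> nonneg_on Zp" "c *\<^sub>R 1 - down h k r \<in> nonneg_on Zm"
    by (rule passage_le_solution[OF h cones N M c(2) r])+
qed

lemma passage_bounded:
  assumes h: "h \<in> nonneg_on Zm"
  obtains B where "B > 0" "\<And>k r. r \<ge> 0 \<Longrightarrow> norm (up h k r) \<le> B" 
    "\<And>k r. r \<ge> 0 \<Longrightarrow> norm (down h k r) \<le> B"
proof -
  obtain c where c: "c \<ge> 0" "c *\<^sub>R 1 - h \<in> nonneg_on Zm" using m.dominating_scalar by blast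
  obtain K where K: "K > 0" 
      "\<And>v w. \<lbrakk>v \<in> nonneg_on Zm; w - v \<in> nonneg_on Zm\<rbrakk> \<Longrightarrow> norm v \<le> K * norm w"
    using m.norm_le_of_between by blast
  obtain K' where K': "K' > 0" 
      "\<And>v w. \<lbrakk>v \<in> nonneg_on Zp; w - v \<in> nonneg_on Zp\<rbrakk> \<Longrightarrow> norm v \<le> K' * norm w"
    using p.norm_le_of_between by blast
  let ?a = "K * norm (c *\<^sub>R 1 :: real^'m)" and ?b = "K' * norm (c *\<^sub>R 1 :: real^'p)"
  have nn: "?a \<ge> 0" "?b \<ge> 0" using K K' by auto
  show thesis
  proof (rule that[of "?a + ?b + 1"])
    show "0 < ?a + ?b + 1" using nn by linarith
    fix k and r :: real assume r: "r \<ge> 0"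
    show "norm (up h k r) \<le> ?a + ?b + 1"
      using K'(2)[OF passage_nonneg(1)[OF h r] passage_le_one(1)[OF h c r], of k] nn by linarith
    show "norm (down h k r) \<le> ?a + ?b + 1"
      using K(2)[OF passage_nonneg(2)[OF h r] passage_le_one(2)[OF h c r], of k] nn by linarith
  qed
qed


lemma convolution_integrable_m:
  assumes [measurable]: "g \<in> borel_measurable borel" and B: "\<And>s. s \<ge> 0 \<Longrightarrow> norm (g s) \<le> B"
  shows "set_integrable lborel {0..r} (\<lambda>s. mexp ((r - s) *\<^sub>R Gm) *v g s)"
proof -
  have "set_integrable lborel {0..r} (\<lambda>s. mexp (s *\<^sub>R (- Gm)) *v g s)"
    by (rule indefinite_mexp_integral(1)[where B=B]) (use B in auto)
  from linear_set_integral(2)[OF matrix_vector_mul_bounded_linear this, of "mexp (r *\<^sub>R Gm)"]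
  show ?thesis by (simp add: matrix_vector_mul_assoc mexp_add[of _ "- _", simplified, symmetric] 
        algebra_simps)
qed

text \<open>
  Going up has an infinite horizon; the exponential decay of the upward flow makes the integral
  converge absolutely and supplies the dominating function.
\<close>
lemma convolution_integrable_p:
  assumes [measurable]: "g \<in> borel_measurable borel" and B: "\<And>s. s \<ge> 0 \<Longrightarrow> norm (g s) \<le> B" and r: "r \<ge> 0"
  obtains K \<rho> where "\<rho> > 0" "\<And>s. s \<ge> r \<Longrightarrow> norm (mexp ((s - r) *\<^sub>R Gp) *v g s) \<le> K * B * exp (- (\<rho> * (s - r)))"
    "set_integrable lborel {r..} (\<lambda>s. mexp ((s - r) *\<^sub>R Gp) *v g s)"
proof -
  obtain K \<rho> where K: "K > 0" "\<rho> > 0" 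
    "\<And>t v. t \<ge> 0 \<Longrightarrow> norm (mexp (t *\<^sub>R Gp) *v v) \<le> K * exp (- (\<rho> * t)) * norm v"
    using p.mexp_exponential_decay[OF Gp_cone Gp_vanishes] by blast
  have *: "norm (mexp ((s - r) *\<^sub>R Gp) *v g s) \<le> K * B * exp (- (\<rho> * (s - r)))" if s: "s \<ge> r" for s
  proof -
    have "norm (mexp ((s - r) *\<^sub>R Gp) *v g s) \<le> K * exp (- (\<rho> * (s - r))) * norm (g s)"
      using s by (intro K) auto
    also have "\<dots> \<le> K * exp (- (\<rho> * (s - r))) * B" using K B s r by (intro mult_left_mono) auto
    finally show ?thesis by (simp add: mult_ac)
  qed
  show thesis by (rule that[OF K(2) *], assumption, rule set_integrable_exp_bounded[OF _ K(2) *]) auto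
qed

end

section \<open>The limit of the iterates\<close>

lemma set_integral_dominated_convergence:
  fixes f :: "real \<Rightarrow> 'a::euclidean_space"
  assumes [measurable]: "f \<in> borel_measurable borel" "\<And>k. g k \<in> borel_measurable borel" "A \<in> sets borel"
    and lim: "\<And>s. s \<in> A \<Longrightarrow> (\<lambda>k. g k s) \<longlonglongrightarrow> f s"
    and w: "set_integrable lborel A w" and bnd: "\<And>k s. s \<in> A \<Longrightarrow> norm (g k s) \<le> w s"
  shows "(\<lambda>k. LBINT s:A. g k s) \<longlonglongrightarrow> (LBINT s:A. f s)"
  unfolding set_lebesgue_integral_def
proof (rule integral_dominated_convergence[where w="\<lambda>s. indicator A s *\<^sub>R w s"])
  show "integrable lborel (\<lambda>s. indicator A s *\<^sub>R w s)" using w by (simp add: set_integrable_def)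
  show "AE s in lborel. (\<lambda>k. indicator A s *\<^sub>R g k s) \<longlonglongrightarrow> indicator A s *\<^sub>R f s"
    using lim by (intro AE_I2) (auto simp: indicator_def)
  show "AE s in lborel. norm (indicator A s *\<^sub>R g k s) \<le> indicator A s *\<^sub>R w s" for k
    using bnd by (intro AE_I2) (auto simp: indicator_def)
qed auto

lemma mexp_diff:
  "mexp (r *\<^sub>R (- A)) ** mexp (s *\<^sub>R A) = mexp ((s - r) *\<^sub>R A)"
  "mexp (s *\<^sub>R A) ** mexp (r *\<^sub>R (- A)) = mexp ((s - r) *\<^sub>R A)"
  using mexp_add[of "- r" s A] mexp_add[of s "- r" A] by (simp_all add: algebra_simps)

context fluid_cones
begin

declare passage.simps(2) [simp del]

lemma passage_gain_bounded:
  assumes h: "h \<in> nonneg_on Zm"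
  shows "\<exists>D. \<forall>k s. s \<ge> 0 \<longrightarrow> norm (gain_p (up h k s) (down h k s)) \<le> D \<and> norm (gain_m (up h k s) (down h k s)) \<le> D"
proof -
  obtain B where B: "B > 0" "\<And>k r. r \<ge> 0 \<Longrightarrow> norm (up h k r) \<le> B" 
    "\<And>k r. r \<ge> 0 \<Longrightarrow> norm (down h k r) \<le> B" using passage_bounded[OF h] by blast
  obtain C where C: "C > 0" "\<And>u v. norm (gain_p u v) \<le> C * (norm u + norm v)" 
    "\<And>u v. norm (gain_m u v) \<le> C * (norm u + norm v)" using gain_bounded by blast
  have le: "C * (norm (up h k s) + norm (down h k s)) \<le> C * (B + B)" if "s \<ge> 0" for k s
    using C B that by (intro mult_left_mono add_mono) auto
  show ?thesis
  proof (intro exI[of _ "C * (B + B)"] allI impI conjI)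
    fix k and s :: real assume s: "s \<ge> 0"
    show "norm (gain_p (up h k s) (down h k s)) \<le> C * (B + B)" by (rule order_trans[OF C(2) le[OF s]])
    show "norm (gain_m (up h k s) (down h k s)) \<le> C * (B + B)" by (rule order_trans[OF C(3) le[OF s]])
  qed
qed

lemma passage_mono:
  assumes h: "h \<in> nonneg_on Zm" and "r \<ge> 0"
  shows "up h (Suc k) r - up h k r \<in> nonneg_on Zp" "down h (Suc k) r - down h k r \<in> nonneg_on Zm"
  using \<open>r \<ge> 0\<close>
proof (induction k arbitrary: r)
  case 0
  { case 1 then show ?case using passage_nonneg(1)[OF h, of r "Suc 0"] by simp next
    case 2 then show ?case using passage_nonneg(2)[OF h, of r "Suc 0"] by simp }
next
  case (Suc k)
  obtain D where D: "\<forall>k s. s \<ge> 0 \<longrightarrow> norm (gain_p (up h k s) (down h k s)) \<le> D \<and> norm (gain_m (up h k s) (down h k s)) \<le> D"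
    using passage_gain_bounded[OF h] ..
  { case 1
    have i: "set_integrable lborel {r..} (\<lambda>s. mexp ((s - r) *\<^sub>R Gp) *v gain_p (up h k s) (down h k s))" for k
      by (rule convolution_integrable_p[of "\<lambda>s. gain_p (up h k s) (down h k s)" D r])
        (use 1 in \<open>auto simp: D simp del: passage.simps\<close>)
    have "up h (Suc (Suc k)) r - up h (Suc k) r = 
        (LBINT s:{r..}. mexp ((s - r) *\<^sub>R Gp) *v gain_p (up h (Suc k) s - up h k s) (down h (Suc k) s - down h k s))"
      by (simp only: up_Suc[of h "Suc k" r] up_Suc[of h k r] set_integral_diff(2)[OF i i] 
          gain_diff[symmetric] mult_linear_simps)
    also have "\<dots> \<in> nonneg_on Zp"
      using 1 by (intro nonneg_on_set_integral cone_mapD[OF Gp_cone] gain_nonneg Suc) auto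
    finally show ?case .
  next
    case 2
    have i: "set_integrable lborel {0..r} (\<lambda>s. mexp ((r - s) *\<^sub>R Gm) *v gain_m (up h k s) (down h k s))" for k
      by (rule convolution_integrable_m[of "\<lambda>s. gain_m (up h k s) (down h k s)" D r])
        (use 2 in \<open>auto simp: D simp del: passage.simps\<close>)
    have "down h (Suc (Suc k)) r - down h (Suc k) r = 
        (LBINT s:{0..r}. mexp ((r - s) *\<^sub>R Gm) *v gain_m (up h (Suc k) s - up h k s) (down h (Suc k) s - down h k s))"
      by (simp only: down_Suc[of h "Suc k" r] down_Suc[of h k r] add_diff_cancel_left
          set_integral_diff(2)[OF i i] gain_diff[symmetric] mult_linear_simps)
    also have "\<dots> \<in> nonneg_on Zm"
      using 2 by (intro nonneg_on_set_integral cone_mapD[OF Gm_cone] gain_nonneg Suc) auto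
    finally show ?case .
  }
qed

text \<open>
  Heights are nonnegative; the value \<open>0\<close> elsewhere keeps the limits measurable and
  bounded on the whole line.
\<close>
definition up_limit :: "real^'m \<Rightarrow> real \<Rightarrow> real^'p" where
  "up_limit h r = (if 0 \<le> r then lim (\<lambda>k. up h k r) else 0)"

definition down_limit :: "real^'m \<Rightarrow> real \<Rightarrow> real^'m" where
  "down_limit h r = (if 0 \<le> r then lim (\<lambda>k. down h k r) else 0)"

lemma passage_limits:
  assumes h: "h \<in> nonneg_on Zm" and r: "r \<ge> 0"
  shows "(\<lambda>k. up h k r) \<longlonglongrightarrow> up_limit h r" "(\<lambda>k. down h k r) \<longlonglongrightarrow> down_limit h r"
proof -
  obtain c where c: "c \<ge> 0" "c *\<^sub>R 1 - h \<in> nonneg_on Zm" using m.dominating_scalar by blast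
  have "convergent (\<lambda>k. up h k r)"
  proof (rule p.convergent_of_inner, rule incseq_bounded_convergent)
    fix z k assume z: "z \<in> Zp"
    show "z \<bullet> up h k r \<le> z \<bullet> up h (Suc k) r"
      using nonneg_onD[OF passage_mono(1)[OF h r] z] by (simp add: inner_diff_right del: passage.simps)
    show "z \<bullet> up h k r \<le> c"
      using nonneg_onD[OF passage_le_one(1)[OF h c r] z, of k] p.sum_one[OF z] by (simp add: inner_diff_right)
  qed
  then show "(\<lambda>k. up h k r) \<longlonglongrightarrow> up_limit h r" using r by (simp add: up_limit_def convergent_LIMSEQ_iff)
  have "convergent (\<lambda>k. down h k r)"
  proof (rule m.convergent_of_inner, rule incseq_bounded_convergent)
    fix z k assume z: "z \<in> Zm"
    show "z \<bullet> down h k r \<le> z \<bullet> down h (Suc k) r"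
      using nonneg_onD[OF passage_mono(2)[OF h r] z] by (simp add: inner_diff_right del: passage.simps)
    show "z \<bullet> down h k r \<le> c"
      using nonneg_onD[OF passage_le_one(2)[OF h c r] z, of k] m.sum_one[OF z] by (simp add: inner_diff_right)
  qed
  then show "(\<lambda>k. down h k r) \<longlonglongrightarrow> down_limit h r" using r by (simp add: down_limit_def convergent_LIMSEQ_iff)
qed

lemma passage_limits_measurable [measurable]:
  assumes h: "h \<in> nonneg_on Zm"
  shows "up_limit h \<in> borel_measurable borel" "down_limit h \<in> borel_measurable borel"
proof -
  show "up_limit h \<in> borel_measurable borel"
    by (rule borel_measurable_LIMSEQ_metric[of "\<lambda>k r. if 0 \<le> r then up h k r else 0"])
      (use passage_limits(1)[OF h] in \<open>auto simp: up_limit_def\<close>)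
  show "down_limit h \<in> borel_measurable borel"
    by (rule borel_measurable_LIMSEQ_metric[of "\<lambda>k r. if 0 \<le> r then down h k r else 0"])
      (use passage_limits(2)[OF h] in \<open>auto simp: down_limit_def\<close>)
qed

lemma passage_limits_nonneg:
  assumes h: "h \<in> nonneg_on Zm" and r: "r \<ge> 0"
  shows "up_limit h r \<in> nonneg_on Zp" "down_limit h r \<in> nonneg_on Zm"
  using passage_nonneg[OF h r]
  by (auto intro: nonneg_on_limit[OF passage_limits(1)[OF h r]] nonneg_on_limit[OF passage_limits(2)[OF h r]])

lemma passage_limits_bounded:
  assumes h: "h \<in> nonneg_on Zm"
  obtains B where "B > 0" "\<And>r. norm (up_limit h r) \<le> B" "\<And>r. norm (down_limit h r) \<le> B"
proof -
  obtain B where B: "B > 0" "\<And>k r. r \<ge> 0 \<Longrightarrow> norm (up h k r) \<le> B" 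
    "\<And>k r. r \<ge> 0 \<Longrightarrow> norm (down h k r) \<le> B" using passage_bounded[OF h] by blast
  show thesis
  proof (rule that[OF B(1)])
    fix r
    show "norm (up_limit h r) \<le> B"
      using B LIMSEQ_le_const2[OF tendsto_norm[OF passage_limits(1)[OF h, of r]], of B]
      by (cases "0 \<le> r") (auto simp: up_limit_def)
    show "norm (down_limit h r) \<le> B"
      using B LIMSEQ_le_const2[OF tendsto_norm[OF passage_limits(2)[OF h, of r]], of B]
      by (cases "0 \<le> r") (auto simp: down_limit_def)
  qed
qed

lemma gain_tendsto:
  assumes "(f \<longlongrightarrow> u) F" "(g \<longlongrightarrow> v) F"
  shows "((\<lambda>x. gain_p (f x) (g x)) \<longlongrightarrow> gain_p u v) F" "((\<lambda>x. gain_m (f x) (g x)) \<longlongrightarrow> gain_m u v) F"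
  unfolding gain_p_def gain_m_def
  by (intro tendsto_add bounded_linear.tendsto[OF matrix_vector_mul_bounded_linear] assms)+

lemma passage_limit_equations:
  assumes h: "h \<in> nonneg_on Zm" and r: "r \<ge> 0"
  shows "up_limit h r = (LBINT s:{r..}. mexp ((s - r) *\<^sub>R Gp) *v gain_p (up_limit h s) (down_limit h s))"
    and "down_limit h r = mexp (r *\<^sub>R Gm) *v h + 
      (LBINT s:{0..r}. mexp ((r - s) *\<^sub>R Gm) *v gain_m (up_limit h s) (down_limit h s))"
proof -
  note [measurable] = passage_limits_measurable[OF h]
  obtain B where B: "B > 0" "\<And>k r. r \<ge> 0 \<Longrightarrow> norm (up h k r) \<le> B" 
    "\<And>k r. r \<ge> 0 \<Longrightarrow> norm (down h k r) \<le> B" using passage_bounded[OF h] by blast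
  obtain C where C: "C > 0" "\<And>u v. norm (gain_p u v) \<le> C * (norm u + norm v)" 
    "\<And>u v. norm (gain_m u v) \<le> C * (norm u + norm v)" using gain_bounded by blast
  have le: "C * (norm (up h k s) + norm (down h k s)) \<le> C * (B + B)" if "s \<ge> 0" for k s
    using C B that by (intro mult_left_mono add_mono) auto
  obtain K \<rho> where K: "K > 0" "\<rho> > 0" 
    "\<And>t v. t \<ge> 0 \<Longrightarrow> norm (mexp (t *\<^sub>R Gp) *v v) \<le> K * exp (- (\<rho> * t)) * norm v"
    using p.mexp_exponential_decay[OF Gp_cone Gp_vanishes] by blast
  have "(\<lambda>k. up h (Suc k) r) \<longlonglongrightarrow> (LBINT s:{r..}. mexp ((s - r) *\<^sub>R Gp) *v gain_p (up_limit h s) (down_limit h s))"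
    unfolding up_Suc
  proof (rule set_integral_dominated_convergence[OF _ _ _ _ set_integrable_exp_tail[OF K(2), of r "K * (C * (B + B))"]])
    fix s assume s: "s \<in> {r..}"
    show "(\<lambda>k. mexp ((s - r) *\<^sub>R Gp) *v gain_p (up h k s) (down h k s)) 
        \<longlonglongrightarrow> mexp ((s - r) *\<^sub>R Gp) *v gain_p (up_limit h s) (down_limit h s)"
      using r s by (intro bounded_linear.tendsto[OF matrix_vector_mul_bounded_linear] gain_tendsto 
          passage_limits h) auto
    fix k
    have "norm (mexp ((s - r) *\<^sub>R Gp) *v gain_p (up h k s) (down h k s)) 
        \<le> K * exp (- (\<rho> * (s - r))) * norm (gain_p (up h k s) (down h k s))"
      using s by (intro K) auto
    also have "\<dots> \<le> K * exp (- (\<rho> * (s - r))) * (C * (B + B))"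
      using s r K by (intro mult_left_mono order_trans[OF C(2) le]) auto
    finally show "norm (mexp ((s - r) *\<^sub>R Gp) *v gain_p (up h k s) (down h k s)) 
        \<le> K * (C * (B + B)) * exp (- (\<rho> * (s - r)))" by (simp add: mult_ac)
  qed (auto simp del: passage.simps)
  then show "up_limit h r = (LBINT s:{r..}. mexp ((s - r) *\<^sub>R Gp) *v gain_p (up_limit h s) (down_limit h s))"
    using LIMSEQ_unique[OF LIMSEQ_Suc[OF passage_limits(1)[OF h r]]] by blast
  have "bounded ((\<lambda>s. mexp ((r - s) *\<^sub>R Gm)) ` {0..r})"
    by (intro compact_imp_bounded compact_continuous_image continuous_on_compose2[OF mexp_continuous[of UNIV]]) 
      (auto intro!: continuous_intros)
  then obtain c where c: "c > 0" "\<And>s. s \<in> {0..r} \<Longrightarrow> norm (mexp ((r - s) *\<^sub>R Gm)) \<le> c"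
    by (auto simp: bounded_pos)
  obtain k0 where k0: "\<And>(X::real^'m^'m) (v::real^'m). norm (X *v v) \<le> norm X * norm v * k0" "k0 > 0"
    using bounded_bilinear.pos_bounded[OF bounded_bilinear_matrix_vector_mult] by metis
  have "(\<lambda>k. down h (Suc k) r) \<longlonglongrightarrow> mexp (r *\<^sub>R Gm) *v h +
      (LBINT s:{0..r}. mexp ((r - s) *\<^sub>R Gm) *v gain_m (up_limit h s) (down_limit h s))"
    unfolding down_Suc
  proof (intro tendsto_add tendsto_const, rule set_integral_dominated_convergence[where w="\<lambda>s. c * (C * (B + B)) * k0"])
    show "set_integrable lborel {0..r} (\<lambda>s. c * (C * (B + B)) * k0)"
      by (rule set_integrable_Icc_bounded[where B="\<bar>c * (C * (B + B)) * k0\<bar>"]) auto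
    fix s assume s: "s \<in> {0..r}"
    show "(\<lambda>k. mexp ((r - s) *\<^sub>R Gm) *v gain_m (up h k s) (down h k s)) 
        \<longlonglongrightarrow> mexp ((r - s) *\<^sub>R Gm) *v gain_m (up_limit h s) (down_limit h s)"
      using r s by (intro bounded_linear.tendsto[OF matrix_vector_mul_bounded_linear] gain_tendsto 
          passage_limits h) auto
    fix k
    have "norm (mexp ((r - s) *\<^sub>R Gm) *v gain_m (up h k s) (down h k s)) 
        \<le> norm (mexp ((r - s) *\<^sub>R Gm)) * norm (gain_m (up h k s) (down h k s)) * k0" by (rule k0)
    also have "\<dots> \<le> c * (C * (B + B)) * k0"
      using s c k0 C B by (intro mult_right_mono mult_mono order_trans[OF C(3) le]) auto
    finally show "norm (mexp ((r - s) *\<^sub>R Gm) *v gain_m (up h k s) (down h k s)) \<le> c * (C * (B + B)) * k0" .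
  qed (auto simp del: passage.simps)
  then show "down_limit h r = mexp (r *\<^sub>R Gm) *v h + 
      (LBINT s:{0..r}. mexp ((r - s) *\<^sub>R Gm) *v gain_m (up_limit h s) (down_limit h s))"
    using LIMSEQ_unique[OF LIMSEQ_Suc[OF passage_limits(2)[OF h r]]] by blast
qed

lemma down_limit_0: 
  assumes "h \<in> nonneg_on Zm"
  shows "down_limit h 0 = h"
proof -
  have "(LBINT s:{0..0}. mexp ((0 - s) *\<^sub>R Gm) *v gain_m (up_limit h s) (down_limit h s)) = 0"
    unfolding set_lebesgue_integral_def
    by (rule integral_eq_zero_AE, rule eventually_mono[OF AE_lborel_singleton[of 0]])
      (auto simp: indicator_def)
  then show ?thesis using passage_limit_equations(2)[OF assms, of 0] by simp
qed

text \<open>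
  Taking the exponential of the end point \<open>r\<close> out of the integrals leaves integrals
  with \<open>r\<close> only in a limit of integration. They are continuous in \<open>r\<close>,
  hence so are the integrands, hence the integrals are differentiable. For the upward part the
  integral over \<open>[r, \<infinity>)\<close> is a constant minus the integral over \<open>[0,
  r]\<close>.
\<close>
lemma passage_limit_derivatives:
  assumes h: "h \<in> nonneg_on Zm" and r: "r \<in> {0..b}"
  shows "(up_limit h has_vector_derivative - (Cp *v up_limit h r + Dpm *v down_limit h r)) (at r within {0..b})"
    and "(down_limit h has_vector_derivative Cm *v down_limit h r + Dmp *v up_limit h r) (at r within {0..b})"
proof -
  note [measurable] = passage_limits_measurable[OF h]
  obtain B where B: "B > 0" "\<And>r. norm (up_limit h r) \<le> B" "\<And>r. norm (down_limit h r) \<le> B" 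
    using passage_limits_bounded[OF h] by blast
  obtain C where C: "C > 0" "\<And>u v. norm (gain_p u v) \<le> C * (norm u + norm v)" 
    "\<And>u v. norm (gain_m u v) \<le> C * (norm u + norm v)" using gain_bounded by blast
  have le: "C * (norm (up_limit h s) + norm (down_limit h s)) \<le> C * (B + B)" for s
    using C B by (intro mult_left_mono add_mono) auto
  define gp where "gp s = gain_p (up_limit h s) (down_limit h s)" for s
  define gm where "gm s = gain_m (up_limit h s) (down_limit h s)" for s
  have [measurable]: "gp \<in> borel_measurable borel" "gm \<in> borel_measurable borel"
    unfolding gp_def gm_def by measurable
  have bnd: "norm (gp s) \<le> C * (B + B)" "norm (gm s) \<le> C * (B + B)" for s
    unfolding gp_def gm_def by (rule order_trans[OF C(2) le] order_trans[OF C(3) le])+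
  define Jp where "Jp r = (LBINT s:{0..r}. mexp (s *\<^sub>R Gp) *v gp s)" for r
  define Jm where "Jm r = (LBINT s:{0..r}. mexp (s *\<^sub>R (- Gm)) *v gm s)" for r
  note Jp = indefinite_mexp_integral[where g=gp and b=b and A=Gp, folded Jp_def, OF _ bnd(1), simplified]
  note Jm = indefinite_mexp_integral[where g=gm and b=b and A="- Gm", folded Jm_def, OF _ bnd(2), simplified]
  have K: "set_integrable lborel {0..} (\<lambda>s. mexp ((s - 0) *\<^sub>R Gp) *v gp s)"
    by (rule convolution_integrable_p[of gp "C * (B + B)" 0]) (use bnd in auto)
  define c where "c = (LBINT s:{0..}. mexp (s *\<^sub>R Gp) *v gp s)"
  have up: "up_limit h r = mexp (r *\<^sub>R (- Gp)) *v (c - Jp r)" if r: "r \<in> {0..b}" for r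
  proof -
    have int: "set_integrable lborel {r..} (\<lambda>s. mexp (s *\<^sub>R Gp) *v gp s)"
      using r by (intro set_integrable_subset[OF K[simplified]]) auto
    have "up_limit h r = (LBINT s:{r..}. mexp (r *\<^sub>R (- Gp)) *v (mexp (s *\<^sub>R Gp) *v gp s))"
      using r by (subst passage_limit_equations(1)[OF h])
        (simp_all only: gp_def matrix_vector_mul_assoc mexp_diff atLeastAtMost_iff)
    also have "\<dots> = mexp (r *\<^sub>R (- Gp)) *v (LBINT s:{r..}. mexp (s *\<^sub>R Gp) *v gp s)"
      by (rule linear_set_integral(1)[OF matrix_vector_mul_bounded_linear int, symmetric])
    also have "(LBINT s:{r..}. mexp (s *\<^sub>R Gp) *v gp s) = c - Jp r"
      unfolding c_def Jp_def using r by (intro LBINT_split_tail) (use K in auto)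
    finally show ?thesis .
  qed
  have down: "down_limit h r = mexp (r *\<^sub>R Gm) *v (h + Jm r)" if r: "r \<in> {0..b}" for r
  proof -
    have int: "set_integrable lborel {0..r} (\<lambda>s. mexp (s *\<^sub>R (- Gm)) *v gm s)"
      by (rule indefinite_mexp_integral(1)[where B="C * (B + B)"]) (use bnd in auto)
    have "down_limit h r = mexp (r *\<^sub>R Gm) *v h + 
        (LBINT s:{0..r}. mexp (r *\<^sub>R Gm) *v (mexp (s *\<^sub>R (- Gm)) *v gm s))"
      using r by (subst passage_limit_equations(2)[OF h])
        (simp_all only: gm_def matrix_vector_mul_assoc mexp_diff atLeastAtMost_iff)
    also have "(LBINT s:{0..r}. mexp (r *\<^sub>R Gm) *v (mexp (s *\<^sub>R (- Gm)) *v gm s)) = mexp (r *\<^sub>R Gm) *v Jm r"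
      unfolding Jm_def by (rule linear_set_integral(1)[OF matrix_vector_mul_bounded_linear int, symmetric])
    finally show ?thesis by (simp add: mult_linear_simps)
  qed
  have cont_up: "continuous_on {0..b} (up_limit h)"
    by (subst continuous_on_cong[OF refl up], assumption)
      (intro bounded_bilinear.continuous_on[OF bounded_bilinear_matrix_vector_mult] mexp_continuous
        continuous_intros Jp(2))
  have cont_down: "continuous_on {0..b} (down_limit h)"
    by (subst continuous_on_cong[OF refl down], assumption)
      (intro bounded_bilinear.continuous_on[OF bounded_bilinear_matrix_vector_mult] mexp_continuous
        continuous_intros Jm(2))
  have cont: "continuous_on {0..b} gp" "continuous_on {0..b} gm"
    unfolding gp_def gm_def gain_p_def gain_m_def
    by (intro continuous_intros bounded_linear.continuous_on[OF matrix_vector_mul_bounded_linear] 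
        cont_up cont_down)+
  have inv: "mexp (r *\<^sub>R (- A)) *v (mexp (r *\<^sub>R A) *v v) = v" "mexp (r *\<^sub>R A) *v (mexp (r *\<^sub>R (- A)) *v v) = v" 
    for A :: "real^'n^'n" and v
    using mexp_minus[of r A] mexp_minus[of "- r" A] by (simp_all add: matrix_vector_mul_assoc)
  have "(Jp has_vector_derivative mexp (r *\<^sub>R Gp) *v gp r) (at r within {0..b})"
    by (rule Jp(3)) (use cont r in auto)
  from matrix_vector_derivative[OF mexp_has_vector_derivative has_vector_derivative_diff[OF has_vector_derivative_const this], 
      of "- Gp" c]
  have "((\<lambda>r. mexp (r *\<^sub>R (- Gp)) *v (c - Jp r)) has_vector_derivative
      - (Gp *v (mexp (r *\<^sub>R (- Gp)) *v (c - Jp r))) - gp r) (at r within {0..b})"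
    by (rule has_vector_derivative_eq_rhs) 
      (simp add: mult_linear_simps matrix_vector_mul_assoc[symmetric] inv del: scaleR_minus_right)
  then have "(up_limit h has_vector_derivative
      - (Gp *v (mexp (r *\<^sub>R (- Gp)) *v (c - Jp r))) - gp r) (at r within {0..b})"
    by (rule has_vector_derivative_transform[OF r, rotated]) (simp add: up)
  then show "(up_limit h has_vector_derivative - (Cp *v up_limit h r + Dpm *v down_limit h r)) (at r within {0..b})"
    by (rule has_vector_derivative_eq_rhs) (simp only: up[OF r, symmetric], simp add: gp_def gain_p_def mult_linear_simps)
  have "(Jm has_vector_derivative mexp (r *\<^sub>R (- Gm)) *v gm r) (at r within {0..b})"
    using Jm(3)[OF cont(2)] r by simp
  from matrix_vector_derivative[OF mexp_has_vector_derivative has_vector_derivative_add[OF has_vector_derivative_const this], 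
      of Gm h]
  have "((\<lambda>r. mexp (r *\<^sub>R Gm) *v (h + Jm r)) has_vector_derivative
      Gm *v (mexp (r *\<^sub>R Gm) *v (h + Jm r)) + gm r) (at r within {0..b})"
    by (rule has_vector_derivative_eq_rhs) 
      (simp add: mult_linear_simps matrix_vector_mul_assoc[symmetric] inv del: scaleR_minus_right)
  then have "(down_limit h has_vector_derivative
      Gm *v (mexp (r *\<^sub>R Gm) *v (h + Jm r)) + gm r) (at r within {0..b})"
    by (rule has_vector_derivative_transform[OF r, rotated]) (simp add: down)
  then show "(down_limit h has_vector_derivative Cm *v down_limit h r + Dmp *v up_limit h r) (at r within {0..b})"
    by (rule has_vector_derivative_eq_rhs) (simp only: down[OF r, symmetric], simp add: gm_def gain_m_def mult_linear_simps)
qed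

end

section \<open>Identification with the matrix exponential\<close>

context fluid_cones
begin

text \<open>
  Let \<open>u\<close> and \<open>d\<close> be the limits and \<open>G = u - \<Psi>' d\<close>,
  with \<open>\<Psi>\<close> and \<open>\<Psi>'\<close> two consecutive iterates. The Sylvester
  equation of \<open>\<Psi>'\<close> gives \<open>G' + Cp G = - ((\<Psi>' - \<Psi>) Dmp u +
  \<Psi> Dmp (u - \<Psi> d))\<close>, where the bracket is nonnegative by monotonicity of the
  iterates and by induction. So \<open>e\<^sup>C\<^sup>s G(r + s)\<close>, \<open>C =
  Cp\<close>, decreases in \<open>s\<close>; it tends to \<open>0\<close>, and therefore its
  value at \<open>s = 0\<close> is nonnegative.
\<close>
lemma psi_le_up_limit:
  assumes h: "h \<in> nonneg_on Zm" and "r \<ge> 0"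
  shows "up_limit h r - psi j *v down_limit h r \<in> nonneg_on Zp"
  using \<open>r \<ge> 0\<close>
proof (induction j arbitrary: r)
  case 0
  then show ?case using passage_limits_nonneg[OF h] by (simp add: mult_linear_simps)
next
  case (Suc j)
  let ?u = "up_limit h" and ?d = "down_limit h"
  define \<Psi> \<Psi>' where "\<Psi> = psi j" and "\<Psi>' = psi (Suc j)"
  have syl: "\<Psi>' ** Cm = - (Cp ** \<Psi>') - (Dpm + \<Psi> ** Dmp ** \<Psi>)"
    using psi_sylvester[of j] unfolding \<Psi>_def \<Psi>'_def 
    by (metis (no_types, lifting) add.commute add_diff_cancel_right' diff_conv_add_uminus)
  define G where "G s = ?u (r + s) - \<Psi>' *v ?d (r + s)" for s
  show ?case
  proof (rule nonneg_onI)
    fix z assume z: "z \<in> Zp"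
    have ge: "z \<bullet> (mexp (S *\<^sub>R Cp) *v G S) \<le> z \<bullet> G 0" if S: "S \<ge> 0" for S
    proof -
      let ?\<phi> = "\<lambda>s. - (z \<bullet> (mexp (s *\<^sub>R Cp) *v G s))"
      let ?e = "\<lambda>s. (\<Psi>' - \<Psi>) *v (Dmp *v ?u (r + s)) + \<Psi> *v (Dmp *v (?u (r + s) - \<Psi> *v ?d (r + s)))"
      have "?\<phi> 0 \<le> ?\<phi> S"
      proof (rule nondecreasing_on_Icc[OF S, where f="?\<phi>"])
        fix s assume s: "s \<in> {0..S}"
        have shift: "((\<lambda>s. r + s) has_vector_derivative 1) (at s within {0..S})"
          by (auto intro!: derivative_eq_intros)
        have sub: "(\<lambda>s. r + s) ` {0..S} \<subseteq> {0..r + S}" using Suc.prems by auto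
        have rs: "r + s \<in> {0..r + S}" using s Suc.prems by auto
        have u: "((\<lambda>s. ?u (r + s)) has_vector_derivative - (Cp *v ?u (r + s) + Dpm *v ?d (r + s))) (at s within {0..S})"
          using vector_diff_chain_within[OF shift has_vector_derivative_within_subset[OF passage_limit_derivatives(1)[OF h rs] sub]]
          by (simp add: o_def)
        have d: "((\<lambda>s. ?d (r + s)) has_vector_derivative Cm *v ?d (r + s) + Dmp *v ?u (r + s)) (at s within {0..S})"
          using vector_diff_chain_within[OF shift has_vector_derivative_within_subset[OF passage_limit_derivatives(2)[OF h rs] sub]]
          by (simp add: o_def)
        note dG = has_vector_derivative_diff[OF u matrix_vector_derivative[OF has_vector_derivative_const[of \<Psi>'] d]]
        have eq: "- (Cp *v ?u (r + s) + Dpm *v ?d (r + s)) - (\<Psi>' *v (Cm *v ?d (r + s) + Dmp *v ?u (r + s)) + 0 *v ?d (r + s)) 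
            + Cp *v G s = - ?e s"
          by (simp add: G_def mult_linear_simps matrix_vector_mul_assoc syl matrix_mul_assoc)
        show "(?\<phi> has_real_derivative z \<bullet> (mexp (s *\<^sub>R Cp) *v ?e s)) (at s within {0..S})"
          unfolding G_def
          by (rule DERIV_cong[OF DERIV_minus[OF inner_mexp_derivative[OF dG]]], 
              simp only: G_def[symmetric] eq) (simp add: mult_linear_simps inner_diff_right)
        show "0 \<le> z \<bullet> (mexp (s *\<^sub>R Cp) *v ?e s)"
          unfolding \<Psi>_def \<Psi>'_def using s Suc.prems
          by (intro nonneg_onD[OF _ z] cone_mapD[OF Cp_cone] nonneg_on_add cone_mapD[OF psi_mono] 
              cone_mapD[OF psi_cone] cone_mapD[OF Dmp_cone] passage_limits_nonneg Suc.IH h) auto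
      qed
      then show ?thesis by simp
    qed
    obtain K \<rho> where K: "K > 0" "\<rho> > 0" 
      "\<And>t v. t \<ge> 0 \<Longrightarrow> norm (mexp (t *\<^sub>R Cp) *v v) \<le> K * exp (- (\<rho> * t)) * norm v"
      using p.mexp_exponential_decay[OF Cp_cone Cp_vanishes] by blast
    obtain B where B: "B > 0" "\<And>r. norm (?u r) \<le> B" "\<And>r. norm (?d r) \<le> B" 
      using passage_limits_bounded[OF h] by blast
    obtain k where k: "\<And>v. norm (\<Psi>' *v v) \<le> norm v * k" "k > 0"
      using bounded_linear.pos_bounded[OF matrix_vector_mul_bounded_linear] by metis
    have nG: "norm (G s) \<le> B + B * k" for s
    proof -
      have "norm (\<Psi>' *v ?d (r + s)) \<le> B * k"
        using order_trans[OF k(1) mult_right_mono[OF B(3)]] k(2) by simp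
      then show ?thesis
        unfolding G_def using norm_triangle_ineq4[of "?u (r + s)" "\<Psi>' *v ?d (r + s)"] B(2)[of "r + s"] by linarith
    qed
    have "((\<lambda>S. K * exp (- (\<rho> * S)) * (B + B * k)) \<longlongrightarrow> 0) at_top" using K by real_asymp
    then have "((\<lambda>S. mexp (S *\<^sub>R Cp) *v G S) \<longlongrightarrow> 0) at_top"
    proof (rule Lim_null_comparison[rotated])
      show "\<forall>\<^sub>F S in at_top. norm (mexp (S *\<^sub>R Cp) *v G S) \<le> K * exp (- (\<rho> * S)) * (B + B * k)"
        using eventually_ge_at_top[of 0]
        by eventually_elim (use K in \<open>auto intro!: order_trans[OF K(3)] mult_left_mono nG\<close>)
    qed
    then have "((\<lambda>S. z \<bullet> (mexp (S *\<^sub>R Cp) *v G S)) \<longlongrightarrow> z \<bullet> 0) at_top" by (intro tendsto_intros)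
    then have "z \<bullet> 0 \<le> z \<bullet> G 0"
      by (rule tendsto_upperbound) (use ge in \<open>auto intro: eventually_mono[OF eventually_ge_at_top[of 0]]\<close>)
    then show "0 \<le> z \<bullet> (?u r - psi (Suc j) *v ?d r)"
      by (simp add: G_def \<Psi>'_def del: Psi_seq.simps)
  qed
qed

text \<open>
  At height \<open>0\<close> the preceding bound reads \<open>psi j *v h \<le> up_limit h
  0\<close>, so the increasing sequence \<open>psi j *v h\<close> is bounded in the order.
\<close>
lemma psi_vector_convergent: "convergent (\<lambda>j. psi j *v v)"
proof -
  have nn: "convergent (\<lambda>j. psi j *v h)" if h: "h \<in> nonneg_on Zm" for h
  proof (rule p.convergent_of_inner, rule incseq_bounded_convergent)
    fix z j assume z: "z \<in> Zp"
    show "z \<bullet> (psi j *v h) \<le> z \<bullet> (psi (Suc j) *v h)"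
      using nonneg_onD[OF cone_mapD[OF psi_mono h] z] 
      by (simp add: mult_linear_simps inner_diff_right del: Psi_seq.simps)
    show "z \<bullet> (psi j *v h) \<le> z \<bullet> up_limit h 0"
      using nonneg_onD[OF psi_le_up_limit[OF h, of 0 j] z] by (simp add: down_limit_0[OF h] inner_diff_right)
  qed
  obtain L where "L > 0" "\<And>v. (L * norm v) *\<^sub>R 1 + v \<in> nonneg_on Zm" using m.order_unit by metis
  then have "convergent (\<lambda>j. psi j *v ((L * norm v) *\<^sub>R 1 + v) - psi j *v ((L * norm v) *\<^sub>R 1))"
    by (intro convergent_diff nn nonneg_on_scaleR m.one_nonneg) auto
  then show ?thesis by (simp add: mult_linear_simps)
qed

lemma psi_tendsto: "psi \<longlonglongrightarrow> Psi Cp Cm Dpm Dmp"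
proof -
  have "\<exists>l. (\<lambda>n. psi n $ i $ j) \<longlonglongrightarrow> l" for i j
  proof -
    obtain l where "(\<lambda>n. psi n *v axis j 1) \<longlonglongrightarrow> l"
      using psi_vector_convergent[of "axis j 1"] by (auto simp: convergent_def)
    from tendsto_vec_nth[OF this, of i] show ?thesis
      by (auto simp: matrix_vector_mult_basis column_def)
  qed
  then obtain l where l: "\<And>i j. (\<lambda>n. psi n $ i $ j) \<longlonglongrightarrow> l i j" by metis
  have "psi \<longlonglongrightarrow> (\<chi> i j. l i j)" by (intro vec_tendstoI) (simp add: l)
  then have "convergent psi" by (rule convergentI)
  then show ?thesis unfolding Psi_def by (simp add: convergent_LIMSEQ_iff)
qed

abbreviation "\<Psi> \<equiv> Psi Cp Cm Dpm Dmp"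

lemma Psi_cone: "cone_map Zp Zm \<Psi>"
  by (rule cone_map_limit[OF psi_tendsto]) (auto simp: psi_cone)

lemma Psi_riccati: "Cp ** \<Psi> + \<Psi> ** Cm = - (Dpm + \<Psi> ** Dmp ** \<Psi>)"
proof (rule LIMSEQ_unique)
  note bb = bounded_bilinear.tendsto[OF bounded_bilinear_matrix_mult]
  show "(\<lambda>n. Cp ** psi (Suc n) + psi (Suc n) ** Cm) \<longlonglongrightarrow> Cp ** \<Psi> + \<Psi> ** Cm"
    by (intro tendsto_add bb tendsto_const LIMSEQ_Suc[OF psi_tendsto])
  show "(\<lambda>n. Cp ** psi (Suc n) + psi (Suc n) ** Cm) \<longlonglongrightarrow> - (Dpm + \<Psi> ** Dmp ** \<Psi>)"
    unfolding psi_sylvester by (intro tendsto_minus tendsto_add bb tendsto_const psi_tendsto)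
qed

lemma down_generator_cone: "t \<ge> 0 \<Longrightarrow> cone_map Zm Zm (mexp (t *\<^sub>R (Cm + Dmp ** \<Psi>)))"
  by (rule m.mexp_perturbed_cone_map[OF Cm_cone cone_map_mult[OF Dmp_cone Psi_cone]])

text \<open>
  The upper bound compares the iterates with \<open>(\<Psi> e\<^sup>U\<^sup>r h,
  e\<^sup>U\<^sup>r h)\<close>, a solution of the system by the Riccati equation. For the lower
  bound, \<open>up_limit h \<ge> \<Psi> down_limit h\<close> turns the equation of
  \<open>down_limit h\<close> into \<open>n' \<ge> U n\<close>.
\<close>
theorem down_limit_eq:
  assumes h: "h \<in> nonneg_on Zm" and r: "r \<ge> 0"
  shows "down_limit h r = mexp (r *\<^sub>R (Cm + Dmp ** \<Psi>)) *v h"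
proof -
  define U where "U = Cm + Dmp ** \<Psi>"
  let ?N = "\<lambda>r. mexp (r *\<^sub>R U) *v h"
  have \<Psi>U: "\<Psi> ** U = - (Cp ** \<Psi>) - Dpm"
  proof -
    have "\<Psi> ** U = \<Psi> ** Cm + \<Psi> ** Dmp ** \<Psi>" by (simp add: U_def mult_linear_simps matrix_mul_assoc)
    also have "\<dots> = (Cp ** \<Psi> + \<Psi> ** Cm) + (Dpm + \<Psi> ** Dmp ** \<Psi>) - Cp ** \<Psi> - Dpm" by simp
    finally show ?thesis unfolding Psi_riccati by simp
  qed
  have Ucone: "cone_map Zm Zm (mexp (t *\<^sub>R U))" if "t \<ge> 0" for t
    using down_generator_cone[OF that] by (simp add: U_def)
  have upper: "?N r - down h k r \<in> nonneg_on Zm" for k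
  proof (rule passage_le_solution(2)[where N="?N" and M="\<lambda>r. \<Psi> *v ?N r"])
    show "((\<lambda>r. ?N r) has_vector_derivative Cm *v ?N r + Dmp *v (\<Psi> *v ?N r)) (at r)" for r
      by (rule has_vector_derivative_eq_rhs[OF mexp_vector_derivative])
        (simp add: U_def mult_linear_simps matrix_vector_mul_assoc matrix_mul_assoc)
    show "((\<lambda>r. \<Psi> *v ?N r) has_vector_derivative - (Cp *v (\<Psi> *v ?N r) + Dpm *v ?N r)) (at r)" for r
      by (rule has_vector_derivative_eq_rhs[OF matrix_vector_derivative[OF has_vector_derivative_const mexp_vector_derivative]])
        (simp add: matrix_vector_mul_assoc mult_linear_simps \<Psi>U matrix_mul_assoc)
  qed (use h r in \<open>auto intro: cone_mapD[OF Ucone] cone_mapD[OF Psi_cone]\<close>)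
  have "?N r - down_limit h r \<in> nonneg_on Zm"
    by (rule nonneg_on_limit[OF tendsto_diff[OF tendsto_const passage_limits(2)[OF h r]]]) 
      (use upper in auto)
  moreover have "down_limit h r - ?N r \<in> nonneg_on Zm"
  proof (rule nonneg_onI)
    fix z assume z: "z \<in> Zm"
    let ?d = "down_limit h" and ?u = "up_limit h"
    have ge: "?u s - \<Psi> *v ?d s \<in> nonneg_on Zp" if s: "s \<ge> 0" for s
      by (rule nonneg_on_limit[OF tendsto_diff[OF tendsto_const bounded_bilinear.tendsto
            [OF bounded_bilinear_matrix_vector_mult psi_tendsto tendsto_const]]])
        (use psi_le_up_limit[OF h s] in auto)
    have "z \<bullet> (mexp ((r - 0) *\<^sub>R U) *v ?d 0) \<le> z \<bullet> (mexp ((r - r) *\<^sub>R U) *v ?d r)"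
    proof (rule nondecreasing_on_Icc[OF r, where f="\<lambda>s. z \<bullet> (mexp ((r - s) *\<^sub>R U) *v ?d s)"])
      fix s assume s: "s \<in> {0..r}"
      show "((\<lambda>s. z \<bullet> (mexp ((r - s) *\<^sub>R U) *v ?d s)) has_real_derivative
          z \<bullet> (mexp ((r - s) *\<^sub>R U) *v (Dmp *v (?u s - \<Psi> *v ?d s)))) (at s within {0..r})"
        by (rule DERIV_cong[OF inner_mexp_rev_derivative[OF passage_limit_derivatives(2)[OF h s]]])
          (simp add: U_def mult_linear_simps matrix_vector_mul_assoc matrix_mul_assoc)
      show "0 \<le> z \<bullet> (mexp ((r - s) *\<^sub>R U) *v (Dmp *v (?u s - \<Psi> *v ?d s)))"
        using s by (intro nonneg_onD[OF _ z] cone_mapD[OF Ucone] cone_mapD[OF Dmp_cone] ge) auto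
    qed
    then show "0 \<le> z \<bullet> (?d r - ?N r)" by (simp add: down_limit_0[OF h] inner_diff_right)
  qed
  ultimately show ?thesis
    unfolding U_def[symmetric]
    by (intro m.eq_of_inner) (force simp: nonneg_on_def inner_diff_right intro: antisym)
qed

end

section \<open>Minimal phase sets span\<close>

text \<open>
  Minimality forbids subspaces of one exact dimension only; a smaller one is enlarged to that
  dimension.
\<close>
lemma affine_extend:
  fixes S :: "'a::euclidean_space set"
  assumes "affine S" "aff_dim S \<le> d" "d \<le> int DIM('a)"
  shows "\<exists>S'. affine S' \<and> S \<subseteq> S' \<and> aff_dim S' = d"
  using assms(1,2)
proof (induction "nat (d - aff_dim S)" arbitrary: S)
  case 0
  then show ?case by (intro exI[of _ S]) auto
next
  case (Suc n)
  then have less: "aff_dim S < d" by simp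
  then have "S \<noteq> UNIV" using assms(3) by auto
  then obtain a where a: "a \<notin> S" by auto
  let ?S = "affine hull (insert a S)"
  have hull: "affine hull S = S" using Suc.prems by (simp add: affine_hull_eq)
  have dim: "aff_dim (insert a S) = aff_dim S + 1"
    using a unfolding aff_dim_insert hull by simp
  have "\<exists>S'. affine S' \<and> ?S \<subseteq> S' \<and> aff_dim S' = d"
    using Suc(2) less by (intro Suc(1)) (auto simp: dim)
  then show ?case using hull_subset[of "insert a S" affine] by blast
qed

lemma phase_setsD:
  assumes "phase_sets b Z"
  shows "Z i \<subseteq> {x. (\<forall>r. b r \<noteq> i \<longrightarrow> x $ r = 0) \<and> x \<bullet> 1 = 1}" "bounded (Z i)"
    "\<not> (\<exists>S. affine S \<and> aff_dim S = int (card {r. b r = i}) - 2 \<and> Z i \<subseteq> S)"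
  using assms by (simp_all only: phase_sets_def simp_thms)

text \<open>
  The affine hull of \<open>Z i\<close> misses the origin, so its dimension is one less than
  that of the span. If the span were smaller than the coordinate space of block
  \<open>i\<close>, then \<open>Z i\<close> would lie in an affine subspace of dimension at most
  block size minus two, contrary to minimality.
\<close>
lemma phase_sets_span:
  fixes b :: "'p::finite \<Rightarrow> 'i"
  assumes "phase_sets b Z"
  shows "span (\<Union>i. Z i) = UNIV"
proof -
  let ?V = "\<lambda>i. {x::real^'p. \<forall>r. b r \<noteq> i \<longrightarrow> x $ r = 0}"
  have V: "?V i \<subseteq> span (Z i)" for i
  proof -
    have sub: "Z i \<subseteq> ?V i" "\<And>z. z \<in> Z i \<Longrightarrow> z \<bullet> 1 = 1" 
      and min: "\<not> (\<exists>S. affine S \<and> aff_dim S = int (card {r. b r = i}) - 2 \<and> Z i \<subseteq> S)"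
      using phase_setsD[OF assms, of i] by (blast, blast, simp only: simp_thms)
    have dimV: "dim (?V i) = card {r. b r = i}"
      using dim_substandard_cart[of "{r. b r = i}", where 'a=real] 
      by (simp add: dim_vec_eq)
    have "0 \<notin> affine hull Z i"
    proof
      assume "0 \<in> affine hull Z i"
      moreover have "affine hull Z i \<subseteq> {x. 1 \<bullet> x = 1}"
        by (rule hull_minimal) (rule subsetI, simp add: sub(2) inner_commute[of 1], rule affine_hyperplane)
      ultimately show False by auto
    qed
    then have "aff_dim (Z i) + 1 = aff_dim (insert 0 (Z i))" by (simp add: aff_dim_insert)
    also have "\<dots> = int (dim (insert 0 (Z i)))" by (rule aff_dim_zero) (simp add: hull_inc)
    finally have dimZ: "aff_dim (Z i) = int (dim (Z i)) - 1" by (simp add: dim_insert span_zero)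
    have "card {r. b r = i} \<le> CARD('p)" by (rule card_mono) auto
    have "\<not> dim (Z i) < card {r. b r = i}"
    proof
      assume "dim (Z i) < card {r. b r = i}"
      then have "\<exists>S. affine S \<and> affine hull Z i \<subseteq> S \<and> aff_dim S = int (card {r. b r = i}) - 2"
        using \<open>card {r. b r = i} \<le> CARD('p)\<close> by (intro affine_extend) (auto simp: dimZ)
      then show False using min hull_subset[of "Z i" affine] by blast
    qed
    moreover have "subspace (?V i)" by (auto simp: subspace_def)
    ultimately have "span (Z i) = ?V i"
      using sub(1) dimV by (intro subspace_dim_equal span_minimal) (auto simp: span_minimal)
    then show ?thesis by simp
  qed
  have "axis r 1 \<in> span (\<Union>i. Z i)" for r
  proof -
    have "axis r 1 \<in> ?V (b r)" by (auto simp: axis_def)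
    also note V[of "b r"]
    also have "span (Z (b r)) \<subseteq> span (\<Union>i. Z i)" by (rule span_mono) auto
    finally show ?thesis .
  qed
  then have "Basis \<subseteq> span (\<Union>i. Z i)" by (auto simp: Basis_vec_def)
  then show ?thesis using span_minimal[OF _ subspace_span] span_Basis by blast
qed

lemma phase_sets_state_cone:
  fixes b :: "'p::finite \<Rightarrow> 'i::finite"
  assumes "phase_sets b Z"
  shows "state_cone (\<Union>i. Z i)"
proof
  show "bounded (\<Union>i. Z i)" using phase_setsD(2)[OF assms] by (intro bounded_UN) auto
  show "span (\<Union>i. Z i) = UNIV" by (rule phase_sets_span[OF assms])
  show "z \<bullet> 1 = 1" if "z \<in> (\<Union>i. Z i)" for z using that phase_setsD(1)[OF assms] by blast
qed

section \<open>Blocks\<close>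

lemma sum_block_part:
  fixes b :: "'p::finite \<Rightarrow> 'i::finite" and c :: "'q::finite \<Rightarrow> 'j::finite"
  shows "(\<Sum>(i, j)\<in>UNIV. block_part b c i j M) = M"
proof -
  have "(\<Sum>(i, j)\<in>UNIV. block_part b c i j M) $ r $ s = M $ r $ s" for r s
  proof -
    have "(case k of (i, j) \<Rightarrow> block_part b c i j M) $ r $ s = (if k = (b r, c s) then M $ r $ s else 0)" for k
      by (auto simp: block_part_def split: prod.splits)
    then have "(\<Sum>(i, j)\<in>UNIV. block_part b c i j M) $ r $ s = 
        (\<Sum>k\<in>UNIV. if k = (b r, c s) then M $ r $ s else 0)"
      by (simp only: sum_component)
    then show ?thesis by simp
  qed
  then show ?thesis by (simp add: vec_eq_iff)
qed

lemma sum_block_part_off_diagonal: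
  fixes b :: "'p::finite \<Rightarrow> 'i::finite"
  shows "(\<Sum>(i, j)\<in>{(i, j). i \<noteq> j}. block_part b b i j M) = M - block_diag b M"
proof -
  have "(\<Sum>(i, j)\<in>{(i, j). i \<noteq> j}. block_part b b i j M) $ r $ s = M $ r $ s - block_diag b M $ r $ s" for r s
  proof -
    have "(case k of (i, j) \<Rightarrow> block_part b b i j M) $ r $ s = (if k = (b r, b s) then M $ r $ s else 0)" for k
      by (auto simp: block_part_def split: prod.splits)
    then have "(\<Sum>(i, j)\<in>{(i, j). i \<noteq> j}. block_part b b i j M) $ r $ s = 
        (\<Sum>k\<in>{(i, j). i \<noteq> j}. if k = (b r, b s) then M $ r $ s else 0)"
      by (simp only: sum_component)
    then show ?thesis by (simp add: block_diag_def)
  qed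
  then show ?thesis by (simp add: vec_eq_iff)
qed

lemma sum_block_part_off_diagonal':
  fixes b :: "'p::finite \<Rightarrow> 'i::finite"
  shows "(\<Sum>k\<in>{(i, j). i \<noteq> j}. block_part b b (fst k) (snd k) M) = M - block_diag b M"
  using sum_block_part_off_diagonal[of b M] by (simp add: case_prod_beta)

lemma vector_block_part_other:
  assumes "\<And>r. b r \<noteq> i \<Longrightarrow> a $ r = 0" "i' \<noteq> i"
  shows "a v* block_part b c i' j M = 0"
  using assms by (auto simp: vec_eq_iff vector_matrix_mult_def block_part_def intro!: sum.neutral)

section \<open>Normalisation\<close>

lemma normalise_zero [simp]: "normalise 0 = 0"
  by (simp add: normalise_def)

lemma normalise_inner: "v \<bullet> 1 \<noteq> 0 \<Longrightarrow> (v \<bullet> 1) * (normalise v \<bullet> h) = v \<bullet> h"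
  by (simp add: normalise_def)

text \<open>
  Intensity times target is the unnormalised target, also if the latter is \<open>0\<close>.
\<close>
lemma jump_ok_inner:
  assumes "jump_ok a M S" "\<And>z. z \<in> S \<Longrightarrow> z \<bullet> 1 = 1"
  shows "((a v* M) \<bullet> 1) * (normalise (a v* M) \<bullet> h) = (a v* M) \<bullet> h"
proof (cases "a v* M = 0")
  case False
  then have "normalise (a v* M) \<bullet> 1 = 1" using assms by (auto simp: jump_ok_def)
  then have "(a v* M) \<bullet> 1 \<noteq> 0" by (auto simp: normalise_def)
  then show ?thesis by (rule normalise_inner)
qed simp

lemma jump_ok_nonneg:
  assumes "jump_ok a M S" "\<And>z. z \<in> S \<Longrightarrow> z \<bullet> 1 = 1" "\<And>z. z \<in> S \<Longrightarrow> 0 \<le> z \<bullet> h"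
  shows "0 \<le> (a v* M) \<bullet> h"
proof (cases "a v* M = 0")
  case False
  then have "0 \<le> normalise (a v* M) \<bullet> h" using assms by (auto simp: jump_ok_def)
  moreover have "0 \<le> (a v* M) \<bullet> 1" using assms by (auto simp: jump_ok_def)
  ultimately show ?thesis by (subst jump_ok_inner[OF assms(1,2), symmetric]) auto
qed simp


text \<open>
  The mass starts at one and is continuous; it cannot vanish, since \<open>normalise\<close>
  would then return \<open>0\<close>, which is not a state.
\<close>
lemma flow_mass_positive:
  assumes "\<And>r. r \<ge> 0 \<Longrightarrow> normalise (a v* mexp (r *\<^sub>R G)) \<in> Z" "\<And>z. z \<in> Z \<Longrightarrow> z \<bullet> 1 = 1"
    and "a \<bullet> 1 = 1" "r \<ge> 0"
  shows "0 < a \<bullet> (mexp (r *\<^sub>R G) *v 1)"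
proof (rule ccontr)
  let ?f = "\<lambda>r. a \<bullet> (mexp (r *\<^sub>R G) *v 1)"
  assume "\<not> 0 < ?f r"
  moreover have "continuous_on {0..r} ?f" by (intro continuous_intros mexp_vector_continuous)
  ultimately obtain s where s: "0 \<le> s" "?f s = 0"
    using IVT2'[of ?f r 0 0] assms(3,4) by auto
  then have "normalise (a v* mexp (s *\<^sub>R G)) = 0" by (simp add: normalise_def vector_matrix_inner)
  then show False using assms(1)[OF s(1)] assms(2) by fastforce
qed

text \<open>
  The integrand is minus the logarithmic derivative of \<open>a \<bullet> e\<^sup>G\<^sup>r
  1\<close>.
\<close>
lemma exp_neg_integral_log_derivative:
  assumes pos: "\<And>r. r \<ge> 0 \<Longrightarrow> 0 < a \<bullet> (mexp (r *\<^sub>R G) *v 1)" and one: "a \<bullet> 1 = 1" and "s \<ge> 0"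
  shows "exp (- (LBINT r:{0..s}. - (a \<bullet> (mexp (r *\<^sub>R G) *v (G *v 1)) / (a \<bullet> (mexp (r *\<^sub>R G) *v 1))))) =
    a \<bullet> (mexp (s *\<^sub>R G) *v 1)"
proof -
  let ?f = "\<lambda>r. a \<bullet> (mexp (r *\<^sub>R G) *v 1)" and ?f' = "\<lambda>r. a \<bullet> (mexp (r *\<^sub>R G) *v (G *v 1))"
  have "(LBINT r:{0..s}. - (?f' r / ?f r)) = (- ln (?f s)) - (- ln (?f 0))"
  proof (rule LBINT_FTC[OF assms(3)])
    fix r assume r: "r \<in> {0..s}"
    have "(?f has_real_derivative ?f' r) (at r within {0..s})"
      by (rule DERIV_cong[OF inner_mexp_derivative[OF has_vector_derivative_const]]) simp
    then show "((\<lambda>r. - ln (?f r)) has_vector_derivative - (?f' r / ?f r)) (at r within {0..s})"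
      unfolding has_real_derivative_iff_has_vector_derivative[symmetric]
      using pos[of r] r by (auto intro!: derivative_eq_intros)
  next
    have "continuous_on {0..s} (\<lambda>r. - (?f' r / ?f r))"
      using pos by (intro continuous_intros mexp_vector_continuous) force
    then show "set_integrable lborel {0..s} (\<lambda>r. - (?f' r / ?f r))"
      unfolding set_integrable_def by (intro borel_integrable_compact) auto
  qed
  then show ?thesis using pos[OF assms(3)] one by simp
qed

section \<open>Local characteristics in linear form\<close>

definition mass :: "('p::finite, 'm::finite) state \<Rightarrow> real" where
  "mass y = (case y of Inl a \<Rightarrow> a \<bullet> 1 | Inr b \<Rightarrow> b \<bullet> 1)"

definition pairing :: "real^'p \<Rightarrow> real^'m \<Rightarrow> ('p::finite, 'm::finite) state \<Rightarrow> real" where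
  "pairing u v y = (case y of Inl a \<Rightarrow> a \<bullet> u | Inr b \<Rightarrow> b \<bullet> v)"

lemma pairing_simps [simp]: "pairing u v (Inl a) = a \<bullet> u" "pairing u v (Inr b) = b \<bullet> v"
  by (simp_all add: pairing_def)

lemma mass_simps [simp]: "mass (Inl a) = a \<bullet> 1" "mass (Inr b) = b \<bullet> 1"
  by (simp_all add: mass_def)

lemma mass_eq_pairing: "mass y = pairing 1 1 y"
  by (cases y) auto

context rap_fluid
begin

abbreviation "Up \<equiv> (\<Union>i. Zp i)"
abbreviation "Um \<equiv> (\<Union>j. Zm j)"
abbreviation "Gp \<equiv> block_diag bp Cp"
abbreviation "Gm \<equiv> block_diag bm Cm"
abbreviation "flw \<equiv> flow bp bm Cp Cm"
abbreviation "rate \<equiv> jump_rate bp bm Cp Cm Dpm Dmp"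
abbreviation "states \<equiv> state_set Zp Zm"

sublocale p: state_cone Up by (rule phase_sets_state_cone[OF phase_sets_p])
sublocale m: state_cone Um by (rule phase_sets_state_cone[OF phase_sets_m])

lemma states_cases:
  assumes "y \<in> states"
  obtains i a where "y = Inl a" "a \<in> Zp i" "a \<in> Up" | j b where "y = Inr b" "b \<in> Zm j" "b \<in> Um"
  using assms unfolding state_set_def by (elim UnE imageE UN_E) (metis UN_I UNIV_I that)+

lemma Inl_states [simp]: "Inl a \<in> states \<longleftrightarrow> a \<in> Up"
  and Inr_states [simp]: "Inr b \<in> states \<longleftrightarrow> b \<in> Um"
  unfolding state_set_def by (simp_all add: image_iff)

lemma Zp_block: "a \<in> Zp i \<Longrightarrow> bp r \<noteq> i \<Longrightarrow> a $ r = 0"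
  and Zm_block: "b \<in> Zm j \<Longrightarrow> bm s \<noteq> j \<Longrightarrow> b $ s = 0"
  using phase_setsD(1)[OF phase_sets_p] phase_setsD(1)[OF phase_sets_m] by blast+

lemma Zp_one: "a \<in> Zp i \<Longrightarrow> a \<bullet> 1 = 1" and Zm_one: "b \<in> Zm j \<Longrightarrow> b \<bullet> 1 = 1"
  by (auto intro: p.sum_one m.sum_one)

text \<open>
  The unnormalised target of the jump from phase \<open>fst k\<close> to phase \<open>snd
  k\<close>. Pairs that do not describe a jump out of \<open>y\<close> get the vector
  \<open>0\<close>, so that all jumps can be summed over one finite index type.
\<close>
definition jump_vector :: "('p, 'm) state \<Rightarrow> ('i + 'j) \<times> ('i + 'j) \<Rightarrow> ('p, 'm) state" where
  "jump_vector y k = (case (y, k) of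
      (Inl a, (Inl i, Inl j)) \<Rightarrow> Inl (if i = j then 0 else a v* block_part bp bp i j Cp)
    | (Inl a, (Inl i, Inr j)) \<Rightarrow> Inr (a v* block_part bp bm i j Dpm)
    | (Inr b, (Inr i, Inr j)) \<Rightarrow> Inr (if i = j then 0 else b v* block_part bm bm i j Cm)
    | (Inr b, (Inr i, Inl j)) \<Rightarrow> Inl (b v* block_part bm bp i j Dmp)
    | _ \<Rightarrow> Inl 0)"

definition jump_target :: "('p, 'm) state \<Rightarrow> ('i + 'j) \<times> ('i + 'j) \<Rightarrow> ('p, 'm) state" where
  "jump_target y k = map_sum normalise normalise (jump_vector y k)"

lemma sum_phase_pairs:
  fixes f :: "('i + 'j) \<times> ('i + 'j) \<Rightarrow> real"
  shows "(\<Sum>k\<in>UNIV. f k) = (\<Sum>(i, j)\<in>UNIV. f (Inl i, Inl j)) + (\<Sum>(i, j)\<in>UNIV. f (Inl i, Inr j))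
    + (\<Sum>(i, j)\<in>UNIV. f (Inr i, Inr j)) + (\<Sum>(i, j)\<in>UNIV. f (Inr i, Inl j))"
proof -
  have s: "(\<Sum>x\<in>UNIV. g x) = (\<Sum>i\<in>UNIV. g (Inl i)) + (\<Sum>j\<in>UNIV. g (Inr j))" for g :: "'i + 'j \<Rightarrow> real"
    unfolding UNIV_Plus_UNIV[symmetric] by (subst sum.Plus) auto
  have "(\<Sum>k\<in>UNIV. f k) = (\<Sum>u\<in>UNIV. \<Sum>v\<in>UNIV. f (u, v))"
    unfolding UNIV_Times_UNIV[symmetric] by (simp add: sum.cartesian_product)
  also have "\<dots> = (\<Sum>i\<in>UNIV. \<Sum>j\<in>UNIV. f (Inl i, Inl j)) + (\<Sum>i\<in>UNIV. \<Sum>j\<in>UNIV. f (Inl i, Inr j))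
    + (\<Sum>i\<in>UNIV. \<Sum>j\<in>UNIV. f (Inr i, Inr j)) + (\<Sum>i\<in>UNIV. \<Sum>j\<in>UNIV. f (Inr i, Inl j))"
    by (simp add: s sum.distrib)
  finally show ?thesis unfolding UNIV_Times_UNIV[symmetric] by (simp add: sum.cartesian_product)
qed

lemma sum_off_diagonal:
  fixes f :: "'k::finite \<times> 'k \<Rightarrow> 'a::comm_monoid_add"
  shows "(\<Sum>(i, j)\<in>UNIV. if i = j then 0 else f (i, j)) = (\<Sum>(i, j)\<in>{(i, j). i \<noteq> j}. f (i, j))"
  by (rule sum.mono_neutral_cong_right) auto

lemma rate_eq: "rate y B = (\<Sum>k\<in>UNIV. mass (jump_vector y k) * indicator B (jump_target y k))"
proof (cases y)
  case (Inl a)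
  have "(\<Sum>(i, j)\<in>UNIV. mass (jump_vector y (Inl i, Inl j)) * indicator B (jump_target y (Inl i, Inl j))) =
      (\<Sum>(i, j)\<in>UNIV. if i = j then 0 else (case (i, j) of (i, j) \<Rightarrow> ((a v* block_part bp bp i j Cp) \<bullet> 1)
              * indicator B (Inl (normalise (a v* block_part bp bp i j Cp)))))"
    by (intro sum.cong) (auto simp: Inl jump_vector_def jump_target_def)
  then show ?thesis
    unfolding sum_phase_pairs sum_off_diagonal 
    by (simp add: Inl jump_rate_def jump_vector_def jump_target_def case_prod_beta)
next
  case (Inr b)
  have "(\<Sum>(i, j)\<in>UNIV. mass (jump_vector y (Inr i, Inr j)) * indicator B (jump_target y (Inr i, Inr j))) =
      (\<Sum>(i, j)\<in>UNIV. if i = j then 0 else (case (i, j) of (i, j) \<Rightarrow> ((b v* block_part bm bm i j Cm) \<bullet> 1)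
              * indicator B (Inr (normalise (b v* block_part bm bm i j Cm)))))"
    by (intro sum.cong) (auto simp: Inr jump_vector_def jump_target_def)
  then show ?thesis
    unfolding sum_phase_pairs sum_off_diagonal 
    by (simp add: Inr jump_rate_def jump_vector_def jump_target_def case_prod_beta)
qed

text \<open>
  A state in phase \<open>i\<close> vanishes outside block \<open>i\<close>, so only jumps out
  of phase \<open>i\<close> count, and for these the admissibility assumptions of the process
  apply.
\<close>
lemma jump_vector_props:
  assumes "y \<in> states"
  shows "mass (jump_vector y k) * pairing u v (jump_target y k) = pairing u v (jump_vector y k)" (is ?A)
    and "0 \<le> mass (jump_vector y k)" (is ?B)
    and "\<lbrakk>u \<in> nonneg_on Up; v \<in> nonneg_on Um\<rbrakk> \<Longrightarrow> 0 \<le> pairing u v (jump_vector y k)"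
proof -
  have gen: "?A \<and> ?B \<and> (u \<in> nonneg_on Up \<longrightarrow> v \<in> nonneg_on Um \<longrightarrow> 0 \<le> pairing u v (jump_vector y k))"
    using assms
  proof (cases rule: states_cases)
    case (1 i a)
    have other: "a v* block_part bp c i' j M = 0" if "i' \<noteq> i" for c :: "'q::finite \<Rightarrow> 'r" and i' j M
      by (rule vector_block_part_other[of bp i]) (use Zp_block[OF 1(2)] that in auto)
    obtain k1 k2 where k: "k = (k1, k2)" by (cases k)
    show ?thesis
    proof (cases k1)
      case (Inl i')
      show ?thesis
      proof (cases "i' = i")
        case True
        show ?thesis
        proof (cases k2)
          case (Inl j)
          show ?thesis
          proof (cases "j = i")
            case False
            note ok = jump_pp[OF 1(2) False]
            show ?thesis
              using jump_ok_inner[OF ok Zp_one] jump_ok_nonneg[OF ok Zp_one] ok False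
              by (auto simp: 1(1) k Inl \<open>k1 = Inl i'\<close> True jump_vector_def jump_target_def nonneg_on_def jump_ok_def)
          qed (simp add: 1(1) k Inl \<open>k1 = Inl i'\<close> True jump_vector_def jump_target_def)
        next
          case (Inr j)
          note ok = jump_pm[OF 1(2), of j]
          show ?thesis
            using jump_ok_inner[OF ok Zm_one] jump_ok_nonneg[OF ok Zm_one] ok
            by (auto simp: 1(1) k Inr \<open>k1 = Inl i'\<close> True jump_vector_def jump_target_def nonneg_on_def jump_ok_def)
        qed
      qed (auto simp: 1(1) k Inl jump_vector_def jump_target_def other split: sum.splits)
    qed (simp add: 1(1) k jump_vector_def jump_target_def)
  next
    case (2 i a)
    have other: "a v* block_part bm c i' j M = 0" if "i' \<noteq> i" for c :: "'q::finite \<Rightarrow> 'r" and i' j M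
      by (rule vector_block_part_other[of bm i]) (use Zm_block[OF 2(2)] that in auto)
    obtain k1 k2 where k: "k = (k1, k2)" by (cases k)
    show ?thesis
    proof (cases k1)
      case (Inr i')
      show ?thesis
      proof (cases "i' = i")
        case True
        show ?thesis
        proof (cases k2)
          case (Inr j)
          show ?thesis
          proof (cases "j = i")
            case False
            note ok = jump_mm[OF 2(2) False]
            show ?thesis
              using jump_ok_inner[OF ok Zm_one] jump_ok_nonneg[OF ok Zm_one] ok False
              by (auto simp: 2(1) k Inr \<open>k1 = Inr i'\<close> True jump_vector_def jump_target_def nonneg_on_def jump_ok_def)
          qed (simp add: 2(1) k Inr \<open>k1 = Inr i'\<close> True jump_vector_def jump_target_def)
        next
          case (Inl j)
          note ok = jump_mp[OF 2(2), of j]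
          show ?thesis
            using jump_ok_inner[OF ok Zp_one] jump_ok_nonneg[OF ok Zp_one] ok
            by (auto simp: 2(1) k Inl \<open>k1 = Inr i'\<close> True jump_vector_def jump_target_def nonneg_on_def jump_ok_def)
        qed
      qed (auto simp: 2(1) k Inr jump_vector_def jump_target_def other split: sum.splits)
    qed (simp add: 2(1) k jump_vector_def jump_target_def)
  qed
  then show ?A ?B "\<lbrakk>u \<in> nonneg_on Up; v \<in> nonneg_on Um\<rbrakk> \<Longrightarrow> 0 \<le> pairing u v (jump_vector y k)" by auto
qed

lemma sum_vector_mult_inner:
  "(\<Sum>k\<in>K. (a v* M k) \<bullet> h) = a \<bullet> ((\<Sum>k\<in>K. M k) *v h)" for a :: "real^'n" and h :: "real^'q"
  by (induction K rule: infinite_finite_induct)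
    (simp_all add: vector_matrix_inner mult_linear_simps inner_add_right)

lemma sum_jump_vector:
  "(\<Sum>k\<in>UNIV. pairing u v (jump_vector (Inl a) k)) = a \<bullet> ((Cp - Gp) *v u + Dpm *v v)"
  "(\<Sum>k\<in>UNIV. pairing u v (jump_vector (Inr b) k)) = b \<bullet> ((Cm - Gm) *v v + Dmp *v u)"
proof -
  have 1: "(\<Sum>(i, j)\<in>UNIV. pairing u v (jump_vector (Inl a) (Inl i, Inl j))) =
      (\<Sum>(i, j)\<in>UNIV. if i = j then 0 else (case (i, j) of (i, j) \<Rightarrow> (a v* block_part bp bp i j Cp) \<bullet> u))"
    by (intro sum.cong) (auto simp: jump_vector_def)
  show "(\<Sum>k\<in>UNIV. pairing u v (jump_vector (Inl a) k)) = a \<bullet> ((Cp - Gp) *v u + Dpm *v v)"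
    unfolding sum_phase_pairs 1 sum_off_diagonal
    using sum_vector_mult_inner[of a "\<lambda>(i, j). block_part bp bp i j Cp" u "{(i, j). i \<noteq> j}"]
      sum_vector_mult_inner[of a "\<lambda>(i, j). block_part bp bm i j Dpm" v UNIV]
    by (simp add: sum_block_part[unfolded case_prod_beta] sum_block_part_off_diagonal'
        jump_vector_def case_prod_beta inner_add_right)
  have 2: "(\<Sum>(i, j)\<in>UNIV. pairing u v (jump_vector (Inr b) (Inr i, Inr j))) =
      (\<Sum>(i, j)\<in>UNIV. if i = j then 0 else (case (i, j) of (i, j) \<Rightarrow> (b v* block_part bm bm i j Cm) \<bullet> v))"
    by (intro sum.cong) (auto simp: jump_vector_def)
  show "(\<Sum>k\<in>UNIV. pairing u v (jump_vector (Inr b) k)) = b \<bullet> ((Cm - Gm) *v v + Dmp *v u)"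
    unfolding sum_phase_pairs 2 sum_off_diagonal
    using sum_vector_mult_inner[of b "\<lambda>(i, j). block_part bm bm i j Cm" v "{(i, j). i \<noteq> j}"]
      sum_vector_mult_inner[of b "\<lambda>(i, j). block_part bm bp i j Dmp" u UNIV]
    by (simp add: sum_block_part[unfolded case_prod_beta] sum_block_part_off_diagonal'
        jump_vector_def case_prod_beta inner_add_right)
qed

end

section \<open>The sum of Borel spaces\<close>

lemma space_sum_borel [simp]: "space sum_borel = UNIV"
  by (simp add: sum_borel_def space_measure_of_conv)

lemma sets_sum_borel:
  "sets (sum_borel :: ('a::topological_space + 'b::topological_space) measure) =
    {S. Inl -` S \<in> sets borel \<and> Inr -` S \<in> sets borel}" (is "_ = ?S")
proof -
  have "sigma_algebra UNIV ?S"
    unfolding sigma_algebra_iff2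
    by (auto simp: vimage_Diff vimage_UN Compl_eq_Diff_UNIV[symmetric] vimage_Compl borel_comp)
  then show ?thesis
    unfolding sum_borel_def by (simp add: sigma_algebra.sigma_sets_eq sets_measure_of_conv)
qed

lemma Inl_measurable [measurable]: "Inl \<in> borel \<rightarrow>\<^sub>M sum_borel"
  and Inr_measurable [measurable]: "Inr \<in> borel \<rightarrow>\<^sub>M sum_borel"
  by (auto intro!: measurableI simp: sets_sum_borel)

definition lpart :: "('p::finite, 'm::finite) state \<Rightarrow> real^'p" where
  "lpart y = (case y of Inl a \<Rightarrow> a | Inr b \<Rightarrow> 0)"

definition rpart :: "('p::finite, 'm::finite) state \<Rightarrow> real^'m" where
  "rpart y = (case y of Inl a \<Rightarrow> 0 | Inr b \<Rightarrow> b)"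

lemma part_simps [simp]: "lpart (Inl a) = a" "rpart (Inr b) = b" "lpart (Inr b) = 0" "rpart (Inl a) = 0"
  by (simp_all add: lpart_def rpart_def)

lemma lpart_measurable [measurable]: 
  "(lpart :: ('p::finite, 'm::finite) state \<Rightarrow> real^'p) \<in> sum_borel \<rightarrow>\<^sub>M borel"
proof (rule measurableI)
  fix B :: "(real^'p) set" assume B: "B \<in> sets borel"
  have "Inl -` (lpart -` B :: ('p, 'm) state set) = B" "Inr -` (lpart -` B :: ('p, 'm) state set) = (if 0 \<in> B then UNIV else {})" by auto
  then show "(lpart -` B :: ('p, 'm) state set) \<inter> space sum_borel \<in> sets sum_borel" using B by (simp add: sets_sum_borel)
qed simp

lemma rpart_measurable [measurable]: 
  "(rpart :: ('p::finite, 'm::finite) state \<Rightarrow> real^'m) \<in> sum_borel \<rightarrow>\<^sub>M borel"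
proof (rule measurableI)
  fix B :: "(real^'m) set" assume B: "B \<in> sets borel"
  have "Inr -` (rpart -` B :: ('p, 'm) state set) = B" "Inl -` (rpart -` B :: ('p, 'm) state set) = (if 0 \<in> B then UNIV else {})" by auto
  then show "(rpart -` B :: ('p, 'm) state set) \<inter> space sum_borel \<in> sets sum_borel" using B by (simp add: sets_sum_borel)
qed simp

lemma isl_measurable [measurable]: "Measurable.pred sum_borel isl"
proof -
  have "Inl -` {x::'a + 'b. isl x} = UNIV" "Inr -` {x::'a + 'b. isl x} = {}" by auto
  then show ?thesis by (simp add: pred_def sets_sum_borel)
qed

lemma measurable_case_state:
  assumes [measurable]: "y \<in> N \<rightarrow>\<^sub>M sum_borel" 
    and f: "(\<lambda>x. f x (lpart (y x))) \<in> N \<rightarrow>\<^sub>M M" and g: "(\<lambda>x. g x (rpart (y x))) \<in> N \<rightarrow>\<^sub>M M"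
  shows "(\<lambda>x. case y x of Inl a \<Rightarrow> f x a | Inr b \<Rightarrow> g x b) \<in> N \<rightarrow>\<^sub>M M"
proof -
  have eq: "(\<lambda>x. case y x of Inl a \<Rightarrow> f x a | Inr b \<Rightarrow> g x b) = 
      (\<lambda>x. if isl (y x) then f x (lpart (y x)) else g x (rpart (y x)))"
    by (auto simp: fun_eq_iff split: sum.splits)
  show ?thesis unfolding eq by (intro measurable_If f g) measurable
qed

text \<open>
  A map into the sum is measurable if its side and its two components are, the component of the
  absent side being set to \<open>0\<close>.
\<close>
lemma measurable_into_sum_borel:
  assumes [measurable]: "Measurable.pred N (\<lambda>x. isl (f x))" "(\<lambda>x. lpart (f x)) \<in> borel_measurable N"
    "(\<lambda>x. rpart (f x)) \<in> borel_measurable N"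
  shows "f \<in> N \<rightarrow>\<^sub>M sum_borel"
proof -
  have "f = (\<lambda>x. if isl (f x) then Inl (lpart (f x)) else Inr (rpart (f x)))"
  proof
    show "f x = (if isl (f x) then Inl (lpart (f x)) else Inr (rpart (f x)))" for x
      by (cases "f x") auto
  qed
  also have "\<dots> \<in> N \<rightarrow>\<^sub>M sum_borel" by measurable
  finally show ?thesis .
qed

lemma normalise_measurable [measurable (raw)]:
  "f \<in> borel_measurable M \<Longrightarrow> (\<lambda>x. normalise (f x)) \<in> borel_measurable M"
  unfolding normalise_def
  by (intro borel_measurable_scaleR borel_measurable_inverse borel_measurable_inner borel_measurable_const)

lemma vector_mexp_continuous:
  "continuous_on S (\<lambda>x::(real^'n) \<times> real. fst x v* mexp (snd x *\<^sub>R A))"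
  by (rule bounded_bilinear.continuous_on[OF bounded_bilinear_vector_matrix_mult])
    (auto intro!: continuous_intros continuous_on_compose2[OF mexp_continuous[of UNIV]])

lemma vector_mexp_measurable [measurable (raw)]:
  fixes A :: "real^'n^'n"
  assumes "f \<in> borel_measurable M" "g \<in> borel_measurable M"
  shows "(\<lambda>x. f x v* mexp (g x *\<^sub>R A)) \<in> borel_measurable M"
  by (rule borel_measurable_continuous_Pair[OF assms vector_mexp_continuous])

lemma vector_matrix_measurable [measurable (raw)]:
  fixes A :: "real^'n^'m"
  assumes "f \<in> borel_measurable M"
  shows "(\<lambda>x. f x v* A) \<in> borel_measurable M"
  by (rule borel_measurable_continuous_on[OF _ assms], rule linear_continuous_on,
      rule bounded_bilinear.bounded_linear_left[OF bounded_bilinear_vector_matrix_mult])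

lemma pairing_measurable [measurable (raw)]:
  assumes [measurable]: "u \<in> borel_measurable N" "v \<in> borel_measurable N" "y \<in> N \<rightarrow>\<^sub>M sum_borel"
  shows "(\<lambda>x. pairing (u x) (v x) (y x)) \<in> borel_measurable N"
  unfolding pairing_def by (rule measurable_case_state) measurable

lemma mass_measurable [measurable (raw)]:
  assumes "y \<in> N \<rightarrow>\<^sub>M sum_borel"
  shows "(\<lambda>x. mass (y x)) \<in> borel_measurable N"
  unfolding mass_eq_pairing by (rule pairing_measurable[OF borel_measurable_const borel_measurable_const assms])

lemma map_sum_normalise_measurable [measurable (raw)]:
  assumes [measurable]: "y \<in> N \<rightarrow>\<^sub>M sum_borel"
  shows "(\<lambda>x. map_sum normalise normalise (y x) :: ('p::finite, 'm::finite) state) \<in> N \<rightarrow>\<^sub>M sum_borel"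
proof -
  have eq: "map_sum normalise normalise z = (case z of Inl a \<Rightarrow> Inl (normalise a) | Inr b \<Rightarrow> Inr (normalise b))"
    for z :: "('p, 'm) state" by (cases z) auto
  show ?thesis unfolding eq by (rule measurable_case_state) measurable
qed

lemma flow_measurable [measurable (raw)]:
  assumes [measurable]: "y \<in> N \<rightarrow>\<^sub>M sum_borel" "s \<in> borel_measurable N"
  shows "(\<lambda>x. flow bp bm Cp Cm (y x) (s x)) \<in> N \<rightarrow>\<^sub>M sum_borel"
  unfolding flow_def by (rule measurable_case_state) measurable

context rap_fluid
begin

lemma jump_vector_measurable [measurable (raw)]:
  assumes [measurable]: "y \<in> N \<rightarrow>\<^sub>M sum_borel"
  shows "(\<lambda>x. jump_vector (y x) k) \<in> N \<rightarrow>\<^sub>M sum_borel"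
proof -
  obtain k1 k2 where k: "k = (k1, k2)" by (cases k)
  have eq: "(\<lambda>x. jump_vector (y x) k) = (\<lambda>x. case y x of
        Inl a \<Rightarrow> jump_vector (Inl a) k | Inr b \<Rightarrow> jump_vector (Inr b) k)"
    by (simp add: fun_eq_iff split: sum.split)
  have l: "(\<lambda>x. jump_vector (Inl (lpart (y x))) k) \<in> N \<rightarrow>\<^sub>M sum_borel"
    unfolding k by (cases k1; cases k2; simp only: jump_vector_def prod.case sum.case; measurable)
  have r: "(\<lambda>x. jump_vector (Inr (rpart (y x))) k) \<in> N \<rightarrow>\<^sub>M sum_borel"
    unfolding k by (cases k1; cases k2; simp only: jump_vector_def prod.case sum.case; measurable)
  show ?thesis
    unfolding eq by (rule measurable_case_state[where f="\<lambda>x a. jump_vector (Inl a) k" and g="\<lambda>x b. jump_vector (Inr b) k", OF assms l r])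
qed

lemma jump_target_measurable [measurable (raw)]:
  assumes [measurable]: "y \<in> N \<rightarrow>\<^sub>M sum_borel"
  shows "(\<lambda>x. jump_target (y x) k) \<in> N \<rightarrow>\<^sub>M sum_borel"
  unfolding jump_target_def by measurable

section \<open>Survival without jumps\<close>

text \<open>
  The sum of the entries of the unnormalised flow; \<open>no_jump_probability\<close> identifies
  it with the probability of no jump before \<open>s\<close>.
\<close>
definition survival :: "('p, 'm) state \<Rightarrow> real \<Rightarrow> real" where
  "survival y s = pairing (mexp (s *\<^sub>R Gp) *v 1) (mexp (s *\<^sub>R Gm) *v 1) y"

lemma survival_measurable [measurable (raw)]:
  assumes [measurable]: "y \<in> N \<rightarrow>\<^sub>M sum_borel" "s \<in> borel_measurable N"
  shows "(\<lambda>x. survival (y x) (s x)) \<in> borel_measurable N"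
  unfolding survival_def by measurable

lemma flow_states: "y \<in> states \<Longrightarrow> 0 \<le> s \<Longrightarrow> flw y s \<in> states"
  by (erule states_cases) (simp_all only: flow_def sum.case Inl_states Inr_states flow_p flow_m)

lemma isl_flow [simp]: "isl (flw y s) = isl y"
  by (cases y) (auto simp: flow_def)

lemma survival_pos:
  assumes "y \<in> states" "0 \<le> s"
  shows "0 < survival y s"
  using assms(1)
proof (cases rule: states_cases)
  case (1 i a)
  show ?thesis
    unfolding 1 survival_def pairing_simps
    by (rule flow_mass_positive[OF flow_p[OF 1(3)] p.sum_one]) (use assms(2) p.sum_one 1 in auto)
next
  case (2 j b)
  show ?thesis
    unfolding 2 survival_def pairing_simps
    by (rule flow_mass_positive[OF flow_m[OF 2(3)] m.sum_one]) (use assms(2) m.sum_one 2 in auto)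
qed

text \<open>
  The linearisation: probability of no jump times a linear functional of the normalised flow is
  a linear functional of the initial state.
\<close>
lemma survival_flow:
  assumes "y \<in> states" "0 \<le> s"
  shows "survival y s * pairing u v (flw y s) = pairing (mexp (s *\<^sub>R Gp) *v u) (mexp (s *\<^sub>R Gm) *v v) y"
proof (cases y)
  case (Inl a)
  have "(a v* mexp (s *\<^sub>R Gp)) \<bullet> 1 \<noteq> 0"
    using survival_pos[OF assms] by (simp add: Inl survival_def vector_matrix_inner)
  from normalise_inner[OF this, of u] show ?thesis
    by (simp add: Inl survival_def flow_def vector_matrix_inner)
next
  case (Inr b)
  have "(b v* mexp (s *\<^sub>R Gm)) \<bullet> 1 \<noteq> 0"
    using survival_pos[OF assms] by (simp add: Inr survival_def vector_matrix_inner)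
  from normalise_inner[OF this, of v] show ?thesis
    by (simp add: Inr survival_def flow_def vector_matrix_inner)
qed

lemma sum_jump_vector_pairing:
  "(\<Sum>k\<in>UNIV. pairing u v (jump_vector y k)) = pairing ((Cp - Gp) *v u + Dpm *v v) ((Cm - Gm) *v v + Dmp *v u) y"
  by (cases y) (simp_all add: sum_jump_vector)

lemma unit_gain:
  "(Cp - Gp) *v 1 + Dpm *v 1 = - (Gp *v 1)" "(Cm - Gm) *v 1 + Dmp *v 1 = - (Gm *v 1)"
  using row_sums_p row_sums_m by (simp_all add: mult_linear_simps algebra_simps add_eq_0_iff)

lemma total_rate: "rate y UNIV = - pairing (Gp *v 1) (Gm *v 1) y"
proof -
  have "rate y UNIV = (\<Sum>k\<in>UNIV. pairing 1 1 (jump_vector y k))"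
    by (simp add: rate_eq mass_eq_pairing)
  also have "\<dots> = - pairing (Gp *v 1) (Gm *v 1) y"
    by (cases y) (simp_all add: sum_jump_vector unit_gain)
  finally show ?thesis .
qed

text \<open>
  By the row sum conditions the total intensity along the flow is minus the logarithmic
  derivative of the survival function.
\<close>
lemma no_jump_probability:
  assumes "y \<in> states" "0 \<le> s"
  shows "exp (- (LBINT r:{0..s}. rate (flw y r) UNIV)) = survival y s"
proof -
  have eq: "rate (flw y r) UNIV = - (pairing (mexp (r *\<^sub>R Gp) *v (Gp *v 1)) (mexp (r *\<^sub>R Gm) *v (Gm *v 1)) y / survival y r)"
    if "r \<in> {0..s}" for r
    using survival_flow[OF assms(1), of r "Gp *v 1" "Gm *v 1"] survival_pos[OF assms(1), of r] that
    by (simp add: total_rate field_simps)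
  have int: "(LBINT r:{0..s}. rate (flw y r) UNIV) = 
      (LBINT r:{0..s}. - (pairing (mexp (r *\<^sub>R Gp) *v (Gp *v 1)) (mexp (r *\<^sub>R Gm) *v (Gm *v 1)) y / survival y r))"
    by (rule set_lebesgue_integral_cong) (use eq in auto)
  show ?thesis
    using assms(1)
  proof (cases rule: states_cases)
    case (1 i a)
    have pos: "0 < a \<bullet> (mexp (r *\<^sub>R Gp) *v 1)" if "0 \<le> r" for r
      using survival_pos[OF assms(1) that] by (simp add: 1 survival_def)
    show ?thesis
      unfolding int using exp_neg_integral_log_derivative[OF pos _ assms(2)] p.sum_one[OF 1(3)] by (simp add: 1 survival_def)
  next
    case (2 j b)
    have pos: "0 < b \<bullet> (mexp (r *\<^sub>R Gm) *v 1)" if "0 \<le> r" for r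
      using survival_pos[OF assms(1) that] by (simp add: 2 survival_def)
    show ?thesis
      unfolding int using exp_neg_integral_log_derivative[OF pos _ assms(2)] m.sum_one[OF 2(3)] by (simp add: 2 survival_def)
  qed
qed

lemma Gp_cone: "t \<ge> 0 \<Longrightarrow> cone_map Up Up (mexp (t *\<^sub>R Gp))"
  unfolding cone_map_def
proof (intro ballI nonneg_onI)
  fix h a assume h: "h \<in> nonneg_on Up" and a: "a \<in> Up" and t: "t \<ge> 0"
  have "0 \<le> survival (Inl a) t * pairing h 0 (flw (Inl a) t)"
    using survival_pos[of "Inl a" t] a t nonneg_onD[OF h flow_p[OF a t]] by (simp add: flow_def)
  then show "0 \<le> a \<bullet> (mexp (t *\<^sub>R Gp) *v h)"
    using survival_flow[of "Inl a" t h 0] a t by simp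
qed

lemma Gm_cone: "t \<ge> 0 \<Longrightarrow> cone_map Um Um (mexp (t *\<^sub>R Gm))"
  unfolding cone_map_def
proof (intro ballI nonneg_onI)
  fix h a assume h: "h \<in> nonneg_on Um" and a: "a \<in> Um" and t: "t \<ge> 0"
  have "0 \<le> survival (Inr a) t * pairing 0 h (flw (Inr a) t)"
    using survival_pos[of "Inr a" t] a t nonneg_onD[OF h flow_m[OF a t]] by (simp add: flow_def)
  then show "0 \<le> a \<bullet> (mexp (t *\<^sub>R Gm) *v h)"
    using survival_flow[of "Inr a" t 0 h] a t by simp
qed

lemma sum_jump_vector_nonneg:
  assumes "y \<in> states" "u \<in> nonneg_on Up" "v \<in> nonneg_on Um"
  shows "0 \<le> pairing ((Cp - Gp) *v u + Dpm *v v) ((Cm - Gm) *v v + Dmp *v u) y"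
  unfolding sum_jump_vector_pairing[symmetric] by (intro sum_nonneg jump_vector_props(3) assms)

lemma jump_cones:
  "cone_map Up Up (Cp - Gp)" "cone_map Up Um Dpm" "cone_map Um Um (Cm - Gm)" "cone_map Um Up Dmp"
proof -
  show "cone_map Up Up (Cp - Gp)"
    unfolding cone_map_def using sum_jump_vector_nonneg[of "Inl _" _ 0] 
    by (intro ballI nonneg_onI) (simp add: mult_linear_simps)
  show "cone_map Up Um Dpm"
    unfolding cone_map_def using sum_jump_vector_nonneg[of "Inl _" 0] 
    by (intro ballI nonneg_onI) (simp add: mult_linear_simps)
  show "cone_map Um Um (Cm - Gm)"
    unfolding cone_map_def using sum_jump_vector_nonneg[of "Inr _" 0] 
    by (intro ballI nonneg_onI) (simp add: mult_linear_simps)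
  show "cone_map Um Up Dmp"
    unfolding cone_map_def using sum_jump_vector_nonneg[of "Inr _" _ 0] 
    by (intro ballI nonneg_onI) (simp add: mult_linear_simps)
qed

end

section \<open>The jump chain\<close>

context rap_fluid
begin

abbreviation "Y \<equiv> post_jump A T"
abbreviation "H \<equiv> jump_history F A T"

lemma T_nonneg: "\<omega> \<in> space F \<Longrightarrow> 0 \<le> T n \<omega>"
proof (induction n)
  case (Suc n)
  then show ?case
    using T_less[of \<omega> n] T_infinite[of \<omega> n] by (cases "T n \<omega> < \<infinity>") auto
qed (simp add: T_0)

lemma T_le_Suc: "\<omega> \<in> space F \<Longrightarrow> T n \<omega> \<le> T (Suc n) \<omega>"
  using T_less[of \<omega> n] T_infinite[of \<omega> n] by (cases "T n \<omega> < \<infinity>") auto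

lemma T_mono: "\<omega> \<in> space F \<Longrightarrow> m \<le> n \<Longrightarrow> T m \<omega> \<le> T n \<omega>"
  using lift_Suc_mono_le[of "\<lambda>n. T n \<omega>"] T_le_Suc by blast

lemma T_real: "\<omega> \<in> space F \<Longrightarrow> T n \<omega> < \<infinity> \<Longrightarrow> T n \<omega> = ereal (real_of_ereal (T n \<omega>))"
  using T_nonneg[of \<omega> n] by (cases "T n \<omega>") auto

lemma jump_interval:
  assumes "\<omega> \<in> space F" "0 \<le> t"
  obtains n where "T n \<omega> \<le> ereal t" "ereal t < T (Suc n) \<omega>"
proof -
  have "\<exists>n. ereal t < T n \<omega>"
    using order_tendstoD(1)[OF T_tendsto[OF assms(1)], of "ereal t"] 
    by (auto simp: eventually_sequentially)
  then obtain m where m: "ereal t < T m \<omega>" "\<And>k. k < m \<Longrightarrow> \<not> ereal t < T k \<omega>"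
    using exists_least_iff[of "\<lambda>n. ereal t < T n \<omega>"] by blast
  have "m \<noteq> 0" using m(1) T_0[OF assms(1)] assms(2) by (metis ereal_less_eq(5) leD)
  then obtain n where "m = Suc n" by (cases m) auto
  then show thesis using that[of n] m(1) m(2)[of n] by auto
qed

lemma Y_states: "\<omega> \<in> space F \<Longrightarrow> Y n \<omega> \<in> states"
  unfolding post_jump_def using T_nonneg[of \<omega> n] by (intro A_in_states) (auto simp: real_of_ereal_pos)

lemma A_between:
  assumes "\<omega> \<in> space F" "T n \<omega> \<le> ereal t" "ereal t < T (Suc n) \<omega>"
  shows "A t \<omega> = flw (Y n \<omega>) (t - real_of_ereal (T n \<omega>))" "real_of_ereal (T n \<omega>) \<le> t"
proof -
  show "A t \<omega> = flw (Y n \<omega>) (t - real_of_ereal (T n \<omega>))" by (rule A_flow[OF assms])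
  show "real_of_ereal (T n \<omega>) \<le> t"
    using assms(2) T_nonneg[OF assms(1), of n] by (cases "T n \<omega>") auto
qed

lemma flow_parts_continuous:
  assumes "y \<in> states"
  shows "continuous_on {0..} (\<lambda>s. lpart (flw y s))" "continuous_on {0..} (\<lambda>s. rpart (flw y s))"
proof -
  have c: "continuous_on {0..} (\<lambda>s. a v* mexp (s *\<^sub>R M))" for a :: "real^'n" and M
    by (intro bounded_bilinear.continuous_on[OF bounded_bilinear_vector_matrix_mult] continuous_intros mexp_continuous)
  have "continuous_on {0..} (\<lambda>s. lpart (flw y s)) \<and> continuous_on {0..} (\<lambda>s. rpart (flw y s))"
  proof (cases y)
    case (Inl a)
    have "(a v* mexp (s *\<^sub>R Gp)) \<bullet> 1 \<noteq> 0" if "0 \<le> s" for s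
      using survival_pos[OF assms that] by (simp add: Inl survival_def vector_matrix_inner)
    then show ?thesis by (simp add: Inl flow_def normalise_def) (intro continuous_intros c; auto)
  next
    case (Inr a)
    have "(a v* mexp (s *\<^sub>R Gm)) \<bullet> 1 \<noteq> 0" if "0 \<le> s" for s
      using survival_pos[OF assms that] by (simp add: Inr survival_def vector_matrix_inner)
    then show ?thesis by (simp add: Inr flow_def normalise_def) (intro continuous_intros c; auto)
  qed
  then show "continuous_on {0..} (\<lambda>s. lpart (flw y s))" "continuous_on {0..} (\<lambda>s. rpart (flw y s))" by auto
qed

text \<open>
  A point of the grid of mesh \<open>1 / Suc k\<close> strictly to the right of
  \<open>t\<close>, at distance at most the mesh.
\<close>
definition grid :: "nat \<Rightarrow> real \<Rightarrow> real" where
  "grid k t = (real (nat \<lfloor>t * real (Suc k)\<rfloor>) + 1) / real (Suc k)"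

lemma grid_bounds:
  assumes "0 \<le> t"
  shows "t < grid k t" "grid k t \<le> t + 1 / real (Suc k)"
proof -
  have f: "real (nat \<lfloor>t * real (Suc k)\<rfloor>) = of_int \<lfloor>t * real (Suc k)\<rfloor>" using assms by simp
  have "t * real (Suc k) < real (nat \<lfloor>t * real (Suc k)\<rfloor>) + 1" unfolding f by linarith
  then show "t < grid k t" unfolding grid_def by (subst pos_less_divide_eq) auto
  have "real (nat \<lfloor>t * real (Suc k)\<rfloor>) + 1 \<le> t * real (Suc k) + 1" unfolding f by linarith
  then have "grid k t \<le> (t * real (Suc k) + 1) / real (Suc k)" unfolding grid_def by (intro divide_right_mono) auto
  then show "grid k t \<le> t + 1 / real (Suc k)" by (simp add: add_divide_distrib)
qed

lemma grid_tendsto: "0 \<le> t \<Longrightarrow> (\<lambda>k. grid k t) \<longlonglongrightarrow> t"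
proof (rule tendsto_sandwich[OF _ _ tendsto_const])
  show "(\<lambda>k. t + 1 / real (Suc k)) \<longlonglongrightarrow> t"
    using tendsto_add[OF tendsto_const[of t] LIMSEQ_inverse_real_of_nat] by (simp add: inverse_eq_divide)
qed (use grid_bounds in \<open>auto intro!: always_eventually less_imp_le\<close>)

text \<open>
  The topology of the sum type is replaced by the convergence of both components together with
  the eventual equality of the sides.
\<close>
lemma right_continuity:
  assumes \<omega>: "\<omega> \<in> space F" and t: "0 \<le> t"
  shows "(\<lambda>k. lpart (A (grid k t) \<omega>)) \<longlonglongrightarrow> lpart (A t \<omega>)" "(\<lambda>k. rpart (A (grid k t) \<omega>)) \<longlonglongrightarrow> rpart (A t \<omega>)"
    "\<forall>\<^sub>F k in sequentially. isl (A (grid k t) \<omega>) = isl (A t \<omega>)"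
proof -
  obtain n where n: "T n \<omega> \<le> ereal t" "ereal t < T (Suc n) \<omega>" using jump_interval[OF assms] by blast
  define s where "s = real_of_ereal (T n \<omega>)"
  have s: "s \<le> t" "A t \<omega> = flw (Y n \<omega>) (t - s)" using A_between[OF \<omega> n] by (auto simp: s_def)
  have "(\<lambda>k. ereal (grid k t)) \<longlonglongrightarrow> ereal t" using grid_tendsto[OF t] by simp
  from order_tendstoD(2)[OF this n(2)]
  have ev: "\<forall>\<^sub>F k in sequentially. A (grid k t) \<omega> = flw (Y n \<omega>) (grid k t - s)"
  proof eventually_elim
    case (elim k)
    have "T n \<omega> \<le> ereal (grid k t)" using n(1) grid_bounds(1)[OF t, of k] by (metis ereal_less_eq(3) less_imp_le order_trans)
    then show ?case using A_between(1)[OF \<omega> _ elim] by (simp add: s_def)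
  qed
  have lim: "(\<lambda>k. grid k t - s) \<longlonglongrightarrow> t - s" by (intro tendsto_intros grid_tendsto t)
  have ge: "\<forall>\<^sub>F k in sequentially. grid k t - s \<in> {0..}"
    using s(1) grid_bounds(1)[OF t] by (intro always_eventually) (auto intro: less_imp_le order_trans)
  have mem: "t - s \<in> {0..}" using s(1) by simp
  note c = flow_parts_continuous[OF Y_states[OF \<omega>, of n]]
  show "(\<lambda>k. lpart (A (grid k t) \<omega>)) \<longlonglongrightarrow> lpart (A t \<omega>)" unfolding s(2)
    by (rule Lim_transform_eventually[OF continuous_on_tendsto_compose[OF c(1) lim mem ge]])
      (use ev in \<open>auto elim: eventually_mono\<close>)
  show "(\<lambda>k. rpart (A (grid k t) \<omega>)) \<longlonglongrightarrow> rpart (A t \<omega>)" unfolding s(2)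
    by (rule Lim_transform_eventually[OF continuous_on_tendsto_compose[OF c(2) lim mem ge]])
      (use ev in \<open>auto elim: eventually_mono\<close>)
  show "\<forall>\<^sub>F k in sequentially. isl (A (grid k t) \<omega>) = isl (A t \<omega>)" unfolding s(2)
    using ev by eventually_elim simp
qed

lemma A_grid_measurable [measurable]:
  assumes [measurable]: "\<tau> \<in> borel_measurable F"
  shows "(\<lambda>\<omega>. A (grid k (\<tau> \<omega>)) \<omega>) \<in> F \<rightarrow>\<^sub>M sum_borel"
  unfolding grid_def
proof (rule measurable_compose_countable[where f="\<lambda>i \<omega>. A ((real i + 1) / real (Suc k)) \<omega>"])
  show "A ((real i + 1) / real (Suc k)) \<in> F \<rightarrow>\<^sub>M sum_borel" for i :: nat
    by (rule measurable_A) simp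
  show "(\<lambda>\<omega>. nat \<lfloor>\<tau> \<omega> * real (Suc k)\<rfloor>) \<in> F \<rightarrow>\<^sub>M count_space UNIV" by measurable
qed

text \<open>
  The assumptions give measurability of \<open>A t\<close> for fixed \<open>t\<close> only. At a
  random time it follows by approximation from the right with times that take countably many
  values.
\<close>
lemma stopped_measurable:
  assumes \<tau>[measurable]: "\<tau> \<in> borel_measurable F" and nn: "\<And>\<omega>. \<omega> \<in> space F \<Longrightarrow> 0 \<le> \<tau> \<omega>"
  shows "(\<lambda>\<omega>. A (\<tau> \<omega>) \<omega>) \<in> F \<rightarrow>\<^sub>M sum_borel"
proof (rule measurable_into_sum_borel)
  note rc = right_continuity[OF _ nn]
  show "(\<lambda>\<omega>. lpart (A (\<tau> \<omega>) \<omega>)) \<in> borel_measurable F"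
    by (rule borel_measurable_LIMSEQ_metric[OF _ rc(1)]) measurable
  show "(\<lambda>\<omega>. rpart (A (\<tau> \<omega>) \<omega>)) \<in> borel_measurable F"
    by (rule borel_measurable_LIMSEQ_metric[OF _ rc(2)]) measurable
  have "(\<lambda>\<omega>. if isl (A (\<tau> \<omega>) \<omega>) then 1 else 0 :: real) \<in> borel_measurable F"
  proof (rule borel_measurable_LIMSEQ_metric)
    show "(\<lambda>\<omega>. if isl (A (grid k (\<tau> \<omega>)) \<omega>) then 1 else 0 :: real) \<in> borel_measurable F" for k
      by measurable
    show "(\<lambda>k. if isl (A (grid k (\<tau> \<omega>)) \<omega>) then 1 else 0 :: real) \<longlonglongrightarrow> (if isl (A (\<tau> \<omega>) \<omega>) then 1 else 0)"
      if "\<omega> \<in> space F" for \<omega>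
      by (rule tendsto_eventually) (use rc(3)[OF that that] in \<open>auto elim: eventually_mono\<close>)
  qed
  then have "Measurable.pred F (\<lambda>\<omega>. (if isl (A (\<tau> \<omega>) \<omega>) then 1 else 0 :: real) = 1)" by measurable
  then show "Measurable.pred F (\<lambda>\<omega>. isl (A (\<tau> \<omega>) \<omega>))"
    by (rule measurable_cong[THEN iffD1, rotated]) auto
qed

lemma T_measurable_F [measurable]: "T n \<in> borel_measurable F"
  by (rule measurable_T)

lemma Y_measurable_F [measurable]: "Y n \<in> F \<rightarrow>\<^sub>M sum_borel"
  unfolding post_jump_def
  by (rule stopped_measurable) (use T_nonneg in \<open>auto simp: real_of_ereal_pos\<close>)

lemma space_H [simp]: "space (H n) = space F"
  by (simp add: jump_history_def)

lemma history_measurable: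
  assumes "l \<le> n"
  shows "T l \<in> borel_measurable (H n)" "Y l \<in> H n \<rightarrow>\<^sub>M sum_borel"
proof -
  have h: "(\<lambda>\<omega>. \<lambda>l\<in>{..n}. (T l \<omega>, Y l \<omega>)) \<in> H n \<rightarrow>\<^sub>M (\<Pi>\<^sub>M l\<in>{..n}. borel \<Otimes>\<^sub>M sum_borel)"
    unfolding jump_history_def by (rule measurable_vimage_algebra1) (auto simp: space_PiM space_pair_measure)
  have pair: "(\<lambda>\<omega>. (T l \<omega>, Y l \<omega>)) \<in> H n \<rightarrow>\<^sub>M borel \<Otimes>\<^sub>M sum_borel"
    using measurable_compose[OF h measurable_component_singleton[of l "{..n}"]] assms by simp
  show "T l \<in> borel_measurable (H n)" "Y l \<in> H n \<rightarrow>\<^sub>M sum_borel"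
    using measurable_compose[OF pair measurable_fst] measurable_compose[OF pair measurable_snd] by simp_all
qed

lemma T_measurable_H [measurable]: "T n \<in> borel_measurable (H n)"
  and Y_measurable_H [measurable]: "Y n \<in> H n \<rightarrow>\<^sub>M sum_borel"
  by (rule history_measurable; simp)+

lemma id_history: "(\<lambda>\<omega>. \<omega>) \<in> F \<rightarrow>\<^sub>M H n"
  unfolding jump_history_def by (rule measurable_vimage_algebra2) (auto intro!: measurable_restrict)

text \<open>
  Conditional expectations are defined by reference to a sub-sigma-algebra; this makes the
  history one.
\<close>
lemma H_subset: "sets (H n) \<subseteq> sets F"
  using measurable_sets[OF id_history[of n]] sets.sets_into_space[of _ "H n"] by (fastforce simp: Int_absorb2)

end

section \<open>The law of the jump chain\<close>

lemma sets_history_jump: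
  "sets (N \<Otimes>\<^sub>M (borel \<Otimes>\<^sub>M (sum_borel :: ('p::finite, 'm::finite) state measure))) =
    sigma_sets (space N \<times> UNIV) {G \<times> ({..t::real} \<times> B) | G t B. G \<in> sets N \<and> B \<in> sets sum_borel}"
proof -
  let ?S = "sum_borel :: ('p, 'm) state measure"
  let ?E = "{a \<times> B | a B. a \<in> range (\<lambda>t::real. {..t}) \<and> B \<in> sets ?S}"
  have ball: "(\<Union>n::nat. {..real n}) = (UNIV :: real set)"
    using real_arch_simple by (auto simp: set_eq_iff)
  have sb: "sets (borel :: real measure) = sigma_sets (space borel) (range (\<lambda>t. {..t}))"
    unfolding borel_eq_atMost by (simp add: space_measure_of_conv)
  have ss: "sets ?S = sigma_sets (space ?S) (sets ?S)" by (rule sets.sigma_sets_eq[symmetric])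
  have 1: "sets (borel \<Otimes>\<^sub>M ?S) = sigma_sets UNIV ?E"
    using sets_pair_eq[OF _ sb _ _ _ _ ss, of "range (\<lambda>n::nat. {..real n})" "{UNIV}"] ball sets.top[of ?S]
    by (auto simp: sets_measure_of_conv)
  have "sets (N \<Otimes>\<^sub>M (borel \<Otimes>\<^sub>M ?S)) = sets (sigma (space N \<times> space (borel \<Otimes>\<^sub>M ?S)) {a \<times> b | a b. a \<in> sets N \<and> b \<in> ?E})"
  proof (rule sets_pair_eq[where Ca="{space N}" and Cb="range (\<lambda>n::nat. {..real n} \<times> UNIV)"])
    show "\<Union> (range (\<lambda>n::nat. {..real n} \<times> UNIV)) = space (borel \<Otimes>\<^sub>M ?S)"
      using ball by (auto simp: space_pair_measure set_eq_iff)
    show "range (\<lambda>n::nat. {..real n} \<times> UNIV) \<subseteq> ?E" using sets.top[of ?S] by auto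
  qed (auto simp: 1 space_pair_measure sets.sigma_sets_eq sets.sets_into_space[THEN subsetD])
  also have "\<dots> = sigma_sets (space N \<times> UNIV) {a \<times> b | a b. a \<in> sets N \<and> b \<in> ?E}"
    using sets.sets_into_space[of _ N] by (subst sets_measure_of) (fastforce simp: space_pair_measure)+
  also have "{a \<times> b | a b. a \<in> sets N \<and> b \<in> ?E} = {G \<times> ({..t::real} \<times> B) | G t B. G \<in> sets N \<and> B \<in> sets sum_borel}"
    by blast
  finally show ?thesis .
qed

context rap_fluid
begin

definition sojourn :: "nat \<Rightarrow> 'w \<Rightarrow> real" where
  "sojourn n \<omega> = real_of_ereal (T (Suc n) \<omega>) - real_of_ereal (T n \<omega>)"

lemma sojourn_measurable [measurable]: "sojourn n \<in> borel_measurable F"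
  unfolding sojourn_def by measurable

lemma T_Suc_finite: "\<omega> \<in> space F \<Longrightarrow> T (Suc n) \<omega> < \<infinity> \<Longrightarrow> T n \<omega> < \<infinity>"
  using T_infinite[of \<omega> n] by (cases "T n \<omega> = \<infinity>") auto

lemma sojourn_pos: 
  assumes "\<omega> \<in> space F" "T (Suc n) \<omega> < \<infinity>"
  shows "0 < sojourn n \<omega>"
proof -
  have "ereal (real_of_ereal (T n \<omega>)) < ereal (real_of_ereal (T (Suc n) \<omega>))"
    using T_less[OF assms(1) T_Suc_finite[OF assms]] T_real[OF assms] T_real[OF assms(1) T_Suc_finite[OF assms]] by simp
  then show ?thesis by (simp add: sojourn_def)
qed

text \<open>
  Jump times are extended reals; this translates between the form of the event in the jump law
  and real sojourn times.
\<close>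
lemma sojourn_le_iff:
  assumes "\<omega> \<in> space F" "T n \<omega> < \<infinity>"
  shows "T (Suc n) \<omega> \<le> T n \<omega> + ereal t \<longleftrightarrow> T (Suc n) \<omega> < \<infinity> \<and> sojourn n \<omega> \<le> t"
proof (cases "T (Suc n) \<omega> < \<infinity>")
  case True
  then obtain a b where "T n \<omega> = ereal a" "T (Suc n) \<omega> = ereal b" using T_real assms by blast
  then show ?thesis by (auto simp: sojourn_def)
next
  case False
  then show ?thesis using T_real[OF assms] by (metis PInfty_neq_ereal(1) ereal_infty_less_eq(1) less_ereal.simps(4) linorder_not_less plus_ereal.simps(1))
qed

definition jump_event :: "nat \<Rightarrow> real \<Rightarrow> ('p, 'm) state set \<Rightarrow> 'w set" where
  "jump_event n t B = {\<omega> \<in> space F. T n \<omega> < \<infinity> \<and> T (Suc n) \<omega> \<le> T n \<omega> + ereal t \<and> Y (Suc n) \<omega> \<in> B}"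

lemma jump_event_sets:
  assumes [measurable]: "B \<in> sets sum_borel"
  shows "jump_event n t B \<in> sets F"
  unfolding jump_event_def by measurable

text \<open>
  The density, in the time \<open>s\<close> since the last jump, of a jump at \<open>s\<close>
  along the pair of phases \<open>k\<close>.
\<close>
definition jump_density :: "('p, 'm) state \<Rightarrow> real \<Rightarrow> ('i + 'j) \<times> ('i + 'j) \<Rightarrow> ennreal" where
  "jump_density y s k = indicator {0..} s * ennreal (survival y s * mass (jump_vector (flw y s) k))"

lemma jump_density_measurable [measurable (raw)]:
  assumes [measurable]: "y \<in> N \<rightarrow>\<^sub>M sum_borel" "s \<in> borel_measurable N"
  shows "(\<lambda>x. jump_density (y x) (s x) k) \<in> borel_measurable N"
  unfolding jump_density_def by measurable

lemma jump_integral: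
  assumes y: "y \<in> states" and B[measurable]: "B \<in> sets sum_borel"
  shows "ennreal (LBINT s:{0..t}. exp (- (LBINT r:{0..s}. rate (flw y r) UNIV)) * rate (flw y s) B) =
      (\<integral>\<^sup>+s. (\<Sum>k\<in>UNIV. jump_density y s k * (indicator {..t} s * indicator B (jump_target (flw y s) k))) \<partial>lborel)"
    and "0 \<le> (LBINT s:{0..t}. exp (- (LBINT r:{0..s}. rate (flw y r) UNIV)) * rate (flw y s) B)"
proof -
  define g where "g s = survival y s * rate (flw y s) B" for s
  have nn: "0 \<le> g s" if "0 \<le> s" for s
    unfolding g_def rate_eq using survival_pos[OF y that] 
    by (intro mult_nonneg_nonneg sum_nonneg jump_vector_props(2) flow_states y that) auto
  have [measurable]: "g \<in> borel_measurable borel" unfolding g_def rate_eq by measurable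
  have c: "continuous_on {0..t} (\<lambda>s. - pairing (mexp (s *\<^sub>R Gp) *v (Gp *v 1)) (mexp (s *\<^sub>R Gm) *v (Gm *v 1)) y)"
    by (cases y) (auto intro!: continuous_intros mexp_vector_continuous)
  have int: "set_integrable lborel {0..t} g"
  proof (rule set_integrable_bound)
    show "set_integrable lborel {0..t} (\<lambda>s. - pairing (mexp (s *\<^sub>R Gp) *v (Gp *v 1)) (mexp (s *\<^sub>R Gm) *v (Gm *v 1)) y)"
      unfolding set_integrable_def by (rule borel_integrable_compact[OF compact_Icc c])
    have "norm (g s) \<le> norm (- pairing (mexp (s *\<^sub>R Gp) *v (Gp *v 1)) (mexp (s *\<^sub>R Gm) *v (Gm *v 1)) y)" if "0 \<le> s" for s
    proof -
      have "rate (flw y s) B \<le> rate (flw y s) UNIV"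
        unfolding rate_eq using jump_vector_props(2)[OF flow_states[OF y that]]
        by (intro sum_mono mult_left_mono) (auto simp: indicator_def)
      then have "g s \<le> survival y s * rate (flw y s) UNIV"
        unfolding g_def using survival_pos[OF y that] by (intro mult_left_mono) auto
      also have "\<dots> = - pairing (mexp (s *\<^sub>R Gp) *v (Gp *v 1)) (mexp (s *\<^sub>R Gm) *v (Gm *v 1)) y"
        using survival_flow[OF y that, of "Gp *v 1" "Gm *v 1"] by (simp add: total_rate)
      finally show ?thesis using nn[OF that] by simp
    qed
    then show "AE s in lborel. s \<in> {0..t} \<longrightarrow> norm (g s) \<le> norm (- pairing (mexp (s *\<^sub>R Gp) *v (Gp *v 1)) (mexp (s *\<^sub>R Gm) *v (Gm *v 1)) y)"
      by (intro AE_I2) auto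
  qed (simp add: set_borel_measurable_def)
  have eq: "(LBINT s:{0..t}. exp (- (LBINT r:{0..s}. rate (flw y r) UNIV)) * rate (flw y s) B) = (LBINT s:{0..t}. g s)"
    by (rule set_lebesgue_integral_cong) (auto simp: g_def no_jump_probability y)
  have "(LBINT s:{0..t}. g s) = (\<integral>s. indicator {0..t} s * g s \<partial>lborel)" by (simp add: set_lebesgue_integral_def)
  also have "ennreal \<dots> = (\<integral>\<^sup>+s. ennreal (indicator {0..t} s * g s) \<partial>lborel)"
    using int nn by (intro nn_integral_eq_integral[symmetric]) (auto simp: set_integrable_def indicator_def)
  also have "\<dots> = (\<integral>\<^sup>+s. (\<Sum>k\<in>UNIV. jump_density y s k * (indicator {..t} s * indicator B (jump_target (flw y s) k))) \<partial>lborel)"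
  proof (rule nn_integral_cong)
    fix s
    show "ennreal (indicator {0..t} s * g s) = (\<Sum>k\<in>UNIV. jump_density y s k * (indicator {..t} s * indicator B (jump_target (flw y s) k)))"
    proof (cases "s \<in> {0..t}")
      case True
      then have s: "0 \<le> s" by simp
      have pos: "0 \<le> survival y s * mass (jump_vector (flw y s) k) * indicator B (jump_target (flw y s) k)" for k
        by (intro mult_nonneg_nonneg less_imp_le[OF survival_pos[OF y s]] 
            jump_vector_props(2)[OF flow_states[OF y s]]) simp
      have "g s = (\<Sum>k\<in>UNIV. survival y s * mass (jump_vector (flw y s) k) * indicator B (jump_target (flw y s) k))"
        by (simp only: g_def rate_eq sum_distrib_left mult.assoc)
      also have "ennreal \<dots> = (\<Sum>k\<in>UNIV. ennreal (survival y s * mass (jump_vector (flw y s) k) * indicator B (jump_target (flw y s) k)))"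
        by (rule sum_ennreal[symmetric], rule pos)
      also have "\<dots> = (\<Sum>k\<in>UNIV. jump_density y s k * (indicator {..t} s * indicator B (jump_target (flw y s) k)))"
        by (rule sum.cong[OF refl]) (use True in \<open>simp add: jump_density_def indicator_def\<close>)
      finally have "ennreal (g s) = (\<Sum>k\<in>UNIV. jump_density y s k * (indicator {..t} s * indicator B (jump_target (flw y s) k)))" .
      moreover have "indicator {0..t} s * g s = g s" using True by simp
      ultimately show ?thesis by (simp only:)
    next
      case False
      then have "jump_density y s k * (indicator {..t} s * indicator B (jump_target (flw y s) k)) = 0" for k
        by (cases "0 \<le> s") (simp_all add: jump_density_def)
      moreover have "indicator {0..t} s * g s = 0" using False by simp
      ultimately show ?thesis by (simp only: ennreal_0 sum.neutral_const)
    qed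
  qed
  finally show "ennreal (LBINT s:{0..t}. exp (- (LBINT r:{0..s}. rate (flw y r) UNIV)) * rate (flw y s) B) =
      (\<integral>\<^sup>+s. (\<Sum>k\<in>UNIV. jump_density y s k * (indicator {..t} s * indicator B (jump_target (flw y s) k))) \<partial>lborel)"
    unfolding eq .
  show "0 \<le> (LBINT s:{0..t}. exp (- (LBINT r:{0..s}. rate (flw y r) UNIV)) * rate (flw y s) B)"
    unfolding eq unfolding set_lebesgue_integral_def
    by (rule Bochner_Integration.integral_nonneg) (simp add: nn indicator_def)
qed

context
  fixes \<alpha> :: "('p, 'm) state"
  assumes \<alpha>: "\<alpha> \<in> states"
begin

abbreviation "M \<equiv> P \<alpha>"

lemma sets_M [measurable_cong]: "sets M = sets F" by (rule sets_P[OF \<alpha>])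
lemma space_M [simp]: "space M = space F" by (rule sets_eq_imp_space_eq[OF sets_M])

lemma prob_M: "prob_space M" by (rule prob[OF \<alpha>])

lemma subalgebra_H: "subalgebra M (H n)"
  using H_subset[of n] by (simp add: subalgebra_def sets_M)

lemma id_history_M [measurable]: "(\<lambda>\<omega>. \<omega>) \<in> M \<rightarrow>\<^sub>M H n"
  using id_history[of n] by (simp add: measurable_cong_sets[OF sets_M refl])

text \<open>
  The jump law integrated over an event of the history, with all real integrals turned into
  nonnegative ones.
\<close>
lemma jump_event_law:
  assumes G: "G \<in> sets (H n)" and t: "0 \<le> t" and B[measurable]: "B \<in> sets sum_borel"
  shows "emeasure M (G \<inter> jump_event n t B) = (\<integral>\<^sup>+\<omega>. indicator G \<omega> * indicator {\<omega>. T n \<omega> < \<infinity>} \<omega> * 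
    (\<integral>\<^sup>+s. (\<Sum>k\<in>UNIV. jump_density (Y n \<omega>) s k * (indicator {..t} s * indicator B (jump_target (flw (Y n \<omega>) s) k))) \<partial>lborel) \<partial>M)"
proof -
  interpret prob_space M by (rule prob_M)
  have "finite_measure_subalgebra M (H n)"
    using subalgebra_H by unfold_locales
  then interpret sigma_finite_subalgebra M "H n" by (rule finite_measure_subalgebra_is_sigma_finite)
  have GF: "G \<in> sets F" using G H_subset by auto
  note [measurable] = GF jump_event_sets[OF B]
  let ?f = "indicator (jump_event n t B) :: 'w \<Rightarrow> real"
  let ?rce = "real_cond_exp M (H n) ?f"
  define R where "R \<omega> = (if T n \<omega> < \<infinity> then LBINT s:{0..t}.
     exp (- (LBINT r:{0..s}. rate (flw (Y n \<omega>) r) UNIV)) * rate (flw (Y n \<omega>) s) B else 0)" for \<omega>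
  have ae: "AE \<omega> in M. ?rce \<omega> = R \<omega>"
    using jump_law[OF \<alpha> t B, of n] unfolding R_def jump_event_def .
  have R0: "0 \<le> R \<omega>" if "\<omega> \<in> space F" for \<omega>
    unfolding R_def using jump_integral(2)[OF Y_states[OF that] B] by simp
  have f: "integrable M ?f"
    by (rule integrable_real_indicator) (auto simp: sets_M emeasure_eq_measure)
  have "emeasure M (G \<inter> jump_event n t B) = ennreal (measure M (G \<inter> jump_event n t B))"
    by (rule emeasure_eq_measure)
  also have "measure M (G \<inter> jump_event n t B) = (\<integral>\<omega>\<in>G. ?f \<omega> \<partial>M)"
    unfolding set_lebesgue_integral_def by (simp add: indicator_inter_arith[symmetric] sets_M Int_absorb1 sets.sets_into_space[OF GF] 
        sets.sets_into_space[OF jump_event_sets] inf.coboundedI1)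
  also have "\<dots> = (\<integral>\<omega>\<in>G. ?rce \<omega> \<partial>M)" by (rule real_cond_exp_intA[OF f G])
  also have "ennreal \<dots> = (\<integral>\<^sup>+\<omega>. ennreal (indicator G \<omega> * ?rce \<omega>) \<partial>M)"
    unfolding set_lebesgue_integral_def real_scaleR_def
  proof (rule nn_integral_eq_integral[symmetric])
    show "integrable M (\<lambda>\<omega>. indicator G \<omega> * ?rce \<omega>)"
      using integrable_mult_indicator[OF _ real_cond_exp_int(1)[OF f], of G] by (simp add: sets_M)
    show "AE \<omega> in M. 0 \<le> indicator G \<omega> * ?rce \<omega>"
      using ae AE_space by eventually_elim (use R0 in \<open>auto simp: indicator_def\<close>)
  qed
  also have "\<dots> = (\<integral>\<^sup>+\<omega>. indicator G \<omega> * indicator {\<omega>. T n \<omega> < \<infinity>} \<omega> * 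
    (\<integral>\<^sup>+s. (\<Sum>k\<in>UNIV. jump_density (Y n \<omega>) s k * (indicator {..t} s * indicator B (jump_target (flw (Y n \<omega>) s) k))) \<partial>lborel) \<partial>M)"
  proof (rule nn_integral_cong_AE)
    show "AE \<omega> in M. ennreal (indicator G \<omega> * ?rce \<omega>) = indicator G \<omega> * indicator {\<omega>. T n \<omega> < \<infinity>} \<omega> * 
    (\<integral>\<^sup>+s. (\<Sum>k\<in>UNIV. jump_density (Y n \<omega>) s k * (indicator {..t} s * indicator B (jump_target (flw (Y n \<omega>) s) k))) \<partial>lborel)"
      using ae AE_space
    proof eventually_elim
      case (elim \<omega>)
      then have \<omega>: "\<omega> \<in> space F" by simp
      show ?case
        unfolding elim(1) R_def using jump_integral(1)[OF Y_states[OF \<omega>] B, where t=t] by (auto simp: indicator_def)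
    qed
  qed
  finally show ?thesis .
qed


text \<open>
  Both sides are integrals of \<open>f\<close> against finite measures on the product of the
  history with the next sojourn time and state. On the products of an event of the history, a
  half line and a set of states the two measures agree by the jump law, and these products
  generate the sigma-algebra. The measure of the right-hand side is an image of a density over a
  product with the finite set of phase pairs.
\<close>
theorem jump_chain_law:
  assumes f[measurable]: "f \<in> borel_measurable (H n \<Otimes>\<^sub>M (borel \<Otimes>\<^sub>M sum_borel))"
  shows "(\<integral>\<^sup>+\<omega>. indicator {\<omega>. T (Suc n) \<omega> < \<infinity>} \<omega> * f (\<omega>, sojourn n \<omega>, Y (Suc n) \<omega>) \<partial>M) =
    (\<integral>\<^sup>+\<omega>. indicator {\<omega>. T n \<omega> < \<infinity>} \<omega> * 
      (\<integral>\<^sup>+s. (\<Sum>k\<in>UNIV. jump_density (Y n \<omega>) s k * f (\<omega>, s, jump_target (flw (Y n \<omega>) s) k)) \<partial>lborel) \<partial>M)"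
proof -
  interpret prob_space M by (rule prob_M)
  let ?K = "count_space (UNIV :: (('i + 'j) \<times> ('i + 'j)) set)"
  let ?N = "H n \<Otimes>\<^sub>M (borel \<Otimes>\<^sub>M sum_borel)"
  interpret K: sigma_finite_measure ?K by (rule sigma_finite_measure_count_space_finite) simp
  interpret LK: pair_sigma_finite lborel ?K ..
  have LK': "sigma_finite_measure (lborel \<Otimes>\<^sub>M ?K)" ..
  define w where "w = (\<lambda>(\<omega>, s, k). indicator {\<omega>. T n \<omega> < \<infinity>} \<omega> * jump_density (Y n \<omega>) s k)"
  define g where "g = (\<lambda>(\<omega>, s, k). (\<omega>, s, jump_target (flw (Y n \<omega>) s) k))"
  have w[measurable]: "w \<in> borel_measurable (M \<Otimes>\<^sub>M (lborel \<Otimes>\<^sub>M ?K))"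
    unfolding w_def split_beta'
    by (rule measurable_compose_countable[where f="\<lambda>k x. indicator {\<omega>. T n \<omega> < \<infinity>} (fst x) * jump_density (Y n (fst x)) (fst (snd x)) k"
          and g="\<lambda>x. snd (snd x)"]) measurable
  have g[measurable]: "g \<in> (M \<Otimes>\<^sub>M (lborel \<Otimes>\<^sub>M ?K)) \<rightarrow>\<^sub>M ?N"
    unfolding g_def split_beta'
    by (rule measurable_compose_countable[where f="\<lambda>k x. (fst x, fst (snd x), jump_target (flw (Y n (fst x)) (fst (snd x))) k)"
          and g="\<lambda>x. snd (snd x)"]) measurable
  define \<mu>1 where "\<mu>1 = distr (density M (indicator {\<omega>. T (Suc n) \<omega> < \<infinity>})) ?N (\<lambda>\<omega>. (\<omega>, sojourn n \<omega>, Y (Suc n) \<omega>))"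
  define \<mu>2 where "\<mu>2 = distr (density (M \<Otimes>\<^sub>M (lborel \<Otimes>\<^sub>M ?K)) w) ?N g"
  have \<mu>1: "(\<integral>\<^sup>+x. f x \<partial>\<mu>1) = (\<integral>\<^sup>+\<omega>. indicator {\<omega>. T (Suc n) \<omega> < \<infinity>} \<omega> * f (\<omega>, sojourn n \<omega>, Y (Suc n) \<omega>) \<partial>M)"
    if [measurable]: "f \<in> borel_measurable ?N" for f
    unfolding \<mu>1_def by (subst nn_integral_distr; (subst nn_integral_density)?; measurable)
  have \<mu>2: "(\<integral>\<^sup>+x. f x \<partial>\<mu>2) = (\<integral>\<^sup>+\<omega>. indicator {\<omega>. T n \<omega> < \<infinity>} \<omega> * 
      (\<integral>\<^sup>+s. (\<Sum>k\<in>UNIV. jump_density (Y n \<omega>) s k * f (\<omega>, s, jump_target (flw (Y n \<omega>) s) k)) \<partial>lborel) \<partial>M)"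
    if [measurable]: "f \<in> borel_measurable ?N" for f
  proof -
    have fg: "(\<lambda>x. w x * f (g x)) \<in> borel_measurable (M \<Otimes>\<^sub>M (lborel \<Otimes>\<^sub>M ?K))" by measurable
    have "(\<integral>\<^sup>+x. f x \<partial>\<mu>2) = (\<integral>\<^sup>+x. w x * f (g x) \<partial>(M \<Otimes>\<^sub>M (lborel \<Otimes>\<^sub>M ?K)))"
      unfolding \<mu>2_def by (subst nn_integral_distr; (subst nn_integral_density)?; measurable)
    also have "\<dots> = (\<integral>\<^sup>+\<omega>. \<integral>\<^sup>+x. w (\<omega>, x) * f (g (\<omega>, x)) \<partial>(lborel \<Otimes>\<^sub>M ?K) \<partial>M)"
      by (rule sigma_finite_measure.nn_integral_fst[OF LK' fg, symmetric])
    also have "\<dots> = (\<integral>\<^sup>+\<omega>. \<integral>\<^sup>+s. \<integral>\<^sup>+k. w (\<omega>, s, k) * f (g (\<omega>, s, k)) \<partial>?K \<partial>lborel \<partial>M)"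
    proof (rule nn_integral_cong)
      fix \<omega> assume \<omega>: "\<omega> \<in> space M"
      have "(\<lambda>x. w (\<omega>, x) * f (g (\<omega>, x))) \<in> borel_measurable (lborel \<Otimes>\<^sub>M ?K)"
        using measurable_Pair2[OF fg \<omega>] by simp
      from K.nn_integral_fst[OF this]
      show "(\<integral>\<^sup>+x. w (\<omega>, x) * f (g (\<omega>, x)) \<partial>(lborel \<Otimes>\<^sub>M ?K)) = (\<integral>\<^sup>+s. \<integral>\<^sup>+k. w (\<omega>, s, k) * f (g (\<omega>, s, k)) \<partial>?K \<partial>lborel)"
        by simp
    qed
    also have "\<dots> = (\<integral>\<^sup>+\<omega>. indicator {\<omega>. T n \<omega> < \<infinity>} \<omega> * 
      (\<integral>\<^sup>+s. (\<Sum>k\<in>UNIV. jump_density (Y n \<omega>) s k * f (\<omega>, s, jump_target (flw (Y n \<omega>) s) k)) \<partial>lborel) \<partial>M)"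
    proof (rule nn_integral_cong)
      fix \<omega> assume \<omega>: "\<omega> \<in> space M"
      show "(\<integral>\<^sup>+s. \<integral>\<^sup>+k. w (\<omega>, s, k) * f (g (\<omega>, s, k)) \<partial>?K \<partial>lborel) = indicator {\<omega>. T n \<omega> < \<infinity>} \<omega> * 
        (\<integral>\<^sup>+s. (\<Sum>k\<in>UNIV. jump_density (Y n \<omega>) s k * f (\<omega>, s, jump_target (flw (Y n \<omega>) s) k)) \<partial>lborel)"
        by (cases "T n \<omega> < \<infinity>") (simp_all add: nn_integral_count_space_finite w_def g_def)
    qed
    finally show ?thesis .
  qed
  have "\<mu>1 = \<mu>2"
  proof (rule measure_eqI_generator_eq)
    let ?E = "{G \<times> ({..t::real} \<times> B) | G t B. G \<in> sets (H n) \<and> B \<in> sets (sum_borel :: ('p, 'm) state measure)}"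
    show "Int_stable ?E"
    proof (rule Int_stableI)
      fix a b assume "a \<in> ?E" "b \<in> ?E"
      then obtain G t B G' t' B' where ab: "a = G \<times> ({..t} \<times> B)" "b = G' \<times> ({..t'} \<times> B')" 
        "G \<in> sets (H n)" "G' \<in> sets (H n)" "B \<in> sets sum_borel" "B' \<in> sets sum_borel" by blast
      then have "a \<inter> b = (G \<inter> G') \<times> ({..min t t'} \<times> (B \<inter> B'))" by auto
      then show "a \<inter> b \<in> ?E" using ab by blast
    qed
    show "?E \<subseteq> Pow (space (H n) \<times> UNIV)" using sets.sets_into_space[of _ "H n"] by blast
    show "sets \<mu>1 = sigma_sets (space (H n) \<times> UNIV) ?E" "sets \<mu>2 = sigma_sets (space (H n) \<times> UNIV) ?E"
      by (simp_all add: \<mu>1_def \<mu>2_def sets_history_jump)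
    show "range (\<lambda>i::nat. space (H n) \<times> ({..real i} \<times> UNIV)) \<subseteq> ?E"
      using sets.top[of "H n"] sets.top[of "sum_borel :: ('p, 'm) state measure"] by (auto simp del: sets.top)
    show "(\<Union>i::nat. space (H n) \<times> ({..real i} \<times> UNIV)) = space (H n) \<times> UNIV"
      using real_arch_simple by (auto simp: set_eq_iff)
    show "emeasure \<mu>1 (space (H n) \<times> ({..real i} \<times> UNIV)) \<noteq> \<infinity>" for i :: nat
    proof -
      have "emeasure \<mu>1 (space (H n) \<times> ({..real i} \<times> UNIV)) \<le> emeasure \<mu>1 (space \<mu>1)" by (rule emeasure_space)
      also have "\<dots> = (\<integral>\<^sup>+x. 1 \<partial>\<mu>1)" by simp
      also have "\<dots> = (\<integral>\<^sup>+\<omega>. indicator {\<omega>. T (Suc n) \<omega> < \<infinity>} \<omega> * 1 \<partial>M)" by (rule \<mu>1) simp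
      also have "\<dots> \<le> (\<integral>\<^sup>+\<omega>. 1 \<partial>M)" by (intro nn_integral_mono) (auto simp: indicator_def)
      also have "\<dots> < \<infinity>" by (simp add: less_top[symmetric])
      finally show ?thesis by auto
    qed
    fix X assume "X \<in> ?E"
    then obtain G t B where X: "X = G \<times> ({..t} \<times> B)" and G: "G \<in> sets (H n)" and B: "B \<in> sets (sum_borel :: ('p, 'm) state measure)" by blast
    have GF: "G \<in> sets F" using G H_subset by auto
    note [measurable] = G B GF
    have XN: "X \<in> sets ?N" unfolding X by (intro pair_measureI) auto
    have ind: "indicator X (\<omega>, s, z) = indicator G \<omega> * (indicator {..t} s * indicator B z :: ennreal)" for \<omega> s z
      by (auto simp: X indicator_def)
    have "emeasure \<mu>1 X = (\<integral>\<^sup>+x. indicator X x \<partial>\<mu>1)" using XN by (simp add: \<mu>1_def)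
    also have "\<dots> = (\<integral>\<^sup>+\<omega>. indicator {\<omega>. T (Suc n) \<omega> < \<infinity>} \<omega> * indicator X (\<omega>, sojourn n \<omega>, Y (Suc n) \<omega>) \<partial>M)"
      by (rule \<mu>1) (use XN in simp)
    also have "\<dots> = (\<integral>\<^sup>+\<omega>. indicator (if 0 \<le> t then G \<inter> jump_event n t B else {}) \<omega> \<partial>M)"
    proof (rule nn_integral_cong)
      fix \<omega> assume "\<omega> \<in> space M"
      then have \<omega>: "\<omega> \<in> space F" by simp
      show "indicator {\<omega>. T (Suc n) \<omega> < \<infinity>} \<omega> * indicator X (\<omega>, sojourn n \<omega>, Y (Suc n) \<omega>) = 
          (indicator (if 0 \<le> t then G \<inter> jump_event n t B else {}) \<omega> :: ennreal)"
        using sojourn_pos[OF \<omega>, of n] sojourn_le_iff[OF \<omega>, of n t] T_Suc_finite[OF \<omega>, of n]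
        unfolding ind by (auto simp: indicator_def jump_event_def \<omega>)
    qed
    also have "\<dots> = emeasure M (if 0 \<le> t then G \<inter> jump_event n t B else {})"
      by (rule nn_integral_indicator) (use GF jump_event_sets[OF B] in \<open>auto simp: sets_M\<close>)
    also have "\<dots> = (\<integral>\<^sup>+\<omega>. indicator {\<omega>. T n \<omega> < \<infinity>} \<omega> * 
      (\<integral>\<^sup>+s. (\<Sum>k\<in>UNIV. jump_density (Y n \<omega>) s k * indicator X (\<omega>, s, jump_target (flw (Y n \<omega>) s) k)) \<partial>lborel) \<partial>M)"
    proof (cases "0 \<le> t")
      case True
      have "emeasure M (G \<inter> jump_event n t B) = (\<integral>\<^sup>+\<omega>. indicator {\<omega>. T n \<omega> < \<infinity>} \<omega> * 
      (\<integral>\<^sup>+s. (\<Sum>k\<in>UNIV. jump_density (Y n \<omega>) s k * indicator X (\<omega>, s, jump_target (flw (Y n \<omega>) s) k)) \<partial>lborel) \<partial>M)"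
        unfolding jump_event_law[OF G True B] ind
        by (intro nn_integral_cong) (auto simp: indicator_def)
      then show ?thesis using True by simp
    next
      case False
      have "(\<integral>\<^sup>+s. (\<Sum>k\<in>UNIV. jump_density (Y n \<omega>) s k * indicator X (\<omega>, s, jump_target (flw (Y n \<omega>) s) k)) \<partial>lborel) = 0" for \<omega>
      proof -
        have "jump_density (Y n \<omega>) s k * indicator X (\<omega>, s, jump_target (flw (Y n \<omega>) s) k) = 0" for s k
          using False unfolding ind jump_density_def by (auto simp: indicator_def)
        then show ?thesis by (simp only: sum.neutral_const nn_integral_0_iff_AE nn_integral_const mult_zero_left)
      qed
      then show ?thesis using False by simp
    qed
    also have "\<dots> = (\<integral>\<^sup>+x. indicator X x \<partial>\<mu>2)" by (rule \<mu>2[symmetric]) (use XN in simp)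
    also have "\<dots> = emeasure \<mu>2 X" using XN by (simp add: \<mu>2_def)
    finally show "emeasure \<mu>1 X = emeasure \<mu>2 X" .
  qed
  then show ?thesis using \<mu>1[OF f] \<mu>2[OF f] by simp
qed

end

end

context rap_fluid
begin

text \<open>
  The rate, along the unnormalised flow from \<open>y\<close>, at which jumps contribute to the
  functional with values \<open>u\<close> and \<open>v\<close>.
\<close>
abbreviation flux :: "real^'p \<Rightarrow> real^'m \<Rightarrow> real \<Rightarrow> ('p, 'm) state \<Rightarrow> real" where
  "flux u v s y \<equiv> pairing (mexp (s *\<^sub>R Gp) *v ((Cp - Gp) *v u + Dpm *v v))
    (mexp (s *\<^sub>R Gm) *v ((Cm - Gm) *v v + Dmp *v u)) y"

text \<open>
  For functionals linear in the next state the sum over the jumps collapses to the matrices of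
  the process. The coefficients may depend on the history and on the sojourn time.
\<close>
lemma one_step_linear:
  assumes \<alpha>: "\<alpha> \<in> states"
    and u[measurable]: "(\<lambda>x. u (fst x) (snd x)) \<in> borel_measurable (H n \<Otimes>\<^sub>M borel)"
    and v[measurable]: "(\<lambda>x. v (fst x) (snd x)) \<in> borel_measurable (H n \<Otimes>\<^sub>M borel)"
    and nn: "\<And>\<omega> s. \<omega> \<in> space F \<Longrightarrow> 0 \<le> s \<Longrightarrow> u \<omega> s \<in> nonneg_on Up" 
      "\<And>\<omega> s. \<omega> \<in> space F \<Longrightarrow> 0 \<le> s \<Longrightarrow> v \<omega> s \<in> nonneg_on Um"
  shows "(\<integral>\<^sup>+\<omega>. indicator {\<omega>. T (Suc n) \<omega> < \<infinity>} \<omega> * 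
      ennreal (pairing (u \<omega> (sojourn n \<omega>)) (v \<omega> (sojourn n \<omega>)) (Y (Suc n) \<omega>)) \<partial>P \<alpha>) =
    (\<integral>\<^sup>+\<omega>. indicator {\<omega>. T n \<omega> < \<infinity>} \<omega> * (\<integral>\<^sup>+s. indicator {0..} s *
      ennreal (flux (u \<omega> s) (v \<omega> s) s (Y n \<omega>)) \<partial>lborel) \<partial>P \<alpha>)"
proof -
  let ?f = "\<lambda>x. ennreal (pairing (u (fst x) (fst (snd x))) (v (fst x) (fst (snd x))) (snd (snd x)))"
  have proj: "(\<lambda>x. (fst x, fst (snd x))) \<in> (H n \<Otimes>\<^sub>M (borel \<Otimes>\<^sub>M (sum_borel :: ('p, 'm) state measure))) \<rightarrow>\<^sub>M H n \<Otimes>\<^sub>M borel"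
    by measurable
  have "(\<lambda>x. u (fst x) (fst (snd x))) \<in> borel_measurable (H n \<Otimes>\<^sub>M (borel \<Otimes>\<^sub>M (sum_borel :: ('p, 'm) state measure)))"
    using measurable_compose[OF proj u] by simp
  moreover have "(\<lambda>x. v (fst x) (fst (snd x))) \<in> borel_measurable (H n \<Otimes>\<^sub>M (borel \<Otimes>\<^sub>M (sum_borel :: ('p, 'm) state measure)))"
    using measurable_compose[OF proj v] by simp
  ultimately have f: "?f \<in> borel_measurable (H n \<Otimes>\<^sub>M (borel \<Otimes>\<^sub>M sum_borel))" by measurable
  have eq: "(\<Sum>k\<in>UNIV. jump_density (Y n \<omega>) s k * ennreal (pairing (u \<omega> s) (v \<omega> s) (jump_target (flw (Y n \<omega>) s) k))) =
     indicator {0..} s *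
      ennreal (flux (u \<omega> s) (v \<omega> s) s (Y n \<omega>))" if \<omega>: "\<omega> \<in> space F" for \<omega> s
  proof (cases "0 \<le> s")
    case True
    note y = Y_states[OF \<omega>, of n]
    note fy = flow_states[OF y True]
    have 1: "jump_density (Y n \<omega>) s k * ennreal (pairing (u \<omega> s) (v \<omega> s) (jump_target (flw (Y n \<omega>) s) k)) =
        ennreal (survival (Y n \<omega>) s * pairing (u \<omega> s) (v \<omega> s) (jump_vector (flw (Y n \<omega>) s) k))" for k
    proof -
      have "0 \<le> survival (Y n \<omega>) s * mass (jump_vector (flw (Y n \<omega>) s) k)"
        by (intro mult_nonneg_nonneg less_imp_le[OF survival_pos[OF y True]] jump_vector_props(2) fy)
      from ennreal_mult'[OF this, of "pairing (u \<omega> s) (v \<omega> s) (jump_target (flw (Y n \<omega>) s) k)"]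
      show ?thesis using True by (simp add: jump_density_def mult.assoc jump_vector_props(1)[OF fy])
    qed
    have 2: "0 \<le> survival (Y n \<omega>) s * pairing (u \<omega> s) (v \<omega> s) (jump_vector (flw (Y n \<omega>) s) k)" for k
      by (intro mult_nonneg_nonneg less_imp_le[OF survival_pos[OF y True]] jump_vector_props(3) fy nn \<omega> True)
    have "(\<Sum>k\<in>UNIV. jump_density (Y n \<omega>) s k * ennreal (pairing (u \<omega> s) (v \<omega> s) (jump_target (flw (Y n \<omega>) s) k))) =
        ennreal (\<Sum>k\<in>UNIV. survival (Y n \<omega>) s * pairing (u \<omega> s) (v \<omega> s) (jump_vector (flw (Y n \<omega>) s) k))"
      unfolding 1 by (rule sum_ennreal, rule 2)
    also have "\<dots> = ennreal (flux (u \<omega> s) (v \<omega> s) s (Y n \<omega>))"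
      by (simp only: sum_distrib_left[symmetric] sum_jump_vector_pairing survival_flow[OF y True])
    finally show ?thesis using True by simp
  next
    case False
    then have "jump_density (Y n \<omega>) s k = 0" for k by (simp add: jump_density_def)
    then show ?thesis using False by simp
  qed
  note jump_chain_law[OF \<alpha> f, unfolded fst_conv snd_conv]
  also have "(\<integral>\<^sup>+\<omega>. indicator {\<omega>. T n \<omega> < \<infinity>} \<omega> * (\<integral>\<^sup>+s. (\<Sum>k\<in>UNIV. jump_density (Y n \<omega>) s k * 
        ennreal (pairing (u \<omega> s) (v \<omega> s) (jump_target (flw (Y n \<omega>) s) k))) \<partial>lborel) \<partial>P \<alpha>) =
    (\<integral>\<^sup>+\<omega>. indicator {\<omega>. T n \<omega> < \<infinity>} \<omega> * (\<integral>\<^sup>+s. indicator {0..} s *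
      ennreal (flux (u \<omega> s) (v \<omega> s) s (Y n \<omega>)) \<partial>lborel) \<partial>P \<alpha>)"
  proof (rule nn_integral_cong)
    fix \<omega> assume "\<omega> \<in> space (P \<alpha>)"
    then have \<omega>: "\<omega> \<in> space F" by (simp add: space_M[OF \<alpha>])
    show "indicator {\<omega>. T n \<omega> < \<infinity>} \<omega> * (\<integral>\<^sup>+s. (\<Sum>k\<in>UNIV. jump_density (Y n \<omega>) s k * 
        ennreal (pairing (u \<omega> s) (v \<omega> s) (jump_target (flw (Y n \<omega>) s) k))) \<partial>lborel) =
      indicator {\<omega>. T n \<omega> < \<infinity>} \<omega> * (\<integral>\<^sup>+s. indicator {0..} s *
      ennreal (flux (u \<omega> s) (v \<omega> s) s (Y n \<omega>)) \<partial>lborel)"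
      unfolding eq[OF \<omega>] by (rule refl)
  qed
  finally show ?thesis .
qed

lemma Y_mass_one: "\<omega> \<in> space F \<Longrightarrow> pairing 1 1 (Y n \<omega>) = 1"
  by (rule states_cases[OF Y_states[of \<omega> n]]) (auto simp: p.sum_one m.sum_one)

text \<open>
  The density of the next sojourn time given that the last state is \<open>y\<close>: minus the
  derivative of the survival function.
\<close>
definition exit_density :: "('p, 'm) state \<Rightarrow> real \<Rightarrow> real" where
  "exit_density y s = pairing (mexp (s *\<^sub>R Gp) *v (- (Gp *v 1))) (mexp (s *\<^sub>R Gm) *v (- (Gm *v 1))) y"

lemma exit_density_measurable [measurable]: "exit_density y \<in> borel_measurable borel"
  unfolding exit_density_def by measurable

lemma survival_derivative:
  "((\<lambda>s. - survival y s) has_real_derivative exit_density y s) (at s within S)"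
proof (cases y)
  case (Inl a)
  show ?thesis
    unfolding Inl survival_def exit_density_def pairing_simps 
    by (rule DERIV_cong[OF DERIV_minus[OF inner_mexp_derivative[OF has_vector_derivative_const]]])
      (simp add: mult_linear_simps)
next
  case (Inr a)
  show ?thesis
    unfolding Inr survival_def exit_density_def pairing_simps 
    by (rule DERIV_cong[OF DERIV_minus[OF inner_mexp_derivative[OF has_vector_derivative_const]]])
      (simp add: mult_linear_simps)
qed

lemma exit_density_nonneg:
  assumes y: "y \<in> states" and s: "0 \<le> s"
  shows "0 \<le> exit_density y s"
proof -
  have "0 \<le> survival y s * pairing (- (Gp *v 1)) (- (Gm *v 1)) (flw y s)"
    using sum_jump_vector_nonneg[OF flow_states[OF y s] p.one_nonneg m.one_nonneg] survival_pos[OF y s]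
    by (simp add: unit_gain)
  then show ?thesis by (simp only: survival_flow[OF y s] exit_density_def)
qed

lemma survival_zero: "y \<in> states \<Longrightarrow> survival y 0 = 1"
  by (rule states_cases) (auto simp: survival_def p.sum_one m.sum_one)

lemma survival_integral:
  assumes y: "y \<in> states" and L: "0 \<le> L"
  shows "(\<integral>\<^sup>+s. indicator {0..L} s * ennreal (exit_density y s) \<partial>lborel) = ennreal (1 - survival y L)"
proof -
  have c: "continuous_on {0..L} (exit_density y)"
    unfolding exit_density_def by (cases y) (auto intro!: continuous_intros mexp_vector_continuous)
  have int: "set_integrable lborel {0..L} (exit_density y)"
    unfolding set_integrable_def by (rule borel_integrable_compact[OF compact_Icc c])
  have "(\<integral>\<^sup>+s. indicator {0..L} s * ennreal (exit_density y s) \<partial>lborel) = 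
      (\<integral>\<^sup>+s. ennreal (indicator {0..L} s * exit_density y s) \<partial>lborel)"
    by (intro nn_integral_cong) (auto simp: indicator_def)
  also have "\<dots> = ennreal (LBINT s:{0..L}. exit_density y s)"
    unfolding set_lebesgue_integral_def real_scaleR_def
    by (rule nn_integral_eq_integral) 
      (use int exit_density_nonneg[OF y] in \<open>auto simp: set_integrable_def indicator_def\<close>)
  also have "(LBINT s:{0..L}. exit_density y s) = - survival y L - (- survival y 0)"
    by (rule LBINT_FTC[OF L survival_derivative[unfolded has_real_derivative_iff_has_vector_derivative] int])
  finally show ?thesis by (simp add: survival_zero[OF y])
qed

lemma survival_le_one: 
  assumes "y \<in> states" "0 \<le> L" 
  shows "survival y L \<le> 1"
  using nondecreasing_on_Icc[OF assms(2) survival_derivative, of y] exit_density_nonneg[OF assms(1)]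
  by (simp add: survival_zero[OF assms(1)])

text \<open>
  The complementary event, a jump within time \<open>L\<close>, is the case \<open>u = v =
  \<phi> 1\<close> of the linear one-step law, because \<open>1\<close> has value one on every
  state. Bounded \<open>\<phi>\<close> makes the subtraction of integrals legitimate. The event
  of no jump by \<open>L\<close> includes that of no further jump at all.
\<close>
lemma no_jump_law:
  assumes \<alpha>: "\<alpha> \<in> states" 
    and \<phi>[measurable]: "\<phi> \<in> borel_measurable (H n)" and \<phi>0: "\<And>\<omega>. \<omega> \<in> space F \<Longrightarrow> 0 \<le> \<phi> \<omega>" 
    and \<phi>b: "\<And>\<omega>. \<omega> \<in> space F \<Longrightarrow> \<phi> \<omega> \<le> (c::real)"
    and L[measurable]: "L \<in> borel_measurable (H n)" and L0: "\<And>\<omega>. \<omega> \<in> space F \<Longrightarrow> \<phi> \<omega> \<noteq> 0 \<Longrightarrow> 0 \<le> L \<omega>"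
  shows "(\<integral>\<^sup>+\<omega>. indicator {\<omega>. T n \<omega> < \<infinity>} \<omega> * indicator {\<omega>. \<not> (T (Suc n) \<omega> < \<infinity> \<and> sojourn n \<omega> \<le> L \<omega>)} \<omega> * ennreal (\<phi> \<omega>) \<partial>P \<alpha>) =
    (\<integral>\<^sup>+\<omega>. indicator {\<omega>. T n \<omega> < \<infinity>} \<omega> * ennreal (\<phi> \<omega> * survival (Y n \<omega>) (L \<omega>)) \<partial>P \<alpha>)"
proof -
  interpret prob_space "P \<alpha>" by (rule prob[OF \<alpha>])
  note [measurable_cong] = sets_P[OF \<alpha>]
  have [measurable]: "\<phi> \<in> borel_measurable F" "L \<in> borel_measurable F"
    using measurable_compose[OF id_history \<phi>] measurable_compose[OF id_history L] by auto
  define u :: "'w \<Rightarrow> real \<Rightarrow> real^'p" where "u \<omega> s = (if s \<le> L \<omega> then \<phi> \<omega> *\<^sub>R 1 else 0)" for \<omega> s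
  define v :: "'w \<Rightarrow> real \<Rightarrow> real^'m" where "v \<omega> s = (if s \<le> L \<omega> then \<phi> \<omega> *\<^sub>R 1 else 0)" for \<omega> s
  let ?T = "indicator {\<omega>. T n \<omega> < \<infinity>} :: 'w \<Rightarrow> ennreal"
  let ?A = "\<integral>\<^sup>+\<omega>. indicator {\<omega>. T (Suc n) \<omega> < \<infinity>} \<omega> * ennreal (pairing (u \<omega> (sojourn n \<omega>)) (v \<omega> (sojourn n \<omega>)) (Y (Suc n) \<omega>)) \<partial>P \<alpha>"
  let ?B = "\<integral>\<^sup>+\<omega>. ?T \<omega> * indicator {\<omega>. \<not> (T (Suc n) \<omega> < \<infinity> \<and> sojourn n \<omega> \<le> L \<omega>)} \<omega> * ennreal (\<phi> \<omega>) \<partial>P \<alpha>"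
  have um: "(\<lambda>x. u (fst x) (snd x)) \<in> borel_measurable (H n \<Otimes>\<^sub>M borel)"
    unfolding u_def by (intro measurable_If borel_measurable_scaleR borel_measurable_const) measurable
  have vm: "(\<lambda>x. v (fst x) (snd x)) \<in> borel_measurable (H n \<Otimes>\<^sub>M borel)"
    unfolding v_def by (intro measurable_If borel_measurable_scaleR borel_measurable_const) measurable
  have "?A = (\<integral>\<^sup>+\<omega>. ?T \<omega> * (\<integral>\<^sup>+s. indicator {0..} s *
      ennreal (flux (u \<omega> s) (v \<omega> s) s (Y n \<omega>)) \<partial>lborel) \<partial>P \<alpha>)"
    by (rule one_step_linear[OF \<alpha> um vm]) 
      (auto simp: u_def v_def intro!: nonneg_on_scaleR \<phi>0 p.one_nonneg m.one_nonneg)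
  also have "\<dots> = (\<integral>\<^sup>+\<omega>. ?T \<omega> * ennreal (\<phi> \<omega> * (1 - survival (Y n \<omega>) (L \<omega>))) \<partial>P \<alpha>)"
  proof (rule nn_integral_cong)
    fix \<omega> assume "\<omega> \<in> space (P \<alpha>)"
    then have \<omega>: "\<omega> \<in> space F" by (simp add: space_M[OF \<alpha>])
    have "(\<integral>\<^sup>+s. indicator {0..} s * ennreal (flux (u \<omega> s) (v \<omega> s) s (Y n \<omega>)) \<partial>lborel) = ennreal (\<phi> \<omega> * (1 - survival (Y n \<omega>) (L \<omega>)))"
    proof (cases "\<phi> \<omega> = 0")
      case True
      then have z: "u \<omega> s = 0" "v \<omega> s = 0" for s by (auto simp: u_def v_def)
      have "pairing 0 0 (Y n \<omega>) = 0" by (cases "Y n \<omega>") auto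
      then show ?thesis unfolding z using True by (simp add: mult_linear_simps)
    next
      case False
      let ?g = "exit_density (Y n \<omega>)"
      have c: "indicator {0..} s * ennreal (flux (u \<omega> s) (v \<omega> s) s (Y n \<omega>)) = ennreal (\<phi> \<omega>) * (indicator {0..L \<omega>} s * ennreal (?g s))" for s
      proof (cases "s \<le> L \<omega>")
        case True
        have e: "(Cp - Gp) *v u \<omega> s + Dpm *v v \<omega> s = \<phi> \<omega> *\<^sub>R (- (Gp *v 1))"
          "(Cm - Gm) *v v \<omega> s + Dmp *v u \<omega> s = \<phi> \<omega> *\<^sub>R (- (Gm *v 1))"
          unfolding unit_gain[symmetric] using True by (simp_all add: u_def v_def mult_linear_simps scaleR_add_right scaleR_diff_right)
        have e': "pairing (E *v (\<phi> \<omega> *\<^sub>R a)) (E' *v (\<phi> \<omega> *\<^sub>R b)) (Y n \<omega>) = \<phi> \<omega> * pairing (E *v a) (E' *v b) (Y n \<omega>)" for E E' a b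
          by (cases "Y n \<omega>") (simp_all add: mult_linear_simps)
        show ?thesis
          unfolding e e' exit_density_def using True \<phi>0[OF \<omega>] by (simp add: ennreal_mult' indicator_def)
      next
        case False
        then have "u \<omega> s = 0" "v \<omega> s = 0" by (auto simp: u_def v_def)
        moreover have "pairing 0 0 (Y n \<omega>) = 0" by (cases "Y n \<omega>") auto
        ultimately show ?thesis using False by (simp add: mult_linear_simps)
      qed
      show ?thesis
        unfolding c using survival_integral[OF Y_states[OF \<omega>] L0[OF \<omega> False], of n] \<phi>0[OF \<omega>]
        by (subst nn_integral_cmult) (auto simp: ennreal_mult')
    qed
    then show "?T \<omega> * (\<integral>\<^sup>+s. indicator {0..} s * ennreal (flux (u \<omega> s) (v \<omega> s) s (Y n \<omega>)) \<partial>lborel) = ?T \<omega> * ennreal (\<phi> \<omega> * (1 - survival (Y n \<omega>) (L \<omega>)))"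
      by (rule arg_cong)
  qed
  finally have A: "?A = (\<integral>\<^sup>+\<omega>. ?T \<omega> * ennreal (\<phi> \<omega> * (1 - survival (Y n \<omega>) (L \<omega>))) \<partial>P \<alpha>)" .
  have "?A + ?B = (\<integral>\<^sup>+\<omega>. ?T \<omega> * ennreal (\<phi> \<omega>) \<partial>P \<alpha>)"
  proof -
    have A': "?A = (\<integral>\<^sup>+\<omega>. indicator {\<omega>. T (Suc n) \<omega> < \<infinity> \<and> sojourn n \<omega> \<le> L \<omega>} \<omega> * ennreal (\<phi> \<omega>) \<partial>P \<alpha>)"
    proof (rule nn_integral_cong)
      fix \<omega> assume "\<omega> \<in> space (P \<alpha>)"
      then have \<omega>: "\<omega> \<in> space F" by (simp add: space_M[OF \<alpha>])
      have "pairing (\<phi> \<omega> *\<^sub>R 1) (\<phi> \<omega> *\<^sub>R 1) (Y (Suc n) \<omega>) = \<phi> \<omega> * pairing 1 1 (Y (Suc n) \<omega>)" 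
        "pairing 0 0 (Y (Suc n) \<omega>) = 0"
        by (cases "Y (Suc n) \<omega>"; simp)+
      then show "indicator {\<omega>. T (Suc n) \<omega> < \<infinity>} \<omega> * ennreal (pairing (u \<omega> (sojourn n \<omega>)) (v \<omega> (sojourn n \<omega>)) (Y (Suc n) \<omega>)) =
          indicator {\<omega>. T (Suc n) \<omega> < \<infinity> \<and> sojourn n \<omega> \<le> L \<omega>} \<omega> * ennreal (\<phi> \<omega>)"
        using Y_mass_one[OF \<omega>, of "Suc n"] by (auto simp: u_def v_def indicator_def)
    qed
    have "?A + ?B = (\<integral>\<^sup>+\<omega>. indicator {\<omega>. T (Suc n) \<omega> < \<infinity> \<and> sojourn n \<omega> \<le> L \<omega>} \<omega> * ennreal (\<phi> \<omega>) +
        ?T \<omega> * indicator {\<omega>. \<not> (T (Suc n) \<omega> < \<infinity> \<and> sojourn n \<omega> \<le> L \<omega>)} \<omega> * ennreal (\<phi> \<omega>) \<partial>P \<alpha>)"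
      unfolding A' by (rule nn_integral_add[symmetric]) measurable
    also have "\<dots> = (\<integral>\<^sup>+\<omega>. ?T \<omega> * ennreal (\<phi> \<omega>) \<partial>P \<alpha>)"
    proof (rule nn_integral_cong)
      fix \<omega> assume "\<omega> \<in> space (P \<alpha>)"
      then have \<omega>: "\<omega> \<in> space F" by (simp add: space_M[OF \<alpha>])
      show "indicator {\<omega>. T (Suc n) \<omega> < \<infinity> \<and> sojourn n \<omega> \<le> L \<omega>} \<omega> * ennreal (\<phi> \<omega>) +
        ?T \<omega> * indicator {\<omega>. \<not> (T (Suc n) \<omega> < \<infinity> \<and> sojourn n \<omega> \<le> L \<omega>)} \<omega> * ennreal (\<phi> \<omega>) = ?T \<omega> * ennreal (\<phi> \<omega>)"
        using T_Suc_finite[OF \<omega>, of n]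
        by (cases "T (Suc n) \<omega> < \<infinity> \<and> sojourn n \<omega> \<le> L \<omega>") simp_all
    qed
    finally show ?thesis .
  qed
  moreover have "(\<integral>\<^sup>+\<omega>. ?T \<omega> * ennreal (\<phi> \<omega>) \<partial>P \<alpha>) = ?A + (\<integral>\<^sup>+\<omega>. ?T \<omega> * ennreal (\<phi> \<omega> * survival (Y n \<omega>) (L \<omega>)) \<partial>P \<alpha>)"
    unfolding A
  proof (subst nn_integral_add[symmetric])
    show "(\<integral>\<^sup>+\<omega>. ?T \<omega> * ennreal (\<phi> \<omega>) \<partial>P \<alpha>) = (\<integral>\<^sup>+\<omega>. ?T \<omega> * ennreal (\<phi> \<omega> * (1 - survival (Y n \<omega>) (L \<omega>))) +
        ?T \<omega> * ennreal (\<phi> \<omega> * survival (Y n \<omega>) (L \<omega>)) \<partial>P \<alpha>)"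
    proof (rule nn_integral_cong)
      fix \<omega> assume "\<omega> \<in> space (P \<alpha>)"
      then have \<omega>: "\<omega> \<in> space F" by (simp add: space_M[OF \<alpha>])
      have "ennreal (\<phi> \<omega>) = ennreal (\<phi> \<omega> * (1 - survival (Y n \<omega>) (L \<omega>))) + ennreal (\<phi> \<omega> * survival (Y n \<omega>) (L \<omega>))"
      proof (cases "\<phi> \<omega> = 0")
        case False
        note L = L0[OF \<omega> False] and y = Y_states[OF \<omega>, of n]
        have "ennreal (\<phi> \<omega> * (1 - survival (Y n \<omega>) (L \<omega>))) + ennreal (\<phi> \<omega> * survival (Y n \<omega>) (L \<omega>)) =
            ennreal (\<phi> \<omega> * (1 - survival (Y n \<omega>) (L \<omega>)) + \<phi> \<omega> * survival (Y n \<omega>) (L \<omega>))"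
          using \<phi>0[OF \<omega>] survival_le_one[OF y L] survival_pos[OF y L] by (intro ennreal_plus[symmetric]) simp_all
        also have "\<phi> \<omega> * (1 - survival (Y n \<omega>) (L \<omega>)) + \<phi> \<omega> * survival (Y n \<omega>) (L \<omega>) = \<phi> \<omega>"
          by (simp add: right_diff_distrib)
        finally show ?thesis by (rule sym)
      qed simp
      then show "?T \<omega> * ennreal (\<phi> \<omega>) = ?T \<omega> * ennreal (\<phi> \<omega> * (1 - survival (Y n \<omega>) (L \<omega>))) +
        ?T \<omega> * ennreal (\<phi> \<omega> * survival (Y n \<omega>) (L \<omega>))"
        by (simp add: distrib_left[symmetric])
    qed
  qed measurable
  moreover have "?A \<noteq> \<infinity>"
  proof -
    have "?A \<le> ?A + ?B" by simp
    also have "\<dots> = (\<integral>\<^sup>+\<omega>. ?T \<omega> * ennreal (\<phi> \<omega>) \<partial>P \<alpha>)" by fact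
    also have "\<dots> \<le> (\<integral>\<^sup>+\<omega>. ennreal c \<partial>P \<alpha>)"
      using \<phi>b by (intro nn_integral_mono) (auto simp: indicator_def space_M[OF \<alpha>] ennreal_leI)
    also have "\<dots> < \<infinity>" by (simp add: ennreal_mult_less_top emeasure_space_1 del: space_M)
    finally show ?thesis by auto
  qed
  ultimately show ?thesis by (simp add: ennreal_add_left_cancel)
qed

end

section \<open>Keeping the sign\<close>

text \<open>
  Variation of constants: the integrand is the derivative of \<open>- a \<bullet>
  e\<^sup>G\<^sup>s e\<^sup>C\<^sup>(\<^sup>r\<^sup>-\<^sup>s\<^sup>) h\<close>.
\<close>
lemma duhamel_integral:
  fixes a :: "real^'n" and G C :: "real^'n^'n"
  assumes r: "0 \<le> r" 
    and nn: "\<And>s. s \<in> {0..r} \<Longrightarrow> 0 \<le> a \<bullet> (mexp (s *\<^sub>R G) *v ((C - G) *v (mexp ((r - s) *\<^sub>R C) *v h)))"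
  shows "(\<integral>\<^sup>+s. indicator {0..r} s * ennreal (a \<bullet> (mexp (s *\<^sub>R G) *v ((C - G) *v (mexp ((r - s) *\<^sub>R C) *v h)))) \<partial>lborel) =
    ennreal (a \<bullet> (mexp (r *\<^sub>R C) *v h) - a \<bullet> (mexp (r *\<^sub>R G) *v h))"
proof -
  let ?g = "\<lambda>s. a \<bullet> (mexp (s *\<^sub>R G) *v ((C - G) *v (mexp ((r - s) *\<^sub>R C) *v h)))"
  let ?F = "\<lambda>s. - (a \<bullet> (mexp (s *\<^sub>R G) *v (mexp ((r - s) *\<^sub>R C) *v h)))"
  have e: "((\<lambda>s. mexp ((r - s) *\<^sub>R C) *v h) has_vector_derivative - (C *v (mexp ((r - s) *\<^sub>R C) *v h))) (at s within {0..r})" for s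
    by (rule has_vector_derivative_eq_rhs[OF matrix_vector_derivative[OF mexp_has_vector_derivative_rev has_vector_derivative_const]])
      (simp add: mult_linear_simps mexp_commute matrix_vector_mul_assoc)
  have d: "(?F has_vector_derivative ?g s) (at s within {0..r})" for s
    unfolding has_real_derivative_iff_has_vector_derivative[symmetric]
    by (rule DERIV_cong[OF DERIV_minus[OF inner_mexp_derivative[OF e]]])
      (simp add: mult_linear_simps inner_diff_right)
  have ce: "continuous_on {0..r} (\<lambda>s. mexp ((r - s) *\<^sub>R C) *v h)"
    by (rule continuous_on_vector_derivative, rule e)
  have c: "continuous_on {0..r} ?g"
    by (rule continuous_on_inner[OF continuous_on_const], 
        rule bounded_bilinear.continuous_on[OF bounded_bilinear_matrix_vector_mult mexp_continuous],
        rule bounded_linear.continuous_on[OF matrix_vector_mul_bounded_linear ce])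
  have int: "set_integrable lborel {0..r} ?g"
    unfolding set_integrable_def by (rule borel_integrable_compact[OF compact_Icc c])
  have "(\<integral>\<^sup>+s. indicator {0..r} s * ennreal (?g s) \<partial>lborel) = (\<integral>\<^sup>+s. ennreal (indicator {0..r} s * ?g s) \<partial>lborel)"
    by (rule nn_integral_cong) (simp add: indicator_def)
  also have "\<dots> = ennreal (LBINT s:{0..r}. ?g s)"
    unfolding set_lebesgue_integral_def real_scaleR_def
    by (rule nn_integral_eq_integral) (use int nn in \<open>auto simp: set_integrable_def indicator_def\<close>)
  also have "(LBINT s:{0..r}. ?g s) = ?F r - ?F 0"
    by (rule LBINT_FTC[OF r d int])
  finally show ?thesis by simp
qed

context rap_fluid
begin

definition stays_up :: "nat \<Rightarrow> real \<Rightarrow> 'w \<Rightarrow> bool" where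
  "stays_up n t \<omega> \<longleftrightarrow> (\<forall>l\<in>{..n}. isl (Y l \<omega>)) \<and> T n \<omega> \<le> ereal t"

lemma stays_up_measurable [measurable]: "Measurable.pred (H n) (stays_up n t)"
proof -
  have [measurable]: "Measurable.pred (H n) (\<lambda>\<omega>. isl (Y l \<omega>))" if "l \<in> {..n}" for l
    using measurable_compose[OF history_measurable(2)[of l n] isl_measurable] that by simp
  have "Measurable.pred (H n) (\<lambda>\<omega>. \<forall>l\<in>{..n}. isl (Y l \<omega>))"
    by (rule pred_intros_finite(3)) simp_all
  then show ?thesis unfolding stays_up_def by measurable
qed

lemma stays_up_measurable_F [measurable]: "Measurable.pred F (stays_up n t)"
  using measurable_compose[OF id_history stays_up_measurable] by simp

lemma stays_upD: 
  assumes "\<omega> \<in> space F" "stays_up n t \<omega>"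
  shows "T n \<omega> < \<infinity>" "real_of_ereal (T n \<omega>) \<le> t" "\<exists>a. Y n \<omega> = Inl a \<and> a \<in> Up"
proof -
  show "T n \<omega> < \<infinity>" using assms(2) by (auto simp: stays_up_def)
  then show "real_of_ereal (T n \<omega>) \<le> t" 
    using assms(2) T_real[OF assms(1), of n] by (metis ereal_less_eq(3) stays_up_def)
  show "\<exists>a. Y n \<omega> = Inl a \<and> a \<in> Up"
  proof -
    have "isl (Y n \<omega>)" using assms(2) by (auto simp: stays_up_def)
    with Y_states[OF assms(1), of n] show ?thesis by (cases "Y n \<omega>") simp_all
  qed
qed

lemma stays_up_Suc:
  assumes "\<omega> \<in> space F"
  shows "stays_up (Suc n) t \<omega> \<longleftrightarrow> stays_up n t \<omega> \<and> T (Suc n) \<omega> < \<infinity> \<and> 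
    sojourn n \<omega> \<le> t - real_of_ereal (T n \<omega>) \<and> isl (Y (Suc n) \<omega>)"
proof -
  have "T (Suc n) \<omega> \<le> ereal t \<longleftrightarrow> T n \<omega> \<le> ereal t \<and> T (Suc n) \<omega> < \<infinity> \<and> sojourn n \<omega> \<le> t - real_of_ereal (T n \<omega>)"
  proof (cases "T (Suc n) \<omega> < \<infinity>")
    case True
    then obtain a b where "T n \<omega> = ereal a" "T (Suc n) \<omega> = ereal b" 
      using T_real[OF assms] T_Suc_finite[OF assms] by blast
    then show ?thesis using T_le_Suc[OF assms, of n] by (auto simp: sojourn_def)
  qed auto
  then show ?thesis by (auto simp: stays_up_def atMost_Suc)
qed

text \<open>
  On the event that the sign stays \<open>+\<close> and \<open>n\<close> jumps occur by time
  \<open>t\<close>, the functional with vector \<open>e\<^sup>C\<^sup>r 1\<close>, \<open>C =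
  Cp\<close> and \<open>r\<close> the remaining time, splits at the next jump: no jump within
  \<open>r\<close> contributes the flow without jumps, and a jump that keeps the sign
  contributes the same functional one step later.
\<close>
lemma stays_up_expectation_step:
  assumes \<alpha>: "\<alpha> \<in> states" and t: "0 \<le> t"
  defines "q \<equiv> \<lambda>n. \<integral>\<^sup>+\<omega>. indicator {\<omega>. stays_up n t \<omega>} \<omega> * 
      ennreal (pairing (mexp ((t - real_of_ereal (T n \<omega>)) *\<^sub>R Cp) *v 1) 0 (Y n \<omega>)) \<partial>P \<alpha>"
  shows "q n = emeasure (P \<alpha>) {\<omega> \<in> space F. stays_up n t \<omega> \<and> ereal t < T (Suc n) \<omega>} + q (Suc n)"
proof -
  interpret prob_space "P \<alpha>" by (rule prob[OF \<alpha>])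
  note [measurable_cong] = sets_P[OF \<alpha>]
  define L where "L \<omega> = t - real_of_ereal (T n \<omega>)" for \<omega>
  have L[measurable]: "L \<in> borel_measurable (H n)" unfolding L_def by measurable
  have LF[measurable]: "L \<in> borel_measurable F" unfolding L_def by measurable
  define u :: "'w \<Rightarrow> real \<Rightarrow> real^'p" where 
    "u \<omega> s = (if stays_up n t \<omega> \<and> s \<le> L \<omega> then mexp ((L \<omega> - s) *\<^sub>R Cp) *v 1 else 0)" for \<omega> s
  have um: "(\<lambda>x. u (fst x) (snd x)) \<in> borel_measurable (H n \<Otimes>\<^sub>M borel)"
    unfolding u_def by (intro measurable_If borel_measurable_mexp_vector borel_measurable_const) measurable
  have un: "u \<omega> s \<in> nonneg_on Up" for \<omega> s
    unfolding u_def using p.mexp_perturbed_cone_map[OF Gp_cone jump_cones(1), of "L \<omega> - s"] p.one_nonneg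
    by (auto simp: cone_map_def)
  let ?T = "indicator {\<omega>. T n \<omega> < \<infinity>} :: 'w \<Rightarrow> ennreal"
  let ?st = "indicator {\<omega>. stays_up n t \<omega>} :: 'w \<Rightarrow> ennreal"
  have "q (Suc n) = (\<integral>\<^sup>+\<omega>. indicator {\<omega>. T (Suc n) \<omega> < \<infinity>} \<omega> * 
      ennreal (pairing (u \<omega> (sojourn n \<omega>)) 0 (Y (Suc n) \<omega>)) \<partial>P \<alpha>)"
    unfolding q_def
  proof (rule nn_integral_cong)
    fix \<omega> assume "\<omega> \<in> space (P \<alpha>)"
    then have \<omega>: "\<omega> \<in> space F" by (simp add: space_M[OF \<alpha>])
    have "t - real_of_ereal (T (Suc n) \<omega>) = L \<omega> - sojourn n \<omega>" by (simp add: L_def sojourn_def)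
    then show "indicator {\<omega>. stays_up (Suc n) t \<omega>} \<omega> * 
      ennreal (pairing (mexp ((t - real_of_ereal (T (Suc n) \<omega>)) *\<^sub>R Cp) *v 1) 0 (Y (Suc n) \<omega>)) =
      indicator {\<omega>. T (Suc n) \<omega> < \<infinity>} \<omega> * ennreal (pairing (u \<omega> (sojourn n \<omega>)) 0 (Y (Suc n) \<omega>))"
      by (cases "Y (Suc n) \<omega>") (simp_all add: stays_up_Suc[OF \<omega>] u_def L_def[symmetric] indicator_def)
  qed
  also have "\<dots> = (\<integral>\<^sup>+\<omega>. ?T \<omega> * (\<integral>\<^sup>+s. indicator {0..} s *
      ennreal (flux (u \<omega> s) 0 s (Y n \<omega>)) \<partial>lborel) \<partial>P \<alpha>)"
    by (rule one_step_linear[OF \<alpha> um, of "\<lambda>_ _. 0"]) (auto intro: un)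
  finally have qSuc: "q (Suc n) = \<dots>" .
  have "emeasure (P \<alpha>) {\<omega> \<in> space F. stays_up n t \<omega> \<and> ereal t < T (Suc n) \<omega>} = 
      (\<integral>\<^sup>+\<omega>. indicator {\<omega> \<in> space F. stays_up n t \<omega> \<and> ereal t < T (Suc n) \<omega>} \<omega> \<partial>P \<alpha>)"
    by (rule nn_integral_indicator[symmetric]) (simp add: sets_M[OF \<alpha>])
  also have "\<dots> = (\<integral>\<^sup>+\<omega>. ?T \<omega> * indicator {\<omega>. \<not> (T (Suc n) \<omega> < \<infinity> \<and> sojourn n \<omega> \<le> L \<omega>)} \<omega> * 
      ennreal (indicator {\<omega>. stays_up n t \<omega>} \<omega>) \<partial>P \<alpha>)"
  proof (rule nn_integral_cong)
    fix \<omega> assume "\<omega> \<in> space (P \<alpha>)"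
    then have \<omega>: "\<omega> \<in> space F" by (simp add: space_M[OF \<alpha>])
    show "indicator {\<omega> \<in> space F. stays_up n t \<omega> \<and> ereal t < T (Suc n) \<omega>} \<omega> = ?T \<omega> * indicator {\<omega>. \<not> (T (Suc n) \<omega> < \<infinity> \<and> sojourn n \<omega> \<le> L \<omega>)} \<omega> * 
      ennreal (indicator {\<omega>. stays_up n t \<omega>} \<omega>)"
    proof (cases "stays_up n t \<omega>")
      case True
      note fin = stays_upD(1)[OF \<omega> True]
      have "T n \<omega> + ereal (L \<omega>) = ereal t" using T_real[OF \<omega> fin] unfolding L_def by (metis plus_ereal.simps(1) add.commute diff_add_cancel)
      then have "ereal t < T (Suc n) \<omega> \<longleftrightarrow> \<not> (T (Suc n) \<omega> < \<infinity> \<and> sojourn n \<omega> \<le> L \<omega>)"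
        using sojourn_le_iff[OF \<omega> fin, of "L \<omega>"] by (simp add: not_le[symmetric])
      then show ?thesis using True fin \<omega> by (simp add: indicator_def)
    qed simp
  qed
  also have "\<dots> = (\<integral>\<^sup>+\<omega>. ?T \<omega> * ennreal (indicator {\<omega>. stays_up n t \<omega>} \<omega> * survival (Y n \<omega>) (L \<omega>)) \<partial>P \<alpha>)"
  proof (rule no_jump_law[OF \<alpha>, where c=1])
    show "0 \<le> L \<omega>" if "\<omega> \<in> space F" "indicator {\<omega>. stays_up n t \<omega>} \<omega> \<noteq> (0::real)" for \<omega>
      using stays_upD(2)[of \<omega> n t] that by (simp add: L_def indicator_eq_0_iff)
  qed (simp_all add: indicator_le_1)
  finally have stop: "emeasure (P \<alpha>) {\<omega> \<in> space F. stays_up n t \<omega> \<and> ereal t < T (Suc n) \<omega>} = \<dots>" .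
  let ?d = "\<lambda>\<omega>. pairing (mexp (L \<omega> *\<^sub>R Cp) *v 1 - mexp (L \<omega> *\<^sub>R Gp) *v 1) 0 (Y n \<omega>)"
  let ?e = "\<lambda>\<omega>. ?T \<omega> * ennreal (indicator {\<omega>. stays_up n t \<omega>} \<omega> * survival (Y n \<omega>) (L \<omega>))"
  have "q (Suc n) = (\<integral>\<^sup>+\<omega>. ?st \<omega> * ennreal (?d \<omega>) \<partial>P \<alpha>)"
    unfolding qSuc
  proof (rule nn_integral_cong)
    fix \<omega> assume "\<omega> \<in> space (P \<alpha>)"
    then have \<omega>: "\<omega> \<in> space F" by (simp add: space_M[OF \<alpha>])
    show "?T \<omega> * (\<integral>\<^sup>+s. indicator {0..} s *
        ennreal (flux (u \<omega> s) 0 s (Y n \<omega>)) \<partial>lborel) = ?st \<omega> * ennreal (?d \<omega>)"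
    proof (cases "stays_up n t \<omega>")
      case True
      note fin = stays_upD(1)[OF \<omega> True] 
      obtain a where a: "Y n \<omega> = Inl a" "a \<in> Up" using stays_upD(3)[OF \<omega> True] by blast
      have L0: "0 \<le> L \<omega>" using stays_upD(2)[OF \<omega> True] by (simp add: L_def)
      let ?g = "\<lambda>s. a \<bullet> (mexp (s *\<^sub>R Gp) *v ((Cp - Gp) *v (mexp ((L \<omega> - s) *\<^sub>R Cp) *v 1)))"
      have c: "cone_map Up Up (mexp (s *\<^sub>R Cp))" if "0 \<le> s" for s
        using p.mexp_perturbed_cone_map[OF Gp_cone jump_cones(1) that] by simp
      have nn: "0 \<le> ?g s" if "s \<in> {0..L \<omega>}" for s
        using that by (intro nonneg_onD[OF _ a(2)] cone_mapD[OF Gp_cone] cone_mapD[OF jump_cones(1)] cone_mapD[OF c]) auto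
      have "(\<integral>\<^sup>+s. indicator {0..} s * ennreal (flux (u \<omega> s) 0 s (Y n \<omega>)) \<partial>lborel) =
          (\<integral>\<^sup>+s. indicator {0..L \<omega>} s * ennreal (?g s) \<partial>lborel)"
      proof (rule nn_integral_cong)
        fix s
        have "mexp (s *\<^sub>R Gp) *v ((Cp - Gp) *v u \<omega> s + Dpm *v 0) = 
            (if s \<le> L \<omega> then mexp (s *\<^sub>R Gp) *v ((Cp - Gp) *v (mexp ((L \<omega> - s) *\<^sub>R Cp) *v 1)) else 0)"
          using True by (cases "s \<le> L \<omega>") (simp_all only: u_def mult_linear_simps(20) if_True if_False simp_thms add_0_right)
        then show "indicator {0..} s * ennreal (flux (u \<omega> s) 0 s (Y n \<omega>)) = indicator {0..L \<omega>} s * ennreal (?g s)"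
          by (cases "s \<le> L \<omega>") (simp_all only: a pairing_simps if_True if_False simp_thms inner_zero_right ennreal_0 
              indicator_def atLeast_iff atLeastAtMost_iff mult_zero_right mult_zero_left of_bool_eq)
      qed
      also have "\<dots> = ennreal (a \<bullet> (mexp (L \<omega> *\<^sub>R Cp) *v 1) - a \<bullet> (mexp (L \<omega> *\<^sub>R Gp) *v 1))"
        by (rule duhamel_integral[OF L0 nn])
      also have "\<dots> = ennreal (?d \<omega>)" by (simp add: a inner_diff_right)
      finally show ?thesis using True fin by (simp only: indicator_simps mem_Collect_eq mult_1)
    next
      case False
      then have "u \<omega> s = 0" for s by (simp add: u_def)
      moreover have "pairing 0 0 (Y n \<omega>) = 0" by (cases "Y n \<omega>") auto
      ultimately show ?thesis using False by (simp add: mult_linear_simps)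
    qed
  qed
  moreover have "q n = (\<integral>\<^sup>+\<omega>. ?e \<omega> + ?st \<omega> * ennreal (?d \<omega>) \<partial>P \<alpha>)"
    unfolding q_def
  proof (rule nn_integral_cong)
    fix \<omega> assume "\<omega> \<in> space (P \<alpha>)"
    then have \<omega>: "\<omega> \<in> space F" by (simp add: space_M[OF \<alpha>])
    show "?st \<omega> * ennreal (pairing (mexp ((t - real_of_ereal (T n \<omega>)) *\<^sub>R Cp) *v 1) 0 (Y n \<omega>)) = ?e \<omega> + ?st \<omega> * ennreal (?d \<omega>)"
    proof (cases "stays_up n t \<omega>")
      case True
      note fin = stays_upD(1)[OF \<omega> True] 
      obtain a where a: "Y n \<omega> = Inl a" "a \<in> Up" using stays_upD(3)[OF \<omega> True] by blast
      have L0: "0 \<le> L \<omega>" using stays_upD(2)[OF \<omega> True] by (simp add: L_def)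
      have 1: "0 \<le> a \<bullet> (mexp (L \<omega> *\<^sub>R Gp) *v 1)" 
        by (rule nonneg_onD[OF cone_mapD[OF Gp_cone[OF L0] p.one_nonneg] a(2)])
      have 2: "0 \<le> a \<bullet> (mexp (L \<omega> *\<^sub>R Cp) *v 1 - mexp (L \<omega> *\<^sub>R Gp) *v 1)"
        using nonneg_onD[OF p.mexp_perturbed_mono[OF Gp_cone jump_cones(1) L0 p.one_nonneg] a(2)] by simp
      have "ennreal (a \<bullet> (mexp (L \<omega> *\<^sub>R Cp) *v 1)) = 
          ennreal (a \<bullet> (mexp (L \<omega> *\<^sub>R Gp) *v 1)) + ennreal (a \<bullet> (mexp (L \<omega> *\<^sub>R Cp) *v 1 - mexp (L \<omega> *\<^sub>R Gp) *v 1))"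
        unfolding ennreal_plus[OF 1 2, symmetric] by (simp add: inner_diff_right)
      then show ?thesis using True fin
        by (simp only: a pairing_simps survival_def indicator_simps mem_Collect_eq mult_1 L_def[symmetric])
    next
      case False
      then show ?thesis by simp
    qed
  qed
  moreover have "(\<integral>\<^sup>+\<omega>. ?e \<omega> + ?st \<omega> * ennreal (?d \<omega>) \<partial>P \<alpha>) = 
      (\<integral>\<^sup>+\<omega>. ?e \<omega> \<partial>P \<alpha>) + (\<integral>\<^sup>+\<omega>. ?st \<omega> * ennreal (?d \<omega>) \<partial>P \<alpha>)"
    by (rule nn_integral_add) measurable
  ultimately show ?thesis unfolding stop by (simp only:)
qed

lemma stays_up_paths:
  assumes "\<omega> \<in> space F" "0 \<le> t"
  shows "(\<forall>s\<in>{0..t}. A s \<omega> \<in> Inl ` Up) \<longleftrightarrow> (\<exists>n. stays_up n t \<omega> \<and> ereal t < T (Suc n) \<omega>)"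
proof
  assume *: "\<forall>s\<in>{0..t}. A s \<omega> \<in> Inl ` Up"
  obtain n where n: "T n \<omega> \<le> ereal t" "ereal t < T (Suc n) \<omega>" using jump_interval[OF assms] by blast
  have "isl (Y l \<omega>)" if "l \<le> n" for l
  proof -
    have "T l \<omega> \<le> ereal t" using T_mono[OF assms(1) that] n(1) by simp
    moreover from this have "T l \<omega> < \<infinity>" by auto
    ultimately have "real_of_ereal (T l \<omega>) \<in> {0..t}"
      using T_real[OF assms(1)] T_nonneg[OF assms(1), of l] by (metis atLeastAtMost_iff ereal_less_eq(3) zero_ereal_def)
    then have "Y l \<omega> \<in> Inl ` Up" using * by (simp add: post_jump_def)
    then show ?thesis by auto
  qed
  then show "\<exists>n. stays_up n t \<omega> \<and> ereal t < T (Suc n) \<omega>" using n by (auto simp: stays_up_def)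
next
  assume "\<exists>n. stays_up n t \<omega> \<and> ereal t < T (Suc n) \<omega>"
  then obtain n where n: "stays_up n t \<omega>" "ereal t < T (Suc n) \<omega>" by blast
  show "\<forall>s\<in>{0..t}. A s \<omega> \<in> Inl ` Up"
  proof
    fix s assume s: "s \<in> {0..t}"
    then have s0: "0 \<le> s" by simp
    obtain m where m: "T m \<omega> \<le> ereal s" "ereal s < T (Suc m) \<omega>" using jump_interval[OF assms(1) s0] by blast
    have "m \<le> n"
    proof (rule ccontr)
      assume "\<not> m \<le> n"
      then have "T (Suc n) \<omega> \<le> T m \<omega>" using T_mono[OF assms(1), of "Suc n" m] by simp
      also have "\<dots> \<le> ereal t" using m(1) s by (metis atLeastAtMost_iff ereal_less_eq(3) order_trans)
      finally show False using n(2) by simp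
    qed
    then have "isl (A s \<omega>)" using n(1) A_between(1)[OF assms(1) m] by (auto simp: stays_up_def)
    moreover have "A s \<omega> \<in> states" by (rule A_in_states[OF s0 assms(1)])
    ultimately show "A s \<omega> \<in> Inl ` Up" by (auto elim!: states_cases)
  qed
qed

lemma stays_up_disjoint: "disjoint_family (\<lambda>n. {\<omega> \<in> space F. stays_up n t \<omega> \<and> ereal t < T (Suc n) \<omega>})"
proof -
  have "\<not> (stays_up m t \<omega> \<and> ereal t < T (Suc n) \<omega>)" if "n < m" "\<omega> \<in> space F" for m n \<omega>
  proof
    assume *: "stays_up m t \<omega> \<and> ereal t < T (Suc n) \<omega>"
    have "T (Suc n) \<omega> \<le> T m \<omega>" by (rule T_mono) (use that in auto)
    also have "\<dots> \<le> ereal t" using * by (simp add: stays_up_def)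
    finally show False using * by (meson leD)
  qed
  then show ?thesis unfolding disjoint_family_on_def by (auto) (metis linorder_neqE_nat)+
qed

text \<open>
  Summing the steps telescopes. What remains after \<open>N\<close> steps is at most a constant
  times the probability of \<open>T N \<le> t\<close>, which tends to \<open>0\<close> as the
  jump times tend to \<open>\<infinity>\<close>.
\<close>
lemma staying_up_probability:
  assumes a: "a \<in> Up" and t: "0 \<le> t"
  shows "a \<bullet> (mexp (t *\<^sub>R Cp) *v 1) \<le> measure (P (Inl a)) {\<omega> \<in> space F. \<forall>s\<in>{0..t}. A s \<omega> \<in> Inl ` Up}"
proof -
  have \<alpha>: "Inl a \<in> states" using a by simp
  interpret prob_space "P (Inl a)" by (rule prob[OF \<alpha>])
  note [measurable_cong] = sets_P[OF \<alpha>]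
  define q where "q n = (\<integral>\<^sup>+\<omega>. indicator {\<omega>. stays_up n t \<omega>} \<omega> * 
      ennreal (pairing (mexp ((t - real_of_ereal (T n \<omega>)) *\<^sub>R Cp) *v 1) 0 (Y n \<omega>)) \<partial>P (Inl a))" for n
  let ?S = "\<lambda>n. {\<omega> \<in> space F. stays_up n t \<omega> \<and> ereal t < T (Suc n) \<omega>}"
  let ?E = "{\<omega> \<in> space F. \<forall>s\<in>{0..t}. A s \<omega> \<in> Inl ` Up}"
  have SF: "?S n \<in> sets (P (Inl a))" for n by (simp add: sets_M[OF \<alpha>])
  have E: "?E = (\<Union>n. ?S n)" 
  proof (rule set_eqI)
    fix \<omega> show "\<omega> \<in> ?E \<longleftrightarrow> \<omega> \<in> (\<Union>n. ?S n)" using stays_up_paths[OF _ t, of \<omega>] by blast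
  qed
  have EF: "?E \<in> sets (P (Inl a))" unfolding E using SF by blast
  have q0: "q 0 = ennreal (a \<bullet> (mexp (t *\<^sub>R Cp) *v 1))"
  proof -
    have "q 0 = (\<integral>\<^sup>+\<omega>. ennreal (a \<bullet> (mexp (t *\<^sub>R Cp) *v 1)) \<partial>P (Inl a))"
      unfolding q_def
    proof (rule nn_integral_cong_AE)
      show "AE \<omega> in P (Inl a). indicator {\<omega>. stays_up 0 t \<omega>} \<omega> * 
        ennreal (pairing (mexp ((t - real_of_ereal (T 0 \<omega>)) *\<^sub>R Cp) *v 1) 0 (Y 0 \<omega>)) = ennreal (a \<bullet> (mexp (t *\<^sub>R Cp) *v 1))"
        using start[OF \<alpha>] AE_space
      proof eventually_elim
        case (elim \<omega>)
        then have "\<omega> \<in> space F" by (simp add: space_M[OF \<alpha>])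
        then show ?case using elim(1) T_0[of \<omega>] t by (simp add: stays_up_def post_jump_def)
      qed
    qed
    then show ?thesis by (simp add: emeasure_space_1 del: space_M)
  qed
  have sum: "q 0 = (\<Sum>n<N. emeasure (P (Inl a)) (?S n)) + q N" for N
  proof (induction N)
    case (Suc N)
    then show ?case using stays_up_expectation_step[OF \<alpha> t, of N, folded q_def] by (simp add: add.assoc)
  qed simp
  have sumE: "(\<Sum>n<N. emeasure (P (Inl a)) (?S n)) \<le> emeasure (P (Inl a)) ?E" for N
  proof -
    have "(\<Sum>n<N. emeasure (P (Inl a)) (?S n)) = emeasure (P (Inl a)) (\<Union>n<N. ?S n)"
      by (rule sum_emeasure) (use SF stays_up_disjoint in \<open>auto intro: disjoint_family_on_mono\<close>)
    also have "\<dots> \<le> emeasure (P (Inl a)) ?E" by (rule emeasure_mono[OF _ EF]) (auto simp: E)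
    finally show ?thesis .
  qed
  obtain L where L: "L > 0" "\<And>z v. z \<in> Up \<Longrightarrow> \<bar>z \<bullet> v\<bar> \<le> L * norm v" using p.inner_bound by blast
  have "bounded ((\<lambda>s. mexp (s *\<^sub>R Cp) *v 1) ` {0..t})"
    by (intro compact_imp_bounded compact_continuous_image mexp_vector_continuous) auto
  then obtain c where c: "c > 0" "\<And>s. s \<in> {0..t} \<Longrightarrow> norm (mexp (s *\<^sub>R Cp) *v 1) \<le> c"
    by (auto simp: bounded_pos)
  let ?R = "\<lambda>N. {\<omega> \<in> space F. T N \<omega> \<le> ereal t}"
  have qle: "q N \<le> ennreal (L * c) * emeasure (P (Inl a)) (?R N)" for N
  proof -
    have "q N \<le> (\<integral>\<^sup>+\<omega>. ennreal (L * c) * indicator (?R N) \<omega> \<partial>P (Inl a))"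
      unfolding q_def
    proof (rule nn_integral_mono)
      fix \<omega> assume "\<omega> \<in> space (P (Inl a))"
      then have \<omega>: "\<omega> \<in> space F" by (simp add: space_M[OF \<alpha>])
      show "indicator {\<omega>. stays_up N t \<omega>} \<omega> * ennreal (pairing (mexp ((t - real_of_ereal (T N \<omega>)) *\<^sub>R Cp) *v 1) 0 (Y N \<omega>))
          \<le> ennreal (L * c) * indicator (?R N) \<omega>"
      proof (cases "stays_up N t \<omega>")
        case True
        obtain b where b: "Y N \<omega> = Inl b" "b \<in> Up" using stays_upD(3)[OF \<omega> True] by blast
        have "t - real_of_ereal (T N \<omega>) \<in> {0..t}" 
          using stays_upD(2)[OF \<omega> True] T_nonneg[OF \<omega>, of N] by (simp add: real_of_ereal_pos)
        then have "b \<bullet> (mexp ((t - real_of_ereal (T N \<omega>)) *\<^sub>R Cp) *v 1) \<le> L * c"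
          using L c by (intro order_trans[OF abs_ge_self order_trans[OF L(2)[OF b(2)] mult_left_mono]]) auto
        then show ?thesis using True \<omega> by (simp add: b stays_up_def ennreal_leI)
      qed simp
    qed
    also have "\<dots> = ennreal (L * c) * emeasure (P (Inl a)) (?R N)"
      by (rule nn_integral_cmult_indicator) (simp add: sets_M[OF \<alpha>])
    finally show ?thesis .
  qed
  have "(\<lambda>N. measure (P (Inl a)) (?R N)) \<longlonglongrightarrow> measure (P (Inl a)) (\<Inter>N. ?R N)"
  proof (rule finite_Lim_measure_decseq)
    show "range ?R \<subseteq> sets (P (Inl a))" by (auto simp: sets_M[OF \<alpha>])
    show "decseq ?R" unfolding decseq_def using T_mono by (blast intro: order_trans)
  qed
  also have "(\<Inter>N. ?R N) = {}"
  proof -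
    have "\<exists>N. \<not> T N \<omega> \<le> ereal t" if \<omega>: "\<omega> \<in> space F" for \<omega>
    proof -
      obtain n where "ereal t < T (Suc n) \<omega>" using jump_interval[OF \<omega> t] by blast
      then show ?thesis by (intro exI[of _ "Suc n"]) simp
    qed
    then show ?thesis by blast
  qed
  finally have lim: "(\<lambda>N. measure (P (Inl a)) (?R N)) \<longlonglongrightarrow> 0" by simp
  have "a \<bullet> (mexp (t *\<^sub>R Cp) *v 1) \<le> measure (P (Inl a)) ?E + L * c * measure (P (Inl a)) (?R N)" for N
  proof -
    have "ennreal (a \<bullet> (mexp (t *\<^sub>R Cp) *v 1)) \<le> emeasure (P (Inl a)) ?E + ennreal (L * c) * emeasure (P (Inl a)) (?R N)"
      unfolding q0[symmetric] sum[of N] by (intro add_mono sumE qle)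
    also have "\<dots> = ennreal (measure (P (Inl a)) ?E + L * c * measure (P (Inl a)) (?R N))"
      using L c by (simp add: emeasure_eq_measure ennreal_mult'[symmetric])
    finally show ?thesis using L c by (subst (asm) ennreal_le_iff) auto
  qed
  moreover have "(\<lambda>N. measure (P (Inl a)) ?E + L * c * measure (P (Inl a)) (?R N)) \<longlonglongrightarrow> measure (P (Inl a)) ?E + L * c * 0"
    by (intro tendsto_intros lim)
  ultimately show ?thesis by (intro LIMSEQ_le_const[of _ "measure (P (Inl a)) ?E"]) auto
qed

lemma Cp_vanishes: "((\<lambda>t. mexp (t *\<^sub>R Cp) *v 1) \<longlongrightarrow> 0) at_top"
proof (rule p.tendsto_of_inner)
  fix a assume a: "a \<in> Up"
  have c: "cone_map Up Up (mexp (s *\<^sub>R Cp))" if "0 \<le> s" for s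
    using p.mexp_perturbed_cone_map[OF Gp_cone jump_cones(1) that] by simp
  show "((\<lambda>t. a \<bullet> (mexp (t *\<^sub>R Cp) *v 1)) \<longlongrightarrow> a \<bullet> 0) at_top"
    unfolding inner_zero_right
  proof (rule tendsto_sandwich[OF _ _ tendsto_const nontrivial_p[OF a]])
    show "\<forall>\<^sub>F t in at_top. 0 \<le> a \<bullet> (mexp (t *\<^sub>R Cp) *v 1)"
      using eventually_ge_at_top[of 0]
      by eventually_elim (rule nonneg_onD[OF cone_mapD[OF c p.one_nonneg] a])
    show "\<forall>\<^sub>F t in at_top. a \<bullet> (mexp (t *\<^sub>R Cp) *v 1) \<le> measure (P (Inl a)) {\<omega> \<in> space F. \<forall>s\<in>{0..t}. A s \<omega> \<in> Inl ` Up}"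
      using eventually_ge_at_top[of 0] by eventually_elim (rule staying_up_probability[OF a])
  qed
qed

sublocale fc: fluid_cones Up Um Gp Cp Gm Cm Dpm Dmp
  by unfold_locales (use Gp_cone Gm_cone jump_cones row_sums_p row_sums_m Cp_vanishes in auto)

end

section \<open>First passage through the jump chain\<close>

lemma nn_integral_translate:
  fixes f :: "real \<Rightarrow> real"
  assumes [measurable]: "f \<in> borel_measurable borel"
  shows "(\<integral>\<^sup>+s. ennreal (indicator {r..} s * f s) \<partial>lborel) = (\<integral>\<^sup>+s. indicator {0..} s * ennreal (f (r + s)) \<partial>lborel)"
proof -
  have "(\<integral>\<^sup>+s. ennreal (indicator {r..} s * f s) \<partial>lborel) = ennreal \<bar>1\<bar> * (\<integral>\<^sup>+s. ennreal (indicator {r..} (r + 1 * s) * f (r + 1 * s)) \<partial>lborel)"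
    by (rule nn_integral_real_affine[where f="\<lambda>s. ennreal (indicator {r..} s * f s)" and t=r and c=1]) simp_all
  also have "\<dots> = (\<integral>\<^sup>+s. indicator {0..} s * ennreal (f (r + s)) \<partial>lborel)"
    by (simp only: abs_one ennreal_1 mult_1, rule nn_integral_cong) (simp add: indicator_def)
  finally show ?thesis .
qed

lemma nn_integral_reflect:
  fixes f :: "real \<Rightarrow> real"
  assumes [measurable]: "f \<in> borel_measurable borel"
  shows "(\<integral>\<^sup>+s. ennreal (indicator {0..r} s * f s) \<partial>lborel) = (\<integral>\<^sup>+s. indicator {0..r} s * ennreal (f (r - s)) \<partial>lborel)"
proof -
  have "(\<integral>\<^sup>+s. ennreal (indicator {0..r} s * f s) \<partial>lborel) = ennreal \<bar>-1\<bar> * (\<integral>\<^sup>+s. ennreal (indicator {0..r} (r + (-1) * s) * f (r + (-1) * s)) \<partial>lborel)"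
    by (rule nn_integral_real_affine[where f="\<lambda>s. ennreal (indicator {0..r} s * f s)" and t=r and c="-1"]) simp_all
  also have "\<dots> = (\<integral>\<^sup>+s. indicator {0..r} s * ennreal (f (r - s)) \<partial>lborel)"
    by (simp only: abs_minus_cancel abs_one ennreal_1 mult_1, rule nn_integral_cong) (simp add: indicator_def)
  finally show ?thesis .
qed

context fluid_cones
begin

text \<open>
  The recursion of the iterates in the variable of the one-step law, the time until the next
  jump.
\<close>
lemma up_Suc_nn_integral:
  assumes h: "h \<in> nonneg_on Zm" and a: "a \<in> Zp" and r: "0 \<le> r"
  shows "ennreal (a \<bullet> up h (Suc k) r) = (\<integral>\<^sup>+s. indicator {0..} s * 
    ennreal (a \<bullet> (mexp (s *\<^sub>R Gp) *v gain_p (up h k (r + s)) (down h k (r + s)))) \<partial>lborel)"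
proof -
  let ?g = "\<lambda>s. mexp ((s - r) *\<^sub>R Gp) *v gain_p (up h k s) (down h k s)"
  obtain D where D: "\<forall>k s. s \<ge> 0 \<longrightarrow> norm (gain_p (up h k s) (down h k s)) \<le> D \<and> norm (gain_m (up h k s) (down h k s)) \<le> D"
    using passage_gain_bounded[OF h] ..
  have int: "set_integrable lborel {r..} ?g"
    by (rule convolution_integrable_p[of "\<lambda>s. gain_p (up h k s) (down h k s)" D r]) (use r D in auto)
  have nn: "0 \<le> a \<bullet> ?g s" if "r \<le> s" for s
    using that r by (intro nonneg_onD[OF _ a] cone_mapD[OF Gp_cone] gain_nonneg passage_nonneg h) auto
  have "ennreal (a \<bullet> up h (Suc k) r) = ennreal (LBINT s:{r..}. a \<bullet> ?g s)"
    by (simp only: up_Suc inner_set_integral(1)[OF int])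
  also have "\<dots> = (\<integral>\<^sup>+s. ennreal (indicator {r..} s * (a \<bullet> ?g s)) \<partial>lborel)"
    unfolding set_lebesgue_integral_def real_scaleR_def
  proof (rule nn_integral_eq_integral[symmetric])
    show "integrable lborel (\<lambda>s. indicator {r..} s * (a \<bullet> ?g s))"
      using inner_set_integral(2)[OF int, of a] unfolding set_integrable_def real_scaleR_def .
    show "AE s in lborel. 0 \<le> indicator {r..} s * (a \<bullet> ?g s)"
      by (rule AE_I2) (use nn in \<open>simp add: indicator_def\<close>)
  qed
  also have "\<dots> = (\<integral>\<^sup>+s. indicator {0..} s * ennreal (a \<bullet> ?g (r + s)) \<partial>lborel)"
    by (rule nn_integral_translate[of "\<lambda>s. a \<bullet> ?g s" r], rule borel_measurable_inner) measurable
  finally show ?thesis by (simp only: add_diff_cancel_left')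
qed

lemma down_Suc_nn_integral:
  assumes h: "h \<in> nonneg_on Zm" and b: "b \<in> Zm" and r: "0 \<le> r"
  shows "ennreal (b \<bullet> down h (Suc k) r) = ennreal (b \<bullet> (mexp (r *\<^sub>R Gm) *v h)) + (\<integral>\<^sup>+s. indicator {0..r} s * 
    ennreal (b \<bullet> (mexp (s *\<^sub>R Gm) *v gain_m (up h k (r - s)) (down h k (r - s)))) \<partial>lborel)"
proof -
  let ?g = "\<lambda>s. mexp ((r - s) *\<^sub>R Gm) *v gain_m (up h k s) (down h k s)"
  obtain D where D: "\<forall>k s. s \<ge> 0 \<longrightarrow> norm (gain_p (up h k s) (down h k s)) \<le> D \<and> norm (gain_m (up h k s) (down h k s)) \<le> D"
    using passage_gain_bounded[OF h] ..
  have int: "set_integrable lborel {0..r} ?g"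
    by (rule convolution_integrable_m[of "\<lambda>s. gain_m (up h k s) (down h k s)" D r]) (use D in auto)
  have nn: "0 \<le> b \<bullet> ?g s" if "0 \<le> s" "s \<le> r" for s
    using that r by (intro nonneg_onD[OF _ b] cone_mapD[OF Gm_cone] gain_nonneg passage_nonneg h) auto
  have 1: "0 \<le> b \<bullet> (mexp (r *\<^sub>R Gm) *v h)"
    by (rule nonneg_onD[OF cone_mapD[OF Gm_cone[OF r] h] b])
  have 2: "0 \<le> (LBINT s:{0..r}. b \<bullet> ?g s)"
    unfolding set_lebesgue_integral_def 
    by (rule Bochner_Integration.integral_nonneg) (use nn in \<open>simp add: indicator_def\<close>)
  have "b \<bullet> down h (Suc k) r = b \<bullet> (mexp (r *\<^sub>R Gm) *v h) + (LBINT s:{0..r}. b \<bullet> ?g s)"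
    by (simp only: down_Suc inner_add_right inner_set_integral(1)[OF int])
  then have "ennreal (b \<bullet> down h (Suc k) r) = ennreal (b \<bullet> (mexp (r *\<^sub>R Gm) *v h)) + ennreal (LBINT s:{0..r}. b \<bullet> ?g s)"
    by (simp only: ennreal_plus[OF 1 2])
  also have "ennreal (LBINT s:{0..r}. b \<bullet> ?g s) = (\<integral>\<^sup>+s. ennreal (indicator {0..r} s * (b \<bullet> ?g s)) \<partial>lborel)"
    unfolding set_lebesgue_integral_def real_scaleR_def
  proof (rule nn_integral_eq_integral[symmetric])
    show "integrable lborel (\<lambda>s. indicator {0..r} s * (b \<bullet> ?g s))"
      using inner_set_integral(2)[OF int, of b] unfolding set_integrable_def real_scaleR_def .
    show "AE s in lborel. 0 \<le> indicator {0..r} s * (b \<bullet> ?g s)"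
      by (rule AE_I2) (use nn in \<open>simp add: indicator_def\<close>)
  qed
  also have "\<dots> = (\<integral>\<^sup>+s. indicator {0..r} s * ennreal (b \<bullet> ?g (r - s)) \<partial>lborel)"
    by (rule nn_integral_reflect[of "\<lambda>s. b \<bullet> ?g s" r], rule borel_measurable_inner) measurable
  finally show ?thesis by (simp only: diff_diff_eq2 add_diff_cancel_left')
qed

end

context rap_fluid
begin

abbreviation "up h k \<equiv> fst (fc.passage h k)"
abbreviation "down h k \<equiv> snd (fc.passage h k)"

text \<open>
  The height above level \<open>- x\<close> at the \<open>n\<close>-th jump time, see
  \<open>level_height\<close>.
\<close>
primrec height :: "real \<Rightarrow> nat \<Rightarrow> 'w \<Rightarrow> real" where
  "height x 0 \<omega> = x"
| "height x (Suc n) \<omega> = height x n \<omega> + (if isl (Y n \<omega>) then sojourn n \<omega> else - sojourn n \<omega>)"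

text \<open>
  The \<open>n\<close>-th jump occurs, and level \<open>- x\<close> has not been reached in a
  downward state before it. If the level is reached exactly at a jump time, the passage is
  decided by the state after that jump; hence the weak inequality.
\<close>
primrec alive :: "real \<Rightarrow> nat \<Rightarrow> 'w \<Rightarrow> bool" where
  "alive x 0 \<omega> \<longleftrightarrow> True"
| "alive x (Suc n) \<omega> \<longleftrightarrow> alive x n \<omega> \<and> T (Suc n) \<omega> < \<infinity> \<and> (isl (Y n \<omega>) \<or> sojourn n \<omega> \<le> height x n \<omega>)"

definition hits :: "real \<Rightarrow> nat \<Rightarrow> 'w \<Rightarrow> bool" where
  "hits x n \<omega> \<longleftrightarrow> alive x n \<omega> \<and> \<not> isl (Y n \<omega>) \<and> \<not> (T (Suc n) \<omega> < \<infinity> \<and> sojourn n \<omega> \<le> height x n \<omega>)"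

lemma sojourn_measurable_H: "Suc m \<le> n \<Longrightarrow> sojourn m \<in> borel_measurable (H n)"
  unfolding sojourn_def using history_measurable(1)[of m n] history_measurable(1)[of "Suc m" n] by simp

lemma height_measurable_H: "m \<le> n \<Longrightarrow> height x m \<in> borel_measurable (H n)"
proof (induction m)
  case (Suc m)
  then have [measurable]: "height x m \<in> borel_measurable (H n)" "sojourn m \<in> borel_measurable (H n)" "Y m \<in> H n \<rightarrow>\<^sub>M sum_borel"
    using sojourn_measurable_H[of m n] history_measurable(2)[of m n] by auto
  show ?case unfolding height.simps by measurable
qed (simp add: height.simps(1)[abs_def])

lemma alive_measurable_H: "m \<le> n \<Longrightarrow> Measurable.pred (H n) (alive x m)"
proof (induction m)
  case (Suc m)
  then have [measurable]: "height x m \<in> borel_measurable (H n)" "sojourn m \<in> borel_measurable (H n)" 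
      "Y m \<in> H n \<rightarrow>\<^sub>M sum_borel" "Measurable.pred (H n) (alive x m)" "T (Suc m) \<in> borel_measurable (H n)"
    using sojourn_measurable_H[of m n] height_measurable_H[of m n x] history_measurable[of m n] history_measurable(1)[of "Suc m" n] by auto
  show ?case unfolding alive.simps by measurable
qed (simp add: alive.simps(1)[abs_def])

lemma height_measurable [measurable]: "height x n \<in> borel_measurable (H n)"
  and alive_measurable [measurable]: "Measurable.pred (H n) (alive x n)"
  by (rule height_measurable_H alive_measurable_H, simp)+

lemma height_measurable_F [measurable]: "height x n \<in> borel_measurable F"
  and alive_measurable_F [measurable]: "Measurable.pred F (alive x n)"
  using measurable_compose[OF id_history height_measurable] measurable_compose[OF id_history alive_measurable] by simp_all

lemma hits_measurable_F [measurable]: "Measurable.pred F (hits x n)"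
  unfolding hits_def by measurable

lemma alive_finite: "\<omega> \<in> space F \<Longrightarrow> alive x n \<omega> \<Longrightarrow> T n \<omega> < \<infinity>"
  by (cases n) (auto simp: T_0)

lemma alive_height: 
  assumes "\<omega> \<in> space F" "0 \<le> x" 
  shows "alive x n \<omega> \<Longrightarrow> 0 \<le> height x n \<omega>"
proof (induction n)
  case (Suc n)
  then show ?case using sojourn_pos[OF assms(1), of n] by auto
qed (use assms in simp)


text \<open>
  The conditional expectation, given the history up to the \<open>n\<close>-th jump, of
  \<open>h\<close> at the passage if it happens within the next \<open>k\<close> sojourns.
\<close>
definition passage_value :: "real \<Rightarrow> real^'m \<Rightarrow> nat \<Rightarrow> nat \<Rightarrow> 'w \<Rightarrow> ennreal" where
  "passage_value x h k n \<omega> = indicator {\<omega>. alive x n \<omega>} \<omega> * 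
    ennreal (pairing (up h k (height x n \<omega>)) (down h k (height x n \<omega>)) (Y n \<omega>))"

definition hit_value :: "real \<Rightarrow> real^'m \<Rightarrow> nat \<Rightarrow> 'w \<Rightarrow> ennreal" where
  "hit_value x h n \<omega> = indicator {\<omega>. hits x n \<omega>} \<omega> * ennreal (rpart (flw (Y n \<omega>) (height x n \<omega>)) \<bullet> h)"

text \<open>
  Splitting at the next jump. A passage before it is covered by \<open>no_jump_law\<close> with
  \<open>\<phi>\<close> the value of \<open>h\<close> at the passage; the rest is the linear
  one-step law with the iterates at the height after the next sojourn as coefficients. Both add
  up to the recursion of the iterates.
\<close>
lemma passage_value_step:
  assumes \<alpha>: "\<alpha> \<in> states" and x: "0 \<le> x" and h: "h \<in> nonneg_on Um"
  shows "(\<integral>\<^sup>+\<omega>. passage_value x h (Suc k) n \<omega> \<partial>P \<alpha>) = (\<integral>\<^sup>+\<omega>. hit_value x h n \<omega> \<partial>P \<alpha>) + (\<integral>\<^sup>+\<omega>. passage_value x h k (Suc n) \<omega> \<partial>P \<alpha>)"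
proof -
  interpret prob_space "P \<alpha>" by (rule prob[OF \<alpha>])
  note [measurable_cong] = sets_P[OF \<alpha>]
  note [measurable] = fc.passage_measurable
  let ?L = "height x n"
  \<comment> \<open>\<open>act\<close>: the passage does not happen within the next \<open>s\<close> time units;
     \<open>nxt\<close>: the height after them.\<close>
  define act where "act \<omega> s \<longleftrightarrow> alive x n \<omega> \<and> 0 \<le> s \<and> (isl (Y n \<omega>) \<or> s \<le> ?L \<omega>)" for \<omega> s
  define nxt where "nxt \<omega> s = (if isl (Y n \<omega>) then ?L \<omega> + s else ?L \<omega> - s)" for \<omega> s
  define u :: "'w \<Rightarrow> real \<Rightarrow> real^'p" where "u \<omega> s = (if act \<omega> s then up h k (nxt \<omega> s) else 0)" for \<omega> s
  define v :: "'w \<Rightarrow> real \<Rightarrow> real^'m" where "v \<omega> s = (if act \<omega> s then down h k (nxt \<omega> s) else 0)" for \<omega> s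
  have [measurable]: "Measurable.pred (H n \<Otimes>\<^sub>M borel) (\<lambda>y. act (fst y) (snd y))" unfolding act_def by measurable
  have [measurable]: "(\<lambda>y. nxt (fst y) (snd y)) \<in> borel_measurable (H n \<Otimes>\<^sub>M borel)" unfolding nxt_def by measurable
  have um: "(\<lambda>y. u (fst y) (snd y)) \<in> borel_measurable (H n \<Otimes>\<^sub>M borel)"
    unfolding u_def by (intro measurable_If borel_measurable_const measurable_compose[OF _ fc.passage_measurable(1)]) measurable
  have vm: "(\<lambda>y. v (fst y) (snd y)) \<in> borel_measurable (H n \<Otimes>\<^sub>M borel)"
    unfolding v_def by (intro measurable_If borel_measurable_const measurable_compose[OF _ fc.passage_measurable(2)]) measurable
  have nxt0: "0 \<le> nxt \<omega> s" if "\<omega> \<in> space F" "act \<omega> s" for \<omega> s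
    using alive_height[OF that(1) x, of n] that(2) by (auto simp: act_def nxt_def)
  have un: "u \<omega> s \<in> nonneg_on Up" and vn: "v \<omega> s \<in> nonneg_on Um" if "\<omega> \<in> space F" for \<omega> s
    using fc.passage_nonneg[OF h nxt0[OF that]] by (simp_all add: u_def v_def)
  let ?T = "indicator {\<omega>. T n \<omega> < \<infinity>} :: 'w \<Rightarrow> ennreal"
  let ?I = "\<lambda>\<omega>. \<integral>\<^sup>+s. indicator {0..} s *
      ennreal (flux (u \<omega> s) (v \<omega> s) s (Y n \<omega>)) \<partial>lborel"
  \<comment> \<open>The integral part of the recursion; for a downward state it is obtained by subtracting the part
     without jumps.\<close>
  define rest where "rest \<omega> = (if isl (Y n \<omega>) then ennreal (lpart (Y n \<omega>) \<bullet> up h (Suc k) (?L \<omega>))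
    else ennreal (rpart (Y n \<omega>) \<bullet> down h (Suc k) (?L \<omega>)) - ennreal (rpart (Y n \<omega>) \<bullet> (mexp (?L \<omega> *\<^sub>R Gm) *v h)))" for \<omega>
  have [measurable]: "rest \<in> borel_measurable F" unfolding rest_def by measurable
  let ?al = "indicator {\<omega>. alive x n \<omega>} :: 'w \<Rightarrow> ennreal"
  have I: "?I \<omega> = ?al \<omega> * rest \<omega>" if \<omega>: "\<omega> \<in> space F" for \<omega>
  proof (cases "alive x n \<omega>")
    case True
    note L0 = alive_height[OF \<omega> x True]
    show ?thesis
      using Y_states[OF \<omega>, of n]
    proof (cases rule: states_cases)
      case (1 i a)
      have "?I \<omega> = (\<integral>\<^sup>+s. indicator {0..} s * 
          ennreal (a \<bullet> (mexp (s *\<^sub>R Gp) *v fc.gain_p (up h k (?L \<omega> + s)) (down h k (?L \<omega> + s)))) \<partial>lborel)"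
      proof (rule nn_integral_cong)
        fix s :: real
        show "indicator {0..} s * ennreal (flux (u \<omega> s) (v \<omega> s) s (Y n \<omega>)) = 
          indicator {0..} s * ennreal (a \<bullet> (mexp (s *\<^sub>R Gp) *v fc.gain_p (up h k (?L \<omega> + s)) (down h k (?L \<omega> + s))))"
        proof (cases "0 \<le> s")
          case s: True
          then have "u \<omega> s = up h k (?L \<omega> + s)" "v \<omega> s = down h k (?L \<omega> + s)"
            using True by (simp_all add: u_def v_def act_def nxt_def 1)
          then show ?thesis by (simp only: fc.gain_p_def 1 pairing_simps)
        qed simp
      qed
      also have "\<dots> = ennreal (a \<bullet> up h (Suc k) (?L \<omega>))"
        by (rule fc.up_Suc_nn_integral[OF h 1(3) L0, symmetric])
      finally show ?thesis using True by (simp only: rest_def 1 sum.disc if_True part_simps indicator_simps mem_Collect_eq mult_1)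
    next
      case (2 j b)
      have "?I \<omega> = (\<integral>\<^sup>+s. indicator {0..?L \<omega>} s * 
          ennreal (b \<bullet> (mexp (s *\<^sub>R Gm) *v fc.gain_m (up h k (?L \<omega> - s)) (down h k (?L \<omega> - s)))) \<partial>lborel)"
      proof (rule nn_integral_cong)
        fix s :: real
        show "indicator {0..} s * ennreal (flux (u \<omega> s) (v \<omega> s) s (Y n \<omega>)) = 
          indicator {0..?L \<omega>} s * ennreal (b \<bullet> (mexp (s *\<^sub>R Gm) *v fc.gain_m (up h k (?L \<omega> - s)) (down h k (?L \<omega> - s))))"
        proof (cases "0 \<le> s \<and> s \<le> ?L \<omega>")
          case s: True
          then have "u \<omega> s = up h k (?L \<omega> - s)" "v \<omega> s = down h k (?L \<omega> - s)"
            using True by (simp_all add: u_def v_def act_def nxt_def 2)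
          then have "mexp (s *\<^sub>R Gm) *v ((Cm - Gm) *v v \<omega> s + Dmp *v u \<omega> s) = 
              mexp (s *\<^sub>R Gm) *v fc.gain_m (up h k (?L \<omega> - s)) (down h k (?L \<omega> - s))"
            by (simp only: fc.gain_m_def)
          then show ?thesis using s by (simp only: 2 pairing_simps) simp
        next
          case s: False
          then have "\<not> act \<omega> s" by (auto simp: act_def 2)
          then have "u \<omega> s = 0" "v \<omega> s = 0" by (simp_all add: u_def v_def)
          then show ?thesis using s by (auto simp: 2 mult_linear_simps(20))
        qed
      qed
      also have "\<dots> = ennreal (b \<bullet> down h (Suc k) (?L \<omega>)) - ennreal (b \<bullet> (mexp (?L \<omega> *\<^sub>R Gm) *v h))"
        unfolding fc.down_Suc_nn_integral[OF h 2(3) L0] by (simp add: add_diff_eq_ennreal)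
      finally show ?thesis using True by (simp only: rest_def 2 sum.disc if_False part_simps indicator_simps mem_Collect_eq mult_1)
    qed
  next
    case False
    then have "u \<omega> s = 0" "v \<omega> s = 0" for s by (simp_all add: u_def v_def act_def)
    moreover have "pairing 0 0 (Y n \<omega>) = 0" by (cases "Y n \<omega>") auto
    ultimately show ?thesis using False by (simp add: mult_linear_simps)
  qed
  have next_term: "(\<integral>\<^sup>+\<omega>. passage_value x h k (Suc n) \<omega> \<partial>P \<alpha>) = (\<integral>\<^sup>+\<omega>. ?al \<omega> * rest \<omega> \<partial>P \<alpha>)"
  proof -
    have "(\<integral>\<^sup>+\<omega>. passage_value x h k (Suc n) \<omega> \<partial>P \<alpha>) = (\<integral>\<^sup>+\<omega>. indicator {\<omega>. T (Suc n) \<omega> < \<infinity>} \<omega> * 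
        ennreal (pairing (u \<omega> (sojourn n \<omega>)) (v \<omega> (sojourn n \<omega>)) (Y (Suc n) \<omega>)) \<partial>P \<alpha>)"
    proof (rule nn_integral_cong)
      fix \<omega> assume "\<omega> \<in> space (P \<alpha>)"
      then have \<omega>: "\<omega> \<in> space F" by (simp add: space_M[OF \<alpha>])
      have "pairing 0 0 (Y (Suc n) \<omega>) = 0" by (cases "Y (Suc n) \<omega>") auto
      moreover have "nxt \<omega> (sojourn n \<omega>) = height x (Suc n) \<omega>" by (simp add: nxt_def)
      moreover have "alive x (Suc n) \<omega> \<longleftrightarrow> T (Suc n) \<omega> < \<infinity> \<and> act \<omega> (sojourn n \<omega>)"
        using sojourn_pos[OF \<omega>, of n] by (auto simp: act_def)
      ultimately show "passage_value x h k (Suc n) \<omega> = indicator {\<omega>. T (Suc n) \<omega> < \<infinity>} \<omega> * 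
        ennreal (pairing (u \<omega> (sojourn n \<omega>)) (v \<omega> (sojourn n \<omega>)) (Y (Suc n) \<omega>))"
        by (simp add: passage_value_def u_def v_def indicator_def del: alive.simps height.simps)
    qed
    also have "\<dots> = (\<integral>\<^sup>+\<omega>. ?T \<omega> * ?I \<omega> \<partial>P \<alpha>)"
      by (rule one_step_linear[OF \<alpha> um vm]) (auto intro: un vn)
    also have "\<dots> = (\<integral>\<^sup>+\<omega>. ?al \<omega> * rest \<omega> \<partial>P \<alpha>)"
    proof (rule nn_integral_cong)
      fix \<omega> assume "\<omega> \<in> space (P \<alpha>)"
      then have \<omega>: "\<omega> \<in> space F" by (simp add: space_M[OF \<alpha>])
      show "?T \<omega> * ?I \<omega> = ?al \<omega> * rest \<omega>"
        unfolding I[OF \<omega>] using alive_finite[OF \<omega>, of x n] by (cases "alive x n \<omega>") simp_all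
    qed
    finally show ?thesis .
  qed
  define \<phi> where "\<phi> \<omega> = (if \<omega> \<in> space F \<and> alive x n \<omega> \<and> \<not> isl (Y n \<omega>) then rpart (flw (Y n \<omega>) (?L \<omega>)) \<bullet> h else 0)" for \<omega>
  have \<phi>m: "\<phi> \<in> borel_measurable (H n)"
  proof -
    have "(\<lambda>\<omega>. if alive x n \<omega> \<and> \<not> isl (Y n \<omega>) then rpart (flw (Y n \<omega>) (?L \<omega>)) \<bullet> h else 0) \<in> borel_measurable (H n)"
      by measurable
    then show ?thesis by (rule measurable_cong[THEN iffD1, rotated]) (simp add: \<phi>_def)
  qed
  have flow_Inr: "\<exists>b\<in>Um. Y n \<omega> = Inr b \<and> rpart (flw (Y n \<omega>) (?L \<omega>)) \<in> Um \<and> 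
      (rpart (flw (Y n \<omega>) (?L \<omega>)) \<bullet> h) * survival (Y n \<omega>) (?L \<omega>) = b \<bullet> (mexp (?L \<omega> *\<^sub>R Gm) *v h)"
    if \<omega>: "\<omega> \<in> space F" "alive x n \<omega>" "\<not> isl (Y n \<omega>)" for \<omega>
    using Y_states[OF \<omega>(1), of n]
  proof (cases rule: states_cases)
    case (2 j b)
    note L0 = alive_height[OF \<omega>(1) x \<omega>(2)]
    have "survival (Y n \<omega>) (?L \<omega>) * pairing 0 h (flw (Y n \<omega>) (?L \<omega>)) = b \<bullet> (mexp (?L \<omega> *\<^sub>R Gm) *v h)"
      using survival_flow[OF Y_states[OF \<omega>(1)] L0, of n 0 h] by (simp add: 2)
    moreover obtain b' where b': "flw (Y n \<omega>) (?L \<omega>) = Inr b'"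
      using \<omega>(3) isl_flow[of "Y n \<omega>" "?L \<omega>"] by (cases "flw (Y n \<omega>) (?L \<omega>)") auto
    moreover have "b' \<in> Um" using flow_states[OF Y_states[OF \<omega>(1)] L0, of n] b' by simp
    ultimately show ?thesis using 2 by (auto simp: mult.commute)
  qed (use \<omega> in simp)
  obtain K where K: "K > 0" "\<And>z v. z \<in> Um \<Longrightarrow> \<bar>z \<bullet> v\<bar> \<le> K * norm v" using m.inner_bound by blast
  have hit_term: "(\<integral>\<^sup>+\<omega>. hit_value x h n \<omega> \<partial>P \<alpha>) = 
      (\<integral>\<^sup>+\<omega>. ?al \<omega> * (if isl (Y n \<omega>) then 0 else ennreal (rpart (Y n \<omega>) \<bullet> (mexp (?L \<omega> *\<^sub>R Gm) *v h))) \<partial>P \<alpha>)"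
  proof -
    have "(\<integral>\<^sup>+\<omega>. hit_value x h n \<omega> \<partial>P \<alpha>) = (\<integral>\<^sup>+\<omega>. ?T \<omega> * indicator {\<omega>. \<not> (T (Suc n) \<omega> < \<infinity> \<and> sojourn n \<omega> \<le> ?L \<omega>)} \<omega> * ennreal (\<phi> \<omega>) \<partial>P \<alpha>)"
    proof (rule nn_integral_cong)
      fix \<omega> assume "\<omega> \<in> space (P \<alpha>)"
      then have \<omega>: "\<omega> \<in> space F" by (simp add: space_M[OF \<alpha>])
      show "hit_value x h n \<omega> = ?T \<omega> * indicator {\<omega>. \<not> (T (Suc n) \<omega> < \<infinity> \<and> sojourn n \<omega> \<le> ?L \<omega>)} \<omega> * ennreal (\<phi> \<omega>)"
        using alive_finite[OF \<omega>, of x n] \<omega> 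
        by (cases "alive x n \<omega> \<and> \<not> isl (Y n \<omega>)") (auto simp: hit_value_def hits_def \<phi>_def indicator_def)
    qed
    also have "\<dots> = (\<integral>\<^sup>+\<omega>. ?T \<omega> * ennreal (\<phi> \<omega> * survival (Y n \<omega>) (?L \<omega>)) \<partial>P \<alpha>)"
    proof (rule no_jump_law[OF \<alpha> \<phi>m _ _ height_measurable])
      fix \<omega> assume \<omega>: "\<omega> \<in> space F"
      show "0 \<le> \<phi> \<omega>" unfolding \<phi>_def using flow_Inr[OF \<omega>] nonneg_onD[OF h] by auto
      show "\<phi> \<omega> \<le> K * norm h" unfolding \<phi>_def using flow_Inr[OF \<omega>] K by (auto intro: order_trans[OF abs_ge_self])
      show "0 \<le> ?L \<omega>" if "\<phi> \<omega> \<noteq> 0" using that alive_height[OF \<omega> x, of n] by (auto simp: \<phi>_def split: if_splits)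
    qed
    also have "\<dots> = (\<integral>\<^sup>+\<omega>. ?al \<omega> * (if isl (Y n \<omega>) then 0 else ennreal (rpart (Y n \<omega>) \<bullet> (mexp (?L \<omega> *\<^sub>R Gm) *v h))) \<partial>P \<alpha>)"
    proof (rule nn_integral_cong)
      fix \<omega> assume "\<omega> \<in> space (P \<alpha>)"
      then have \<omega>: "\<omega> \<in> space F" by (simp add: space_M[OF \<alpha>])
      show "?T \<omega> * ennreal (\<phi> \<omega> * survival (Y n \<omega>) (?L \<omega>)) = ?al \<omega> * (if isl (Y n \<omega>) then 0 else ennreal (rpart (Y n \<omega>) \<bullet> (mexp (?L \<omega> *\<^sub>R Gm) *v h)))"
      proof (cases "alive x n \<omega> \<and> \<not> isl (Y n \<omega>)")
        case True
        then show ?thesis using flow_Inr[OF \<omega>] alive_finite[OF \<omega>, of x n] \<omega> by (auto simp: \<phi>_def)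
      qed (auto simp: \<phi>_def)
    qed
    finally show ?thesis .
  qed
  have "(\<integral>\<^sup>+\<omega>. passage_value x h (Suc k) n \<omega> \<partial>P \<alpha>) = (\<integral>\<^sup>+\<omega>. 
      ?al \<omega> * (if isl (Y n \<omega>) then 0 else ennreal (rpart (Y n \<omega>) \<bullet> (mexp (?L \<omega> *\<^sub>R Gm) *v h))) + ?al \<omega> * rest \<omega> \<partial>P \<alpha>)"
  proof (rule nn_integral_cong)
    fix \<omega> assume "\<omega> \<in> space (P \<alpha>)"
    then have \<omega>: "\<omega> \<in> space F" by (simp add: space_M[OF \<alpha>])
    show "passage_value x h (Suc k) n \<omega> = ?al \<omega> * (if isl (Y n \<omega>) then 0 else ennreal (rpart (Y n \<omega>) \<bullet> (mexp (?L \<omega> *\<^sub>R Gm) *v h))) + ?al \<omega> * rest \<omega>"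
    proof (cases "alive x n \<omega>")
      case True
      show ?thesis
        using Y_states[OF \<omega>, of n]
      proof (cases rule: states_cases)
        case (1 i a)
        then show ?thesis using True by (simp add: passage_value_def rest_def)
      next
        case (2 j b)
        show ?thesis 
          using True fc.down_Suc_nn_integral[OF h 2(3) alive_height[OF \<omega> x True], of k]
          by (simp add: passage_value_def rest_def 2 add_diff_eq_ennreal)
      qed
    qed (simp add: passage_value_def)
  qed
  also have "\<dots> = (\<integral>\<^sup>+\<omega>. hit_value x h n \<omega> \<partial>P \<alpha>) + (\<integral>\<^sup>+\<omega>. passage_value x h k (Suc n) \<omega> \<partial>P \<alpha>)"
    unfolding hit_term next_term by (rule nn_integral_add) measurable
  finally show ?thesis .
qed

lemma passage_value_sum:
  assumes \<alpha>: "\<alpha> \<in> states" and x: "0 \<le> x" and h: "h \<in> nonneg_on Um"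
  shows "(\<integral>\<^sup>+\<omega>. passage_value x h k n \<omega> \<partial>P \<alpha>) = (\<Sum>l<k. \<integral>\<^sup>+\<omega>. hit_value x h (n + l) \<omega> \<partial>P \<alpha>)"
proof (induction k arbitrary: n)
  case 0
  have "passage_value x h 0 n \<omega> = 0" for \<omega> by (cases "Y n \<omega>") (auto simp: passage_value_def)
  then show ?case by simp
next
  case (Suc k)
  show ?case
    unfolding passage_value_step[OF assms] Suc.IH by (simp only: sum.lessThan_Suc_shift) simp
qed

lemma down_eq_hit_sum:
  assumes b: "b \<in> Um" and x: "0 \<le> x" and h: "h \<in> nonneg_on Um"
  shows "ennreal (b \<bullet> down h k x) = (\<Sum>l<k. \<integral>\<^sup>+\<omega>. hit_value x h l \<omega> \<partial>P (Inr b))"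
proof -
  have \<alpha>: "Inr b \<in> states" using b by simp
  interpret prob_space "P (Inr b)" by (rule prob[OF \<alpha>])
  have "(\<integral>\<^sup>+\<omega>. passage_value x h k 0 \<omega> \<partial>P (Inr b)) = (\<integral>\<^sup>+\<omega>. ennreal (b \<bullet> down h k x) \<partial>P (Inr b))"
  proof (rule nn_integral_cong_AE)
    show "AE \<omega> in P (Inr b). passage_value x h k 0 \<omega> = ennreal (b \<bullet> down h k x)"
      using start[OF \<alpha>] AE_space
    proof eventually_elim
      case (elim \<omega>)
      then have "\<omega> \<in> space F" by (simp add: space_M[OF \<alpha>])
      then show ?case using elim(1) T_0[of \<omega>] by (simp add: passage_value_def post_jump_def)
    qed
  qed
  also have "\<dots> = ennreal (b \<bullet> down h k x)" by (simp add: emeasure_space_1 del: space_M)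
  finally show ?thesis using passage_value_sum[OF \<alpha> x h, of k 0] by simp
qed

end

section \<open>Paths of the level process\<close>

context rap_fluid
begin

text \<open>
  The set of times at which the orbit moves up, as a countable union of intervals. In this form
  its indicator is a Borel function of time.
\<close>
definition up_times :: "'w \<Rightarrow> real set" where
  "up_times \<omega> = (\<Union>n\<in>{n. isl (Y n \<omega>)}. {s. T n \<omega> \<le> ereal s \<and> ereal s < T (Suc n) \<omega>})"

definition direction :: "'w \<Rightarrow> real \<Rightarrow> real" where
  "direction \<omega> s = (if s \<in> up_times \<omega> then 1 else - 1)"

lemma direction_measurable [measurable]: "direction \<omega> \<in> borel_measurable borel"
proof -
  have [measurable]: "up_times \<omega> \<in> sets borel"
    unfolding up_times_def by (rule sets.countable_UN') auto
  show ?thesis unfolding direction_def by measurable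
qed

lemma interval_unique:
  assumes "\<omega> \<in> space F" "T n \<omega> \<le> ereal s" "ereal s < T (Suc n) \<omega>" "T m \<omega> \<le> ereal s" "ereal s < T (Suc m) \<omega>"
  shows "m = n"
proof (rule ccontr)
  have *: False if "n < m" "T m \<omega> \<le> ereal s" "ereal s < T (Suc n) \<omega>" for m n
    using T_mono[OF assms(1), of "Suc n" m] that by (meson Suc_leI leD order_trans)
  assume "m \<noteq> n"
  then show False using *[of n m] *[of m n] assms by (meson linorder_neqE_nat)
qed

lemma direction_between:
  assumes "\<omega> \<in> space F" "T n \<omega> \<le> ereal s" "ereal s < T (Suc n) \<omega>"
  shows "direction \<omega> s = (if isl (Y n \<omega>) then 1 else - 1)"
proof -
  have "s \<in> up_times \<omega> \<longleftrightarrow> isl (Y n \<omega>)"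
    unfolding up_times_def using assms interval_unique[OF assms] by blast
  then show ?thesis by (simp add: direction_def)
qed

lemma level_direction:
  assumes \<omega>: "\<omega> \<in> space F"
  shows "level Zp Zm A t \<omega> = integral {0..t} (direction \<omega>)" "direction \<omega> integrable_on {0..t}"
proof -
  have int: "set_integrable lborel {0..t} (direction \<omega>)"
    by (rule set_integrable_Icc_bounded[where B=1]) (auto simp: direction_def)
  have "level Zp Zm A t \<omega> = (LBINT s:{0..t}. direction \<omega> s)"
    unfolding level_def
  proof (rule set_lebesgue_integral_cong)
    show "\<forall>s. s \<in> {0..t} \<longrightarrow> indicator (Inl ` Up) (A s \<omega>) - indicator (Inr ` Um) (A s \<omega>) = direction \<omega> s"
    proof (intro allI impI)
      fix s assume "s \<in> {0..t}"
      then have s: "0 \<le> s" by simp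
      obtain n where n: "T n \<omega> \<le> ereal s" "ereal s < T (Suc n) \<omega>" using jump_interval[OF \<omega> s] by blast
      have "isl (A s \<omega>) \<longleftrightarrow> isl (Y n \<omega>)" using A_between(1)[OF \<omega> n] by simp
      then show "indicator (Inl ` Up) (A s \<omega>) - indicator (Inr ` Um) (A s \<omega>) = direction \<omega> s"
        unfolding direction_between[OF \<omega> n]
        by (rule_tac states_cases[OF A_in_states[OF s \<omega>]]) (simp_all add: indicator_def image_iff)
    qed
  qed simp
  then show "level Zp Zm A t \<omega> = integral {0..t} (direction \<omega>)" "direction \<omega> integrable_on {0..t}"
    using set_borel_integral_eq_integral[OF int] by simp_all
qed

lemma level_between:
  assumes \<omega>: "\<omega> \<in> space F" and n: "T n \<omega> < \<infinity>" and u: "0 \<le> u" "T n \<omega> + ereal u \<le> T (Suc n) \<omega>"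
  shows "level Zp Zm A (real_of_ereal (T n \<omega>) + u) \<omega> = 
    level Zp Zm A (real_of_ereal (T n \<omega>)) \<omega> + (if isl (Y n \<omega>) then u else - u)"
proof -
  define s where "s = real_of_ereal (T n \<omega>)"
  have s: "0 \<le> s" "T n \<omega> = ereal s" using T_nonneg[OF \<omega>, of n] T_real[OF \<omega> n] by (auto simp: s_def real_of_ereal_pos)
  have "integral {0..s} (direction \<omega>) + integral {s..s + u} (direction \<omega>) = integral {0..s + u} (direction \<omega>)"
    using s u by (intro Henstock_Kurzweil_Integration.integral_combine level_direction(2)[OF \<omega>]) auto
  moreover have "integral {s..s + u} (direction \<omega>) = integral {s..s + u} (\<lambda>_. if isl (Y n \<omega>) then 1 else - 1)"
  proof (rule integral_spike[of "{s + u}"])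
    fix r assume r: "r \<in> {s..s + u} - {s + u}"
    have "ereal r < ereal (s + u)" using r by simp
    also have "\<dots> \<le> T (Suc n) \<omega>" using u(2) by (simp add: s)
    finally show "(if isl (Y n \<omega>) then 1 else - 1) = direction \<omega> r"
      using direction_between[OF \<omega>, of n r] r by (simp add: s)
  qed simp
  ultimately show ?thesis
    unfolding level_direction(1)[OF \<omega>] s_def[symmetric] using u by (cases "isl (Y n \<omega>)") auto
qed

lemma level_zero: "\<omega> \<in> space F \<Longrightarrow> level Zp Zm A 0 \<omega> = 0"
  by (simp add: level_direction)

lemma level_height:
  assumes \<omega>: "\<omega> \<in> space F"
  shows "T n \<omega> < \<infinity> \<Longrightarrow> level Zp Zm A (real_of_ereal (T n \<omega>)) \<omega> = height x n \<omega> - x"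
proof (induction n)
  case 0
  then show ?case by (simp add: T_0[OF \<omega>] level_zero[OF \<omega>])
next
  case (Suc n)
  note fin = T_Suc_finite[OF \<omega> Suc.prems]
  have eq: "real_of_ereal (T (Suc n) \<omega>) = real_of_ereal (T n \<omega>) + sojourn n \<omega>" by (simp add: sojourn_def)
  have "T n \<omega> + ereal (sojourn n \<omega>) = T (Suc n) \<omega>"
    using T_real[OF \<omega> fin] T_real[OF \<omega> Suc.prems] eq by (metis plus_ereal.simps(1))
  then show ?case
    unfolding eq using level_between[OF \<omega> fin less_imp_le[OF sojourn_pos[OF \<omega> Suc.prems]]] Suc.IH[OF fin] by simp
qed

definition hitting_times :: "real \<Rightarrow> 'w \<Rightarrow> real set" where
  "hitting_times x \<omega> = {t. t \<ge> 0 \<and> level Zp Zm A t \<omega> = - x \<and> A t \<omega> \<in> Inr ` Um}"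

text \<open>
  Within one sojourn the level is affine in time, so a downward state meets the target level at
  exactly one candidate time.
\<close>
lemma hitting_times_between:
  assumes \<omega>: "\<omega> \<in> space F" and t: "T n \<omega> \<le> ereal t" "ereal t < T (Suc n) \<omega>"
  shows "t \<in> hitting_times x \<omega> \<longleftrightarrow> \<not> isl (Y n \<omega>) \<and> t = real_of_ereal (T n \<omega>) + height x n \<omega>"
proof -
  define u where "u = t - real_of_ereal (T n \<omega>)"
  have fin: "T n \<omega> < \<infinity>" using t(1) by auto
  have u0: "0 \<le> u" using A_between(2)[OF \<omega> t] by (simp add: u_def)
  have tu: "t = real_of_ereal (T n \<omega>) + u" by (simp add: u_def)
  have t0: "0 \<le> t" using u0 T_nonneg[OF \<omega>, of n] by (simp add: tu real_of_ereal_pos)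
  have "T n \<omega> + ereal u = ereal t" using T_real[OF \<omega> fin] tu by (metis plus_ereal.simps(1))
  then have lev: "level Zp Zm A t \<omega> = height x n \<omega> - x + (if isl (Y n \<omega>) then u else - u)"
    using level_between[OF \<omega> fin u0] t(2) level_height[OF \<omega> fin, of x] by (simp add: tu[symmetric] less_imp_le)
  have "A t \<omega> \<in> Inr ` Um \<longleftrightarrow> \<not> isl (A t \<omega>)"
    by (rule states_cases[OF A_in_states[OF t0 \<omega>]]) (simp_all add: image_iff)
  then have side: "A t \<omega> \<in> Inr ` Um \<longleftrightarrow> \<not> isl (Y n \<omega>)" using A_between(1)[OF \<omega> t] by simp
  show ?thesis
    unfolding hitting_times_def mem_Collect_eq side using t0 lev by (cases "isl (Y n \<omega>)") (auto simp: tu)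
qed

text \<open>
  Within an earlier sojourn the candidate time would lie at or beyond the end of that sojourn.
\<close>
lemma alive_no_earlier_hit:
  assumes \<omega>: "\<omega> \<in> space F" 
  shows "alive x n \<omega> \<Longrightarrow> t \<in> hitting_times x \<omega> \<Longrightarrow> T n \<omega> \<le> ereal t"
proof (induction n)
  case 0
  then show ?case by (simp add: T_0[OF \<omega>] hitting_times_def)
next
  case (Suc n)
  have Tn: "T n \<omega> \<le> ereal t" using Suc by simp
  show ?case
  proof (rule ccontr)
    assume "\<not> T (Suc n) \<omega> \<le> ereal t"
    then have lt: "ereal t < T (Suc n) \<omega>" by simp
    from hitting_times_between[OF \<omega> Tn lt] Suc.prems(2) 
    have *: "\<not> isl (Y n \<omega>)" "t = real_of_ereal (T n \<omega>) + height x n \<omega>" by auto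
    have fin: "T (Suc n) \<omega> < \<infinity>" using Suc.prems(1) by simp
    have "t < real_of_ereal (T (Suc n) \<omega>)" using lt T_real[OF \<omega> fin] by (metis less_ereal.simps(1))
    then have "height x n \<omega> < sojourn n \<omega>" using *(2) by (simp add: sojourn_def)
    then show False using Suc.prems(1) *(1) by simp
  qed
qed

lemma hits_unique:
  assumes "hits x n \<omega>" "hits x m \<omega>"
  shows "m = n"
proof (rule ccontr)
  have down: "alive x m \<omega> \<Longrightarrow> k \<le> m \<Longrightarrow> alive x k \<omega>" for m k
    by (induction m) (auto simp: le_Suc_eq)
  have *: False if "n < m" "hits x n \<omega>" "hits x m \<omega>" for m n
    using down[of m "Suc n"] that by (auto simp: hits_def)
  assume "m \<noteq> n"
  then show False using * assms by (meson linorder_neqE_nat)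
qed

lemma hits_position:
  assumes \<omega>: "\<omega> \<in> space F" and x: "0 \<le> x" and hit: "hits x n \<omega>"
  defines "t \<equiv> real_of_ereal (T n \<omega>) + height x n \<omega>"
  shows "T n \<omega> \<le> ereal t" "ereal t < T (Suc n) \<omega>"
proof -
  have alive: "alive x n \<omega>" using hit by (simp add: hits_def)
  note fin = alive_finite[OF \<omega> alive] and L0 = alive_height[OF \<omega> x alive]
  have t: "T n \<omega> + ereal (height x n \<omega>) = ereal t" 
    unfolding t_def using T_real[OF \<omega> fin] by (metis plus_ereal.simps(1))
  show "T n \<omega> \<le> ereal t" using T_real[OF \<omega> fin] L0 unfolding t_def by (metis ereal_less_eq(3) le_add_same_cancel1)
  show "ereal t < T (Suc n) \<omega>"
    using sojourn_le_iff[OF \<omega> fin, of "height x n \<omega>"] hit t by (auto simp: hits_def not_le[symmetric])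
qed

text \<open>
  The candidate time of the hitting sojourn is the least hitting time, so the infimum in
  \<open>tau_minus\<close> is attained there.
\<close>
lemma minus_vector_hit:
  assumes \<omega>: "\<omega> \<in> space F" and x: "0 \<le> x" and hit: "hits x n \<omega>"
  shows "minus_vector (down_orbit Zp Zm A x \<omega>) = rpart (flw (Y n \<omega>) (height x n \<omega>))"
proof -
  define t where "t = real_of_ereal (T n \<omega>) + height x n \<omega>"
  note pos = hits_position[OF assms, folded t_def]
  have alive: "alive x n \<omega>" and down: "\<not> isl (Y n \<omega>)" using hit by (simp_all add: hits_def)
  have mem: "t \<in> hitting_times x \<omega>" unfolding hitting_times_between[OF \<omega> pos] using down by (simp add: t_def)
  have "Inf (ereal ` hitting_times x \<omega>) = ereal t"
  proof (rule Inf_eqI)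
    fix i assume "i \<in> ereal ` hitting_times x \<omega>"
    then obtain s where s: "i = ereal s" "s \<in> hitting_times x \<omega>" by blast
    have Tn: "T n \<omega> \<le> ereal s" by (rule alive_no_earlier_hit[OF \<omega> alive s(2)])
    show "ereal t \<le> i"
    proof (rule ccontr)
      assume "\<not> ereal t \<le> i"
      then have "ereal s < ereal t" by (simp add: s)
      then have "s = t" 
        using hitting_times_between[OF \<omega> Tn, of x] s(2) pos(2) unfolding t_def by (metis less_trans)
      then show False using \<open>ereal s < ereal t\<close> by simp
    qed
  qed (use mem in blast)
  then have tau: "tau_minus Zp Zm A x \<omega> = ereal t" unfolding tau_minus_def hitting_times_def .
  have "A t \<omega> = flw (Y n \<omega>) (height x n \<omega>)" using A_between(1)[OF \<omega> pos] by (simp add: t_def)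
  moreover have "\<not> isl (flw (Y n \<omega>) (height x n \<omega>))" using down by simp
  ultimately show ?thesis
    by (cases "flw (Y n \<omega>) (height x n \<omega>)") (simp_all add: down_orbit_def tau minus_vector_def)
qed

text \<open>
  Without a hitting sojourn every jump that occurs is reached alive, so a hitting time would
  make its own sojourn a hitting one.
\<close>
lemma minus_vector_no_hit:
  assumes \<omega>: "\<omega> \<in> space F" and no: "\<And>n. \<not> hits x n \<omega>"
  shows "minus_vector (down_orbit Zp Zm A x \<omega>) = 0"
proof -
  have alive: "T n \<omega> < \<infinity> \<Longrightarrow> alive x n \<omega>" for n
  proof (induction n)
    case (Suc n)
    then have "alive x n \<omega>" using T_Suc_finite[OF \<omega>] by blast
    then show ?case using no[of n] Suc.prems by (auto simp: hits_def)
  qed simp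
  have "hitting_times x \<omega> = {}"
  proof (rule ccontr)
    assume "hitting_times x \<omega> \<noteq> {}"
    then obtain t where t: "t \<in> hitting_times x \<omega>" by blast
    then have "0 \<le> t" by (simp add: hitting_times_def)
    then obtain n where n: "T n \<omega> \<le> ereal t" "ereal t < T (Suc n) \<omega>" using jump_interval[OF \<omega>] by blast
    have fin: "T n \<omega> < \<infinity>" using n(1) by auto
    from hitting_times_between[OF \<omega> n] t have *: "\<not> isl (Y n \<omega>)" "t = real_of_ereal (T n \<omega>) + height x n \<omega>" by auto
    have "T n \<omega> + ereal (height x n \<omega>) = ereal t" 
      using T_real[OF \<omega> fin] *(2) by (metis plus_ereal.simps(1))
    then have "\<not> T (Suc n) \<omega> \<le> T n \<omega> + ereal (height x n \<omega>)" using n(2) by (simp add: not_le)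
    then have "hits x n \<omega>" using alive[OF fin] *(1) sojourn_le_iff[OF \<omega> fin] by (simp add: hits_def)
    then show False using no by blast
  qed
  moreover have "tau_minus Zp Zm A x \<omega> = Inf (ereal ` hitting_times x \<omega>)"
    by (simp only: tau_minus_def hitting_times_def)
  ultimately have "tau_minus Zp Zm A x \<omega> = \<infinity>" by (simp add: top_ereal_def)
  then show ?thesis by (simp add: down_orbit_def minus_vector_def)
qed

definition hit_vector :: "real \<Rightarrow> nat \<Rightarrow> 'w \<Rightarrow> real^'m" where
  "hit_vector x n \<omega> = (if hits x n \<omega> then rpart (flw (Y n \<omega>) (height x n \<omega>)) else 0)"

lemma hit_vector_measurable [measurable]: "hit_vector x n \<in> borel_measurable F"
  unfolding hit_vector_def by measurable

text \<open>
  At most one sojourn is a hitting one; this gives measurability of the passage state and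
  additivity of its expectation over the sojourns.
\<close>
lemma minus_vector_sums:
  assumes \<omega>: "\<omega> \<in> space F" and x: "0 \<le> x"
  shows "(\<lambda>n. hit_vector x n \<omega>) sums minus_vector (down_orbit Zp Zm A x \<omega>)"
proof (cases "\<exists>n. hits x n \<omega>")
  case True
  then obtain n where n: "hits x n \<omega>" by blast
  have "hit_vector x m \<omega> = 0" if "m \<noteq> n" for m
    using that hits_unique[OF n, of m] by (auto simp: hit_vector_def)
  then show ?thesis
    using sums_finite[of "{n}" "\<lambda>n. hit_vector x n \<omega>"] minus_vector_hit[OF \<omega> x n] n by (simp add: hit_vector_def)
next
  case False
  then have "hit_vector x n \<omega> = 0" for n by (simp add: hit_vector_def)
  moreover have "minus_vector (down_orbit Zp Zm A x \<omega>) = 0" using False by (intro minus_vector_no_hit \<omega>) blast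
  ultimately show ?thesis by simp
qed

lemma minus_vector_measurable:
  assumes x: "0 \<le> x"
  shows "(\<lambda>\<omega>. minus_vector (down_orbit Zp Zm A x \<omega>)) \<in> borel_measurable F"
proof (rule borel_measurable_LIMSEQ_metric)
  show "(\<lambda>\<omega>. \<Sum>n<k. hit_vector x n \<omega>) \<in> borel_measurable F" for k by measurable
  show "(\<lambda>k. \<Sum>n<k. hit_vector x n \<omega>) \<longlonglongrightarrow> minus_vector (down_orbit Zp Zm A x \<omega>)" if "\<omega> \<in> space F" for \<omega>
    using minus_vector_sums[OF that x] by (simp add: sums_def)
qed

lemma hit_vector_nonneg:
  assumes \<omega>: "\<omega> \<in> space F" and x: "0 \<le> x" and h: "h \<in> nonneg_on Um"
  shows "0 \<le> hit_vector x n \<omega> \<bullet> h"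
proof (cases "hits x n \<omega>")
  case True
  then have "alive x n \<omega>" "\<not> isl (Y n \<omega>)" by (simp_all add: hits_def)
  note L0 = alive_height[OF \<omega> x this(1)]
  have "flw (Y n \<omega>) (height x n \<omega>) \<in> states" by (rule flow_states[OF Y_states[OF \<omega>] L0])
  then show ?thesis
    using \<open>\<not> isl (Y n \<omega>)\<close> isl_flow[of "Y n \<omega>" "height x n \<omega>"] nonneg_onD[OF h] True
    by (cases "flw (Y n \<omega>) (height x n \<omega>)") (simp_all add: hit_vector_def del: isl_flow)
qed (simp add: hit_vector_def)

text \<open>
  For nonnegative \<open>h\<close> the contributions of the sojourns are nonnegative, so the
  expectation of their sum is the limit of the iterates by monotone convergence.
\<close>
theorem down_orbit_functional:
  assumes b: "b \<in> Um" and x: "0 \<le> x" and h: "h \<in> nonneg_on Um"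
  shows "has_bochner_integral (P (Inr b)) (\<lambda>\<omega>. minus_vector (down_orbit Zp Zm A x \<omega>) \<bullet> h)
    (b \<bullet> (mexp (x *\<^sub>R (Cm + Dmp ** Psi Cp Cm Dpm Dmp)) *v h))"
proof (rule has_bochner_integral_nn_integral)
  have \<alpha>: "Inr b \<in> states" using b by simp
  note [measurable_cong] = sets_P[OF \<alpha>]
  note [measurable] = minus_vector_measurable[OF x]
  let ?O = "\<lambda>\<omega>. minus_vector (down_orbit Zp Zm A x \<omega>)"
  let ?v = "b \<bullet> (mexp (x *\<^sub>R (Cm + Dmp ** Psi Cp Cm Dpm Dmp)) *v h)"
  have sums: "(\<lambda>n. hit_vector x n \<omega> \<bullet> h) sums (?O \<omega> \<bullet> h)" if "\<omega> \<in> space F" for \<omega>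
    using minus_vector_sums[OF that x] by (rule bounded_linear.sums[OF bounded_linear_inner_left])
  have nn: "0 \<le> ?O \<omega> \<bullet> h" if "\<omega> \<in> space F" for \<omega>
    using sums_le[OF _ sums_zero sums[OF that]] hit_vector_nonneg[OF that x h] by simp
  show "(\<lambda>\<omega>. ?O \<omega> \<bullet> h) \<in> borel_measurable (P (Inr b))" by measurable
  show "AE \<omega> in P (Inr b). 0 \<le> ?O \<omega> \<bullet> h" using nn by (intro AE_I2) (simp add: space_M[OF \<alpha>])
  show "0 \<le> ?v" by (rule nonneg_onD[OF cone_mapD[OF fc.down_generator_cone[OF x] h] b])
  have hv[measurable]: "hit_value x h n \<in> borel_measurable F" for n unfolding hit_value_def by measurable
  have "(\<integral>\<^sup>+\<omega>. ennreal (?O \<omega> \<bullet> h) \<partial>P (Inr b)) = (\<integral>\<^sup>+\<omega>. (\<Sum>n. hit_value x h n \<omega>) \<partial>P (Inr b))"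
  proof (rule nn_integral_cong)
    fix \<omega> assume "\<omega> \<in> space (P (Inr b))"
    then have \<omega>: "\<omega> \<in> space F" by (simp add: space_M[OF \<alpha>])
    have "hit_value x h n \<omega> = ennreal (hit_vector x n \<omega> \<bullet> h)" for n
      by (simp add: hit_value_def hit_vector_def)
    then have "(\<Sum>n. hit_value x h n \<omega>) = ennreal (\<Sum>n. hit_vector x n \<omega> \<bullet> h)"
      using suminf_ennreal2[OF hit_vector_nonneg[OF \<omega> x h] sums_summable[OF sums[OF \<omega>]]] by simp
    then show "ennreal (?O \<omega> \<bullet> h) = (\<Sum>n. hit_value x h n \<omega>)" using sums_unique[OF sums[OF \<omega>]] by simp
  qed
  also have "\<dots> = (\<Sum>n. \<integral>\<^sup>+\<omega>. hit_value x h n \<omega> \<partial>P (Inr b))" by (rule nn_integral_suminf) measurable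
  also have "\<dots> = ennreal ?v"
  proof (rule LIMSEQ_unique)
    show "(\<lambda>k. \<Sum>n<k. \<integral>\<^sup>+\<omega>. hit_value x h n \<omega> \<partial>P (Inr b)) \<longlonglongrightarrow> (\<Sum>n. \<integral>\<^sup>+\<omega>. hit_value x h n \<omega> \<partial>P (Inr b))"
      by (rule summable_LIMSEQ) simp
    have "(\<lambda>k. b \<bullet> down h k x) \<longlonglongrightarrow> ?v"
      using tendsto_inner[OF tendsto_const fc.passage_limits(2)[OF h x], of b] unfolding fc.down_limit_eq[OF h x] .
    then show "(\<lambda>k. \<Sum>n<k. \<integral>\<^sup>+\<omega>. hit_value x h n \<omega> \<partial>P (Inr b)) \<longlonglongrightarrow> ennreal ?v"
      unfolding down_eq_hit_sum[OF b x h, symmetric] by (rule tendsto_ennrealI)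
  qed
  finally show "(\<integral>\<^sup>+\<omega>. ennreal (?O \<omega> \<bullet> h) \<partial>P (Inr b)) = ennreal ?v" .
qed

text \<open>
  Every coordinate vector is a difference of two nonnegative vectors, the second a multiple of
  \<open>1\<close>.
\<close>
theorem down_orbit_expectation:
  assumes b: "b \<in> Um" and x: "0 \<le> x"
  shows "has_bochner_integral (P (Inr b)) (\<lambda>\<omega>. minus_vector (down_orbit Zp Zm A x \<omega>))
    (b v* mexp (x *\<^sub>R (Cm + Dmp ** Psi Cp Cm Dpm Dmp)))"
proof -
  let ?O = "\<lambda>\<omega>. minus_vector (down_orbit Zp Zm A x \<omega>)"
  let ?E = "mexp (x *\<^sub>R (Cm + Dmp ** Psi Cp Cm Dpm Dmp))"
  have comp: "has_bochner_integral (P (Inr b)) (\<lambda>\<omega>. ?O \<omega> $ i) ((b v* ?E) $ i)" for i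
  proof -
    obtain L where L: "L > 0" "\<And>v. (L * norm v) *\<^sub>R 1 + v \<in> nonneg_on Um" using m.order_unit by metis
    define e :: "real^'m" where "e = axis i 1"
    let ?c = "(L * norm e) *\<^sub>R 1 :: real^'m"
    have "?c \<in> nonneg_on Um" using L(1) by (intro nonneg_on_scaleR m.one_nonneg) auto
    from has_bochner_integral_diff[OF down_orbit_functional[OF b x L(2)[of e]] down_orbit_functional[OF b x this]]
    have "has_bochner_integral (P (Inr b)) (\<lambda>\<omega>. ?O \<omega> \<bullet> e) (b \<bullet> (?E *v e))"
      by (simp add: mult_linear_simps inner_add_right)
    then show ?thesis by (simp add: e_def inner_axis vector_matrix_inner[symmetric])
  qed
  have expand: "(\<Sum>i\<in>UNIV. v $ i *\<^sub>R axis i 1) = v" for v :: "real^'m"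
    using basis_expansion[of v] by (simp add: scalar_mult_eq_scaleR)
  have "has_bochner_integral (P (Inr b)) (\<lambda>\<omega>. \<Sum>i\<in>UNIV. ?O \<omega> $ i *\<^sub>R (axis i 1 :: real^'m)) 
      (\<Sum>i\<in>UNIV. (b v* ?E) $ i *\<^sub>R (axis i 1 :: real^'m))"
    by (intro has_bochner_integral_sum has_bochner_integral_scaleR_left comp)
  then show ?thesis by (simp only: expand)
qed

end

theorem theorem4p4:
  fixes bp :: "'p::finite \<Rightarrow> 'i::finite" and bm :: "'m::finite \<Rightarrow> 'j::finite"
    and Zp :: "'i \<Rightarrow> (real^'p) set" and Zm :: "'j \<Rightarrow> (real^'m) set"
    and Cp :: "real^'p^'p" and Cm :: "real^'m^'m"
    and Dpm :: "real^'m^'p" and Dmp :: "real^'p^'m"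
    and F :: "'w measure" and P :: "('p, 'm) state \<Rightarrow> 'w measure"
    and A :: "real \<Rightarrow> 'w \<Rightarrow> ('p, 'm) state" and T :: "nat \<Rightarrow> 'w \<Rightarrow> ereal"
    and \<beta> :: "real^'m" and x :: real
  assumes "rap_fluid bp bm Zp Zm Cp Cm Dpm Dmp F P A T"
    and "\<beta> \<in> (\<Union>j. Zm j)" and "x \<ge> 0"
  shows "has_bochner_integral (P (Inr \<beta>))
           (\<lambda>\<omega>. minus_vector (down_orbit Zp Zm A x \<omega>))
           (\<beta> v* mexp (x *\<^sub>R (Cm + Dmp ** Psi Cp Cm Dpm Dmp)))"
  by (rule rap_fluid.down_orbit_expectation[OF assms])

end
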